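(* Let $\alpha>1$ be a fixed irrational number of finite type $\tau<\infty$ and let $\beta\in\mathbb{Z}$ be a fixed integer. Then for every $\varepsilon>0$, for all integers $c,d$ with $d\ge 1$ and $\gcd(c,d)=1$, and all sufficiently large integers $N$, \[ \sum_{\substack{n\leq N,\ n\in\mathcal{B}_{\alpha,\beta}\\ n\equiv c \ (\mathrm{mod}\ d)}}\Lambda(n) =\alpha^{-1}\sum_{\substack{m\leq N\\ m \equiv c \ (\mathrm{mod}\ d)}}\Lambda(m) +O\!\left(N^{1-1/(3\tau+2)+\varepsilon}\right), \] where the implied constant depends only on $\alpha$, $\beta$ and $\varepsilon$ (and not on $c,d$; when $\beta=0$ the dependence on $\beta$ may be removed).
   Context: $\Lambda$ is the von Mangoldt function and $[x]$ denotes the greatest integer not exceeding $x$. For fixed reals $\alpha,\beta$ the Beatty sequence is $\mathcal{B}_{\alpha,\beta}=\{[\alpha n+\beta]: n=1,2,3,\dots\}$. For a real $x$, $\|x\|$ denotes the distance from $x$ to the nearest integer. The type of an irrational number $\alpha$ is $\tau=\sup\{\theta\in\mathbb{R}: \liminf_{q\to\infty,\,q\in\mathbb{Z}^+} q^{\theta}\|\alpha q\|=0\}$; $\alpha$ is of finite type if $\tau<\infty$. *)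

theory Defs
  imports "HOL-Analysis.Analysis" "HOL-Number_Theory.Number_Theory"
begin

definition beatty :: "real \<Rightarrow> real \<Rightarrow> int set" where
  "beatty \<alpha> \<beta> = {\<lfloor>\<alpha> * real n + \<beta>\<rfloor> | n :: nat. n \<ge> 1}"

definition dist_nearest_int :: "real \<Rightarrow> real" where
  "dist_nearest_int x = \<bar>x - of_int (round x)\<bar>"

(* The supremum and the lower limits are taken in the extended reals, so that the type may be
   infinite.  The index q = 0 is irrelevant for the lower limit. *)
definition irrationality_type :: "real \<Rightarrow> ereal" where
  "irrationality_type \<alpha> =
     Sup (ereal ` {\<theta> :: real.
       liminf (\<lambda>q :: nat. ereal (real q powr \<theta> * dist_nearest_int (\<alpha> * real q))) = 0})"

end

theory Submission
  imports Defs "HOL-Computational_Algebra.Squarefree"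
begin

text \<open>
  With \<open>\<gamma> = 1 / \<alpha>\<close>, the indicator of the Beatty sequence at \<open>n > \<beta>\<close> is \<open>\<lfloor>\<gamma> (n + 1 - \<beta>)\<rfloor> - \<lfloor>\<gamma> (n - \<beta>)\<rfloor>\<close>, so
  the error is a sum of the sawtooth function weighted by \<open>\<Lambda>\<close>. The sawtooth lies, up to \<open>\<Delta> / 2\<close>,
  between two difference quotients with step \<open>\<Delta>\<close> of the periodic second Bernoulli function, whose Fourier
  series converges absolutely; this leaves the sums \<open>S(k) = \<Sum> \<Lambda>(n) e(k \<gamma> n)\<close> over the progression.

  Write \<open>\<Lambda>\<^bsub>>U\<^esub> = \<mu> * B\<close> with \<open>B = 1 * \<Lambda>\<^bsub>>U\<^esub>\<close>, so that \<open>0 \<le> B \<le> ln\<close> and no divisor function appears.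
  The terms with \<open>b \<le> U\<close> in \<open>\<mu>(b)\<close> give sums over progressions of modulus \<open>d\<close> with frequencies
  \<open>k \<gamma> d t\<close>; the others are treated dyadically by Cauchy-Schwarz and give the frequencies \<open>k \<gamma> d\<^sup>2 j\<close>.
  Choosing the Dirichlet denominators of \<open>k \<gamma> d\<close> and \<open>k \<gamma> d\<^sup>2\<close> by means of the irrationality measure makes the
  powers of \<open>d\<close> cancel, whence with \<open>\<sigma> = 1 / (3 \<tau> + 2)\<close>, \<open>U = N powr (2 \<sigma>)\<close> and \<open>\<Delta> = N powr (- \<sigma>)\<close>
  \<open>S(k)\<close> is at most \<open>N powr (1 - \<sigma>) * (1 + sqrt (k \<Delta>))\<close> up to logarithms for \<open>d \<le> N powr \<sigma>\<close>; for larger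
  \<open>d\<close> the trivial bound suffices.
\<close>

section \<open>The Fourier series of the second Bernoulli function\<close>

text \<open>The sawtooth has Fourier coefficients of size \<open>1 / k\<close>, too large to sum
  absolutely. Those of its antiderivative are of size \<open>1 / k\<^sup>2\<close>, and the division
  by \<Delta> is paid for by the smallness of \<open>e(k \<Delta>) - 1\<close> for \<open>k\<close>
  below \<open>1 / \<Delta>\<close>.

  Powers of \<open>d\<close> cancel because the irrationality measure is applied to
  \<open>m = k d q\<close> instead of \<open>q\<close>: if \<open>\<gamma> m\<close> is within
  \<open>1 / Q\<close> of an integer, then \<open>m\<close> is large, and
  \<open>N / (d q) = N k / m\<close> no longer sees \<open>d\<close>. Up to constants,
  \<open>q\<close> and \<open>N / (d q)\<close> are both at most
  \<open>E = (N k) powr (\<tau> / (1 + \<tau>))\<close>; likewise with \<open>d\<^sup>2\<close>.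

  The losses are then \<open>N \<Delta>\<close>, \<open>U\<^sup>2\<close>, \<open>N / sqrt U\<close>
  and \<open>sqrt (N E)\<close>. The choices of \<Delta> and \<open>U\<close> make the first and
  third \<open>N powr (1 - \<sigma>)\<close>. At the critical frequency
  \<open>k = 1 / \<Delta>\<close> the fourth is equally large when \<open>1 / 2 + (1 + \<sigma>)
  \<tau> / (2 (1 + \<tau>)) = 1 - \<sigma>\<close>, that is
  \<open>\<sigma> = 1 / (3 \<tau> + 2)\<close>. Since \<open>\<tau> \<ge> 1\<close> gives
  \<open>5 \<sigma> \<le> 1\<close>, the second is no larger.\<close>

lemma dirichlet_kernel:
  fixes t :: real
  assumes "sin (t / 2) \<noteq> 0"
  shows "(\<Sum>k<n. cos (real (Suc k) * t)) = sin ((real n + 1/2) * t) / (2 * sin (t / 2)) - 1 / 2"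
proof (induction n)
  case 0
  then show ?case using assms by simp
next
  case (Suc n)
  have "sin ((real n + 1/2) * t) + 2 * cos (real (Suc n) * t) * sin (t / 2) = sin ((real (Suc n) + 1/2) * t)"
  proof -
    have a: "(real n + 1/2) * t = real (Suc n) * t - t / 2" "(real (Suc n) + 1/2) * t = real (Suc n) * t + t / 2"
      by (simp_all add: algebra_simps)
    show ?thesis unfolding a sin_diff sin_add by simp
  qed
  then show ?case using Suc assms by (simp add: field_simps)
qed

text \<open>The derivative of the difference is the Dirichlet kernel, which oscillates but is not
  small. Integrating it by parts from \<open>pi\<close>, where the difference vanishes, gives a
  boundary term and a remainder, both of order \<open>1 / n\<close> away from the multiples of
  \<open>2 * pi\<close>.\<close>

lemma sum_sin_over_k_bound:
  fixes t \<delta> :: real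
  assumes \<delta>: "0 < \<delta>" "\<delta> < pi" and t: "t \<in> {\<delta>..2 * pi - \<delta>}"
  shows "\<bar>(\<Sum>k<n. sin (real (Suc k) * t) / real (Suc k)) - (pi - t) / 2\<bar>
          \<le> (pi / (2 * (sin (\<delta> / 2))\<^sup>2) + 1 / sin (\<delta> / 2)) / real (2 * n + 1)"
proof -
  let ?S = "{\<delta>..2 * pi - \<delta>}"
  define s0 where "s0 = sin (\<delta> / 2)"
  have s0: "s0 > 0" unfolding s0_def using \<delta> by (intro sin_gt_zero) auto
  have sge: "sin (u / 2) \<ge> s0" if u: "u \<in> ?S" for u
  proof (cases "u \<le> pi")
    case True
    then show ?thesis unfolding s0_def using u \<delta> by (intro sin_monotone_2pi_le) auto
  next
    case False
    have "sin (\<delta> / 2) \<le> sin (pi - u / 2)" using False u \<delta> by (intro sin_monotone_2pi_le) auto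
    then show ?thesis unfolding s0_def by simp
  qed
  \<comment> \<open>The last summand is minus the boundary term of the integration by parts: its
    derivative cancels the kernel \<open>sin ((n + 1/2) u) / (2 sin (u / 2))\<close> and leaves
    \<open>G'\<close>, of size \<open>1 / n\<close>.\<close>
  define G where "G = (\<lambda>u. (\<Sum>k<n. sin (real (Suc k) * u) / real (Suc k)) - (pi - u) / 2
      + cos ((real n + 1/2) * u) / (real (2 * n + 1) * sin (u / 2)))"
  define G' where "G' = (\<lambda>u. - (cos ((real n + 1/2) * u) * cos (u / 2)) / (2 * real (2 * n + 1) * (sin (u / 2))\<^sup>2))"
  have der: "(G has_field_derivative G' u) (at u within ?S)" if u: "u \<in> ?S" for u
  proof -
    have nz: "sin (u / 2) \<noteq> 0" using sge[OF u] s0 by auto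
    have "(G has_field_derivative ((\<Sum>k<n. cos (real (Suc k) * u)) + 1/2
       + ((- sin ((real n + 1/2) * u) * (real n + 1/2)) * (real (2 * n + 1) * sin (u / 2))
          - cos ((real n + 1/2) * u) * (real (2 * n + 1) * (cos (u / 2) * (1/2))))
         / ((real (2 * n + 1) * sin (u / 2)) * (real (2 * n + 1) * sin (u / 2))))) (at u within ?S)"
      unfolding G_def using nz
      by (auto intro!: derivative_eq_intros sum.cong simp: field_simps simp del: of_nat_Suc of_nat_add of_nat_mult)
    also have "(\<Sum>k<n. cos (real (Suc k) * u)) + 1/2
       + ((- sin ((real n + 1/2) * u) * (real n + 1/2)) * (real (2 * n + 1) * sin (u / 2))
          - cos ((real n + 1/2) * u) * (real (2 * n + 1) * (cos (u / 2) * (1/2))))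
         / ((real (2 * n + 1) * sin (u / 2)) * (real (2 * n + 1) * sin (u / 2))) = G' u"
    proof -
      define A B c r where "A = sin ((real n + 1/2) * u)" and "B = cos ((real n + 1/2) * u)"
        and "c = cos (u / 2)" and "r = real n + 1/2"
      define s where "s = sin (u / 2)"
      have r: "real (2 * n + 1) = 2 * r" "r > 0" by (auto simp: r_def)
      have "s \<noteq> 0" using nz s_def by simp
      then have "A / (2 * s) - 1 / 2 + 1 / 2 + (- A * r * (2 * r * s) - B * (2 * r * (c * (1/2)))) / (2 * r * s * (2 * r * s))
         = - (B * c) / (2 * (2 * r) * s\<^sup>2)"
        using r(2) by (simp add: field_simps power2_eq_square)
      then show ?thesis
        unfolding dirichlet_kernel[OF nz] G'_def r(1) unfolding A_def B_def c_def r_def s_def .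
    qed
    finally show ?thesis .
  qed
  have bd: "norm (G' u) \<le> 1 / (2 * real (2 * n + 1) * s0\<^sup>2)" if u: "u \<in> ?S" for u
  proof -
    have "\<bar>cos ((real n + 1/2) * u) * cos (u / 2)\<bar> \<le> 1 * 1"
      unfolding abs_mult by (intro mult_mono) auto
    then show ?thesis
      unfolding G'_def real_norm_def abs_divide abs_minus_cancel using s0 sge[OF u]
      by (intro frac_le) (auto intro!: mult_left_mono power_mono)
  qed
  have "norm (G t - G pi) \<le> 1 / (2 * real (2 * n + 1) * s0\<^sup>2) * norm (t - pi)"
    by (rule field_differentiable_bound[where S = ?S and f' = G']) (use der bd t \<delta> in auto)
  also have "\<dots> \<le> 1 / (2 * real (2 * n + 1) * s0\<^sup>2) * pi"
    using t \<delta> by (intro mult_left_mono) auto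
  also have "G pi = 0"
  proof -
    have "cos ((real n + 1/2) * pi) = 0"
      by (simp add: distrib_right cos_add)
    moreover have "sin (real (Suc k) * pi) = 0" for k by (rule sin_npi)
    ultimately show ?thesis unfolding G_def by (simp del: of_nat_Suc)
  qed
  finally have 1: "\<bar>G t\<bar> \<le> 1 / (2 * real (2 * n + 1) * s0\<^sup>2) * pi" by simp
  have 2: "\<bar>cos ((real n + 1/2) * t) / (real (2 * n + 1) * sin (t / 2))\<bar> \<le> 1 / (real (2 * n + 1) * s0)"
    unfolding abs_divide using s0 sge[OF t] by (intro frac_le) (auto intro!: mult_left_mono)
  have "\<bar>(\<Sum>k<n. sin (real (Suc k) * t) / real (Suc k)) - (pi - t) / 2\<bar>
     \<le> 1 / (2 * real (2 * n + 1) * s0\<^sup>2) * pi + 1 / (real (2 * n + 1) * s0)"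
    using 1 2 unfolding G_def by linarith
  also have "\<dots> = (pi / (2 * s0\<^sup>2) + 1 / s0) / real (2 * n + 1)"
    by (simp add: add_divide_distrib ac_simps del: of_nat_add of_nat_mult of_nat_Suc)
  finally show ?thesis unfolding s0_def .
qed

text \<open>The termwise derivative is the sine series, which is known to converge uniformly only
  away from \<open>0\<close> and \<open>2 * pi\<close>. Hence the sum is differentiated in the open
  interval, the endpoints follow by continuity, and the constant of integration is fixed at
  \<open>0\<close> by the sum of the inverse squares.\<close>

lemma sum_cos_over_square:
  fixes t :: real
  assumes "t \<in> {0..2 * pi}"
  shows "(\<lambda>k. cos (real (Suc k) * t) / (real (Suc k))\<^sup>2) sums ((pi - t)\<^sup>2 / 4 - pi\<^sup>2 / 12)"
proof -
  define f where "f = (\<lambda>k t. cos (real (Suc k) * t) / (real (Suc k))\<^sup>2)"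
  have sq: "summable (\<lambda>k. 1 / (real (Suc k))\<^sup>2)"
    using inverse_squares_sums by (auto simp: sums_iff add.commute)
  have le: "norm (f k u) \<le> 1 / (real (Suc k))\<^sup>2" for k u
    unfolding f_def by (auto simp: field_simps)
  have sm: "summable (\<lambda>k. f k u)" for u
    by (rule summable_comparison_test'[OF sq le])
  define F where "F = (\<lambda>u. \<Sum>k. f k u)"
  have ul: "uniform_limit UNIV (\<lambda>n u. \<Sum>k<n. f k u) F sequentially"
    unfolding F_def by (rule Weierstrass_m_test[OF _ sq]) (use le in auto)
  have cont: "continuous_on UNIV F"
    by (rule uniform_limit_theorem[OF _ ul]) (auto simp: f_def intro!: always_eventually continuous_intros)
  have der: "(F has_field_derivative - ((pi - u) / 2)) (at u)" if u: "u \<in> {0<..<2 * pi}" for u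
  proof -
    \<comment> \<open>This puts \<open>u\<close> strictly inside
      \<open>{\<delta>..2 * pi - \<delta>}\<close> and keeps \<delta> below \<open>pi\<close>, as
      \<open>sum_sin_over_k_bound\<close> requires.\<close>
    define \<delta> where "\<delta> = min (u / 2) (min ((2 * pi - u) / 2) (pi / 2))"
    have \<delta>: "0 < \<delta>" "\<delta> < pi" "\<delta> < u" "u < 2 * pi - \<delta>"
    proof -
      have "\<delta> \<le> u / 2" "\<delta> \<le> (2 * pi - u) / 2" "\<delta> \<le> pi / 2"
        unfolding \<delta>_def by linarith+
      then show "\<delta> < pi" "\<delta> < u" "u < 2 * pi - \<delta>" using u pi_gt_zero by auto
      show "0 < \<delta>" using u by (auto simp: \<delta>_def)
    qed
    let ?S = "{\<delta>..2 * pi - \<delta>}"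
    define K where "K = pi / (2 * (sin (\<delta> / 2))\<^sup>2) + 1 / sin (\<delta> / 2)"
    define f' where "f' = (\<lambda>k t. - (sin (real (Suc k) * t) / real (Suc k)))"
    have sumf': "(\<Sum>k<n. f' k x) = - (\<Sum>k<n. sin (real (Suc k) * x) / real (Suc k))" for n x
      by (simp add: f'_def sum_negf)
    have ul': "uniform_limit ?S (\<lambda>n x. \<Sum>i<n. f' i x) (\<lambda>x. - ((pi - x) / 2)) sequentially"
    proof (rule uniform_limitI)
      fix e :: real assume e: "e > 0"
      have "((\<lambda>n. K / real (2 * n + 1)) \<longlongrightarrow> 0) sequentially"
        by (intro tendsto_divide_0[OF tendsto_const] filterlim_at_top_imp_at_infinity
              filterlim_compose[OF filterlim_real_sequentially] filterlim_subseq) (auto simp: strict_mono_def)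
      then have "eventually (\<lambda>n. K / real (2 * n + 1) < e) sequentially"
        using e by (auto dest: order_tendstoD)
      then show "\<forall>\<^sub>F n in sequentially. \<forall>x\<in>?S. dist (\<Sum>i<n. f' i x) (- ((pi - x) / 2)) < e"
      proof eventually_elim
        case (elim n)
        show ?case
        proof
          fix x assume x: "x \<in> ?S"
          have "\<bar>(\<Sum>k<n. sin (real (Suc k) * x) / real (Suc k)) - (pi - x) / 2\<bar> \<le> K / real (2 * n + 1)"
            unfolding K_def by (rule sum_sin_over_k_bound[OF \<delta>(1,2) x])
          then show "dist (\<Sum>i<n. f' i x) (- ((pi - x) / 2)) < e"
            using elim unfolding sumf' dist_real_def by linarith
        qed
      qed
    qed
    have d: "(f n has_field_derivative f' n x) (at x within ?S)" for n x
      unfolding f_def f'_def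
      by (auto intro!: derivative_eq_intros simp: power2_eq_square simp del: of_nat_Suc)
    obtain g where g: "\<forall>x\<in>?S. (\<lambda>n. f n x) sums g x \<and> (g has_field_derivative - ((pi - x) / 2)) (at x within ?S)"
      using has_field_derivative_series[OF _ d ul', of u] \<delta> sm by auto
    have "(F has_field_derivative - ((pi - u) / 2)) (at u within ?S)"
      by (rule has_field_derivative_transform_within[of g _ _ _ 1]) (use g \<delta> in \<open>auto simp: F_def sums_iff\<close>)
    then show ?thesis using \<delta> by (simp add: at_within_Icc_at)
  qed
  define H where "H = (\<lambda>u. F u - (pi - u)\<^sup>2 / 4)"
  have "H t = H 0"
  proof (cases "t = 0")
    case False
    have "(H has_field_derivative 0) (at u)" if "u \<in> {0<..<2 * pi}" for u
      unfolding H_def using der[OF that] by (auto intro!: derivative_eq_intros simp: field_simps)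
    moreover have "continuous_on {0..2*pi} H"
      unfolding H_def by (intro continuous_intros continuous_on_subset[OF cont]) auto
    ultimately show ?thesis using assms False
      by (intro DERIV_isconst2[of 0 "2 * pi"]) auto
  qed simp
  moreover have "F 0 = pi\<^sup>2 / 6"
    using inverse_squares_sums unfolding F_def f_def by (simp add: sums_iff add.commute)
  ultimately have "F t = (pi - t)\<^sup>2 / 4 - pi\<^sup>2 / 12" unfolding H_def by simp
  then show ?thesis using sm[of t] by (simp add: sums_iff F_def f_def)
qed

section \<open>The sawtooth function and its periodic antiderivative\<close>

definition sawtooth :: "real \<Rightarrow> real" where
  "sawtooth x = frac x - 1 / 2"

text \<open>Half the periodic second Bernoulli polynomial. The factor \<open>1 / 2\<close> makes
  \<open>sawtooth\<close> its derivative off the integers; the constant \<open>1 / 6\<close> gives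
  it mean zero, so that its Fourier series has no constant term.\<close>

definition bern2 :: "real \<Rightarrow> real" where
  "bern2 x = ((frac x)\<^sup>2 - frac x + 1 / 6) / 2"

lemma bern2_fourier:
  "(\<lambda>k. cos (2 * pi * (real (Suc k) * x)) / (2 * pi\<^sup>2 * (real (Suc k))\<^sup>2)) sums bern2 x"
proof -
  have "(\<lambda>k. cos (real (Suc k) * (2 * pi * frac x)) / (real (Suc k))\<^sup>2)
     sums ((pi - 2 * pi * frac x)\<^sup>2 / 4 - pi\<^sup>2 / 12)"
    using frac_lt_1[of x] by (intro sum_cos_over_square) (auto)
  then have "(\<lambda>k. cos (real (Suc k) * (2 * pi * frac x)) / (real (Suc k))\<^sup>2 / (2 * pi\<^sup>2))
     sums (((pi - 2 * pi * frac x)\<^sup>2 / 4 - pi\<^sup>2 / 12) / (2 * pi\<^sup>2))"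
    by (rule sums_divide)
  moreover have "((pi - 2 * pi * frac x)\<^sup>2 / 4 - pi\<^sup>2 / 12) / (2 * pi\<^sup>2) = bern2 x"
    unfolding bern2_def by (simp add: field_simps power2_eq_square)
  moreover have "cos (real (Suc k) * (2 * pi * frac x)) = cos (2 * pi * (real (Suc k) * x))" for k
  proof -
    have "cos (2 * pi * (real (Suc k) * x)) = cos (real (Suc k) * (2 * pi * frac x) + 2 * pi * of_int (int (Suc k) * \<lfloor>x\<rfloor>))"
      by (rule arg_cong[of _ _ cos]) (simp add: frac_def algebra_simps)
    also have "\<dots> = cos (real (Suc k) * (2 * pi * frac x))"
      by (simp only: cos_add cos_int_2pin sin_int_2pin mult_1_right mult_zero_right diff_zero)
    finally show ?thesis by simp
  qed
  ultimately show ?thesis by (simp add: field_simps del: of_nat_Suc)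
qed

text \<open>The left-hand side is the integral of the sawtooth over an interval starting at
  \<open>x\<close>. The sawtooth has slope 1 and jumps only downwards, so at distance
  \<open>u\<close> to the right of \<open>x\<close> it is at most
  \<open>sawtooth x + u\<close>.\<close>

lemma bern2_add_le:
  assumes "0 \<le> \<Delta>" "\<Delta> < 1"
  shows "bern2 (x + \<Delta>) - bern2 x \<le> \<Delta> * sawtooth x + \<Delta>\<^sup>2 / 2"
proof -
  have f: "frac \<Delta> = \<Delta>" using assms by (simp add: frac_eq)
  show ?thesis
  proof (cases "frac x + \<Delta> < 1")
    case True
    then have "frac (x + \<Delta>) = frac x + \<Delta>" using f by (simp add: frac_add)
    then show ?thesis unfolding bern2_def sawtooth_def by (simp add: power2_eq_square field_simps)
  next
    case False
    then have e: "frac (x + \<Delta>) = frac x + \<Delta> - 1" using f by (simp add: frac_add)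
    show ?thesis unfolding bern2_def sawtooth_def e using False by (simp add: power2_eq_square field_simps)
  qed
qed

text \<open>The mirror image: to the left of \<open>x\<close> the sawtooth is at least
  \<open>sawtooth x\<close> minus the distance, again because its jumps go down.\<close>

lemma bern2_diff_ge:
  assumes "0 \<le> \<Delta>" "\<Delta> < 1"
  shows "bern2 x - bern2 (x - \<Delta>) \<ge> \<Delta> * sawtooth x - \<Delta>\<^sup>2 / 2"
proof -
  define y where "y = x - \<Delta>"
  have x: "x = y + \<Delta>" by (simp add: y_def)
  have f: "frac \<Delta> = \<Delta>" using assms by (simp add: frac_eq)
  have "bern2 (y + \<Delta>) - bern2 y \<ge> \<Delta> * sawtooth (y + \<Delta>) - \<Delta>\<^sup>2 / 2"
  proof (cases "frac y + \<Delta> < 1")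
    case True
    then have "frac (y + \<Delta>) = frac y + \<Delta>" using f by (simp add: frac_add)
    then show ?thesis unfolding bern2_def sawtooth_def by (simp add: power2_eq_square field_simps)
  next
    case False
    have e: "frac (y + \<Delta>) = frac y + \<Delta> - 1" using f False by (simp add: frac_add)
    show ?thesis unfolding bern2_def sawtooth_def e using frac_lt_1[of y] by (simp add: power2_eq_square field_simps)
  qed
  then show ?thesis using x by simp
qed

section \<open>Distances to the nearest integer\<close>

lemma dist_nearest_int_le: "dist_nearest_int x \<le> \<bar>x - of_int n\<bar>"
  unfolding dist_nearest_int_def using round_diff_minimal[of x n] by (simp add: abs_minus_commute)

lemma dist_nearest_int_nonneg: "0 \<le> dist_nearest_int x"
  by (simp add: dist_nearest_int_def)

lemma dist_nearest_int_le_half: "dist_nearest_int x \<le> 1 / 2"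
  unfolding dist_nearest_int_def using of_int_round_abs_le[of x] by (simp add: abs_minus_commute)

lemma dist_nearest_int_pos: "x \<notin> \<int> \<Longrightarrow> 0 < dist_nearest_int x"
  unfolding dist_nearest_int_def by (metis Ints_of_int eq_iff_diff_eq_0 zero_less_abs_iff)

lemma dist_nearest_int_minus [simp]: "dist_nearest_int (- x) = dist_nearest_int x"
proof -
  have "dist_nearest_int (- x) \<le> dist_nearest_int x" for x
    using dist_nearest_int_le[of "- x" "- round x"] by (simp add: dist_nearest_int_def)
  from this[of x] this[of "- x"] show ?thesis by simp
qed

lemma dist_nearest_int_frac: "min (frac x) (1 - frac x) \<le> dist_nearest_int x"
proof -
  have "x - of_int (round x) = frac x + of_int (\<lfloor>x\<rfloor> - round x)" by (simp add: frac_def)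
  moreover have "\<lfloor>x\<rfloor> - round x \<ge> 0 \<or> \<lfloor>x\<rfloor> - round x \<le> -1" by linarith
  then have "(of_int (\<lfloor>x\<rfloor> - round x) :: real) \<ge> 0 \<or> (of_int (\<lfloor>x\<rfloor> - round x) :: real) \<le> -1"
    using of_int_le_iff[of "\<lfloor>x\<rfloor> - round x" "-1", where ?'a = real]
      of_int_0_le_iff[of "\<lfloor>x\<rfloor> - round x", where ?'a = real] by auto
  ultimately show ?thesis unfolding dist_nearest_int_def using frac_ge_0[of x] by linarith
qed

text \<open>Since \<open>x / 0 = 0\<close>, the bound for a point at distance \<open>0\<close> has to be spelt out with a conditional.\<close>

definition min_inv :: "real \<Rightarrow> real \<Rightarrow> real" where
  "min_inv Y r = (if r = 0 then Y else min Y (1 / r))"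

lemma min_inv_le1: "min_inv Y r \<le> Y"
  by (simp add: min_inv_def)

lemma min_inv_le2: "r \<noteq> 0 \<Longrightarrow> min_inv Y r \<le> 1 / r"
  by (simp add: min_inv_def)

lemma min_inv_mono: "Y \<le> Y' \<Longrightarrow> min_inv Y r \<le> min_inv Y' r"
  by (auto simp: min_inv_def)

lemma min_inv_nonneg: "0 \<le> Y \<Longrightarrow> 0 \<le> r \<Longrightarrow> 0 \<le> min_inv Y r"
  by (auto simp: min_inv_def)

text \<open>Cut the circle into \<open>R\<close> arcs of length \<open>1 / R\<close>; the spacing
  puts at most one point into each. A point in arc \<open>m\<close> has distance at least
  \<open>m / R\<close> from \<open>0\<close> and \<open>(R - 1 - m) / R\<close> from
  \<open>1\<close>, so the sum is dominated by two harmonic sums, one from each end, and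
  \<open>Y\<close> is paid only in the arcs next to the integers.\<close>

lemma sum_min_inv_spaced:
  fixes x :: "nat \<Rightarrow> real" and R :: nat
  assumes fin: "finite J" and R: "R > 0" and Y: "Y \<ge> 0"
    and sp: "\<And>i j. i \<in> J \<Longrightarrow> j \<in> J \<Longrightarrow> i \<noteq> j \<Longrightarrow> dist_nearest_int (x i - x j) \<ge> 1 / real R"
  shows "(\<Sum>j\<in>J. min_inv Y (dist_nearest_int (x j))) \<le> 2 * Y + 2 * real R * harm R"
proof -
  define f where "f = (\<lambda>j. nat \<lfloor>real R * frac (x j)\<rfloor>)"
  define g where "g = (\<lambda>m. if m = 0 then Y else real R / real m)"
  have f_lower: "real (f j) \<le> real R * frac (x j)" for j
    unfolding f_def by (simp add: of_nat_floor)
  have f_upper: "real R * frac (x j) < real (f j) + 1" for j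
    unfolding f_def by linarith
  have f_lt: "f j < R" for j
  proof -
    have "real R * frac (x j) < real R * 1"
      using R frac_lt_1 by (intro mult_strict_left_mono) auto
    then have "real (f j) < real R" using f_lower[of j] by linarith
    then show ?thesis by simp
  qed
  have inj: "inj_on f J"
  proof (rule inj_onI, rule ccontr)
    fix i j assume ij: "i \<in> J" "j \<in> J" "f i = f j" "i \<noteq> j"
    have "\<bar>real R * frac (x i) - real R * frac (x j)\<bar> < 1"
      using f_lower[of i] f_upper[of i] f_lower[of j] f_upper[of j] ij(3) by (simp add: abs_less_iff)
    then have "real R * \<bar>frac (x i) - frac (x j)\<bar> < 1"
      by (simp add: abs_mult flip: right_diff_distrib)
    then have "\<bar>frac (x i) - frac (x j)\<bar> < 1 / real R" using R by (simp add: field_simps)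
    moreover have "\<bar>frac (x i) - frac (x j)\<bar> = \<bar>(x i - x j) - of_int (\<lfloor>x i\<rfloor> - \<lfloor>x j\<rfloor>)\<bar>"
      by (simp add: frac_def)
    ultimately show False using sp[OF ij(1,2,4)] dist_nearest_int_le[of "x i - x j" "\<lfloor>x i\<rfloor> - \<lfloor>x j\<rfloor>"]
      by linarith
  qed
  have gnn: "g m \<ge> 0" for m using Y by (simp add: g_def)
  have g0: "g 0 = Y" by (simp add: g_def)
  have le: "min_inv Y (dist_nearest_int (x j)) \<le> g (f j) + g (R - 1 - f j)" if "j \<in> J" for j
  proof -
    let ?r = "dist_nearest_int (x j)"
    consider "f j = 0" | "R - 1 - f j = 0" | "f j > 0" "R - 1 - f j > 0" by linarith
    then show ?thesis
    proof cases
      case 3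
      let ?m = "min (f j) (R - 1 - f j)"
      have m: "?m > 0" using 3 by simp
      have A: "real (f j) / real R \<le> frac (x j)"
        using f_lower[of j] R by (simp add: field_simps)
      have B: "real (R - 1 - f j) / real R \<le> 1 - frac (x j)"
        using f_upper[of j] R f_lt[of j] by (simp add: field_simps of_nat_diff)
      have "real ?m / real R \<le> real (f j) / real R" "real ?m / real R \<le> real (R - 1 - f j) / real R"
        by (intro divide_right_mono; simp)+
      then have "real ?m / real R \<le> min (frac (x j)) (1 - frac (x j))"
        using A B by linarith
      then have r: "real ?m / real R \<le> ?r" using dist_nearest_int_frac[of "x j"] by linarith
      moreover have "real ?m / real R > 0" using m R by simp
      ultimately have r0: "?r > 0" by linarith
      have "min_inv Y ?r \<le> 1 / ?r" using r0 by (intro min_inv_le2) auto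
      also have "\<dots> \<le> 1 / (real ?m / real R)"
        using r \<open>real ?m / real R > 0\<close> r0 by (intro divide_left_mono mult_pos_pos) auto
      also have "\<dots> = g ?m" using m unfolding g_def by (subst if_not_P) simp_all
      also have "\<dots> \<le> g (f j) + g (R - 1 - f j)" using gnn by (auto simp: min_def)
      finally show ?thesis .
    qed (use min_inv_le1[of Y ?r] gnn[of "f j"] gnn[of "R - 1 - f j"] g0 in auto)
  qed
  have gs: "(\<Sum>m<R. g m) \<le> Y + real R * harm R"
  proof -
    have "(\<Sum>m<R. g m) = (\<Sum>m\<in>insert 0 {1..<R}. g m)"
      using R by (intro sum.cong) auto
    also have "\<dots> = Y + (\<Sum>m\<in>{1..<R}. real R / real m)" by (simp add: g_def)
    also have "(\<Sum>m\<in>{1..<R}. real R / real m) \<le> (\<Sum>m\<in>{1..R}. real R / real m)"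
      by (intro sum_mono2) auto
    also have "\<dots> = real R * harm R" by (simp add: harm_def sum_distrib_left divide_inverse)
    finally show ?thesis by simp
  qed
  have "(\<Sum>j\<in>J. min_inv Y (dist_nearest_int (x j))) \<le> (\<Sum>j\<in>J. g (f j) + g (R - 1 - f j))"
    by (intro sum_mono le)
  also have "\<dots> = (\<Sum>m\<in>f ` J. g m + g (R - 1 - m))"
    by (subst sum.reindex[OF inj]) simp
  also have "\<dots> \<le> (\<Sum>m<R. g m + g (R - 1 - m))"
    using f_lt gnn by (intro sum_mono2) auto
  also have "\<dots> = (\<Sum>m<R. g m) + (\<Sum>m<R. g (R - 1 - m))" by (rule sum.distrib)
  also have "(\<Sum>m<R. g (R - 1 - m)) = (\<Sum>m<R. g m)"
    using sum.nat_diff_reindex[of g R] by simp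
  finally show ?thesis using gs by (simp add: algebra_simps)
qed

text \<open>Blocks of length \<open>q div 2 + 1\<close> consist of points \<open>\<theta> j\<close> that are \<open>1 / (2 q)\<close>-spaced modulo 1;
  on the first block even the points themselves stay away from the integers.\<close>

lemma sum_min_inv_multiples:
  fixes \<theta> W :: real and q T :: nat
  assumes q: "q > 0" and W: "W \<ge> 0"
    and sp: "\<And>j. 1 \<le> j \<Longrightarrow> 2 * j \<le> q \<Longrightarrow> dist_nearest_int (\<theta> * real j) \<ge> 1 / (2 * real q)"
  shows "(\<Sum>j = 1..T. min_inv (W / real j) (dist_nearest_int (\<theta> * real j)))
          \<le> 8 * (real q + real T + W / real q) * (1 + harm (2 * q) + harm T)"
proof -
  \<comment> \<open>Indices in a block of \<open>B\<close> consecutive integers differ by at most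
    \<open>B - 1\<close>, and \<open>2 * (B - 1) \<le> q\<close> makes \<open>sp\<close> apply to
    every difference; \<open>2 * B > q\<close> bounds the number of blocks after the first by
    \<open>2 * T / q\<close>.\<close>
  define B where "B = q div 2 + 1"
  have B: "B > 0" "2 * B > q" "2 * (B - 1) \<le> q" by (auto simp: B_def)
  define H where "H = (harm (2 * q) :: real)"
  have H: "H \<ge> 0" unfolding H_def by (rule harm_nonneg)
  let ?F = "\<lambda>j. min_inv (W / real j) (dist_nearest_int (\<theta> * real j))"
  have Fnn: "?F j \<ge> 0" for j by (intro min_inv_nonneg dist_nearest_int_nonneg) (use W in auto)
  have spaced: "(\<Sum>j\<in>J. min_inv Y (dist_nearest_int (\<theta> * real j))) \<le> 2 * Y + 4 * real q * H"
    if J: "J \<subseteq> {h * B..<(h + 1) * B}" and Y: "Y \<ge> 0" for J h Y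
  proof -
    have *: "dist_nearest_int (\<theta> * real i - \<theta> * real j) \<ge> 1 / real (2 * q)" if "i \<in> J" "j \<in> J" "j < i" for i j
    proof -
      have "i < h * B + B" "h * B \<le> j" using J that by auto
      then have "2 * (i - j) \<le> q" using B by auto
      then have "dist_nearest_int (\<theta> * real (i - j)) \<ge> 1 / (2 * real q)" using that by (intro sp) auto
      then show ?thesis using that by (simp add: of_nat_diff right_diff_distrib)
    qed
    have "(\<Sum>j\<in>J. min_inv Y (dist_nearest_int (\<theta> * real j))) \<le> 2 * Y + 2 * real (2 * q) * harm (2 * q)"
    proof (rule sum_min_inv_spaced)
      show "finite J" using J finite_subset by blast
      fix i j assume ij: "i \<in> J" "j \<in> J" "i \<noteq> j"
      show "1 / real (2 * q) \<le> dist_nearest_int (\<theta> * real i - \<theta> * real j)"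
      proof (cases "j < i")
        case False
        then have "1 / real (2 * q) \<le> dist_nearest_int (\<theta> * real j - \<theta> * real i)" using ij by (intro *) auto
        also have "\<dots> = dist_nearest_int (- (\<theta> * real i - \<theta> * real j))" by simp
        finally show ?thesis by (simp only: dist_nearest_int_minus)
      qed (use ij * in auto)
    qed (use q Y in auto)
    then show ?thesis by (simp add: H_def)
  qed
  define blk where "blk = (\<lambda>h. {j \<in> {1..T}. j div B = h})"
  have blk: "blk h \<subseteq> {h * B..<(h + 1) * B}" for h
  proof
    fix j assume "j \<in> blk h"
    then have h: "h = j div B" by (simp add: blk_def)
    have "j = j div B * B + j mod B" "j mod B < B" using B(1) by auto
    then show "j \<in> {h * B..<(h + 1) * B}" unfolding h by (auto simp only: atLeastLessThan_iff add_mult_distrib mult_1)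
  qed
  have b0: "(\<Sum>j\<in>blk 0. ?F j) \<le> 4 * real q + 4 * real q * H"
  proof -
    have "(\<Sum>j\<in>blk 0. ?F j) \<le> (\<Sum>j\<in>blk 0. min_inv (2 * real q) (dist_nearest_int (\<theta> * real j)))"
    proof (rule sum_mono)
      fix j assume j: "j \<in> blk 0"
      then have "j < B" "j \<ge> 1" using B(1) blk[of 0] by (auto simp: blk_def)
      then have d: "dist_nearest_int (\<theta> * real j) \<ge> 1 / (2 * real q)" using B by (intro sp) auto
      moreover have "1 / (2 * real q) > 0" using q by simp
      ultimately have r: "dist_nearest_int (\<theta> * real j) > 0" by linarith
      have "1 / dist_nearest_int (\<theta> * real j) \<le> 1 / (1 / (2 * real q))"
        using d q by (intro divide_left_mono) (auto simp: r)
      then show "?F j \<le> min_inv (2 * real q) (dist_nearest_int (\<theta> * real j))"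
        using r by (auto simp: min_inv_def)
    qed
    also have "\<dots> \<le> 2 * (2 * real q) + 4 * real q * H"
      by (rule spaced[OF blk]) simp
    finally show ?thesis by simp
  qed
  \<comment> \<open>In block \<open>h\<close> one has \<open>j \<ge> h * B > h * q / 2\<close>, so
    \<open>W / j\<close> may be replaced by a bound that is constant on the block; summed over
    \<open>h\<close> it costs a harmonic number.\<close>
  have bh: "(\<Sum>j\<in>blk h. ?F j) \<le> 4 * W / (real q * real h) + 4 * real q * H" if h: "h \<ge> 1" for h
  proof -
    have "(\<Sum>j\<in>blk h. ?F j) \<le> (\<Sum>j\<in>blk h. min_inv (2 * W / (real q * real h)) (dist_nearest_int (\<theta> * real j)))"
    proof (intro sum_mono min_inv_mono)
      fix j assume j: "j \<in> blk h"
      then have "h * B \<le> j" "j \<ge> 1" using blk[of h] by (auto simp: blk_def)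
      have "h * q \<le> h * (2 * B)" using B by (intro mult_left_mono) auto
      also have "\<dots> \<le> 2 * j" using \<open>h * B \<le> j\<close> by simp
      finally have "real h * real q \<le> 2 * real j" by (metis of_nat_le_iff of_nat_mult of_nat_numeral)
      then have "W * (real h * real q) \<le> W * (2 * real j)" using W by (intro mult_left_mono)
      then show "W / real j \<le> 2 * W / (real q * real h)"
        using h q \<open>j \<ge> 1\<close> by (simp add: field_simps)
    qed
    also have "\<dots> \<le> 2 * (2 * W / (real q * real h)) + 4 * real q * H"
      using W by (intro spaced[OF blk]) auto
    finally show ?thesis by simp
  qed
  have "(\<Sum>j = 1..T. ?F j) = (\<Sum>h\<in>{..T div B}. \<Sum>j\<in>blk h. ?F j)"
    unfolding blk_def by (rule sum.group[symmetric]) (auto intro: div_le_mono)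
  also have "\<dots> = (\<Sum>h\<in>insert 0 {1..T div B}. \<Sum>j\<in>blk h. ?F j)"
    by (intro sum.cong) auto
  also have "\<dots> = (\<Sum>j\<in>blk 0. ?F j) + (\<Sum>h = 1..T div B. \<Sum>j\<in>blk h. ?F j)" by simp
  also have "\<dots> \<le> (4 * real q + 4 * real q * H) + (\<Sum>h = 1..T div B. 4 * W / (real q * real h) + 4 * real q * H)"
    by (intro add_mono b0 sum_mono bh) auto
  also have "(\<Sum>h = 1..T div B. 4 * W / (real q * real h) + 4 * real q * H)
     = 4 * (W / real q) * harm (T div B) + real (T div B) * (4 * real q * H)"
    by (simp add: sum.distrib harm_def sum_distrib_left field_simps)
  also have "4 * (W / real q) * harm (T div B) \<le> 4 * (W / real q) * harm T"
    unfolding harm_def using W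
    by (intro mult_left_mono sum_mono2) (auto intro: order.trans[OF _ div_le_dividend])
  also have "real (T div B) * (4 * real q * H) \<le> 8 * real T * H"
  proof -
    have "(T div B) * q \<le> (T div B) * (2 * B)" using B by (intro mult_left_mono) auto
    also have "\<dots> \<le> 2 * T" by (simp add: mult.left_commute div_times_less_eq_dividend)
    finally have "real (T div B) * real q \<le> 2 * real T" by (metis of_nat_le_iff of_nat_mult of_nat_numeral)
    then have "real (T div B) * real q * (4 * H) \<le> 2 * real T * (4 * H)" using H by (intro mult_right_mono) auto
    then show ?thesis by (simp add: ac_simps)
  qed
  finally have "(\<Sum>j = 1..T. ?F j) \<le> 4 * real q + 4 * real q * H + (4 * (W / real q) * harm T + 8 * real T * H)"
    by simp
  also have "\<dots> \<le> 8 * (real q + real T + W / real q) * (1 + H + harm T)"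
  proof -
    have h: "harm T \<ge> (0::real)" by (rule harm_nonneg)
    define w where "w = W / real q"
    have w: "w \<ge> 0" using W by (simp add: w_def)
    have "8 * (real q + real T + w) * (1 + H + harm T) - (4 * real q + 4 * real q * H + (4 * w * harm T + 8 * real T * H))
      = 4 * real q + 4 * (real q * H) + 8 * (real q * harm T) + 8 * real T + 8 * (real T * harm T) + 8 * w + 8 * (w * H) + 4 * (w * harm T)"
      by (simp add: algebra_simps)
    also have "\<dots> \<ge> 0" using w h H by (intro add_nonneg_nonneg mult_nonneg_nonneg) auto
    finally show ?thesis unfolding w_def by linarith
  qed
  finally show ?thesis unfolding H_def .
qed

text \<open>For the reduced fraction \<open>h / q\<close> of Dirichlet's theorem and
  \<open>1 \<le> j < q\<close>, the integer \<open>j h - q m\<close> is nonzero. It equals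
  \<open>q (\<theta> j - m) - j (q \<theta> - h)\<close>, whose second term is at most
  \<open>j / q \<le> 1 / 2\<close> in size, so \<open>q\<close> times the distance of
  \<open>\<theta> j\<close> to the integers is at least \<open>1 / 2\<close>.\<close>

lemma dirichlet_spacing:
  fixes \<theta> :: real
  assumes "Q > 0"
  obtains q :: nat where "0 < q" "q \<le> Q" "dist_nearest_int (\<theta> * real q) < 1 / real Q"
    "\<And>j. 1 \<le> j \<Longrightarrow> 2 * j \<le> q \<Longrightarrow> dist_nearest_int (\<theta> * real j) \<ge> 1 / (2 * real q)"
proof -
  obtain h k where hk: "coprime h k" "0 < k" "k \<le> int Q" "\<bar>of_int k * \<theta> - of_int h\<bar> < 1 / Q"
    using Dirichlet_approx_coprime[OF assms] by blast
  define q where "q = nat k"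
  have k: "k = int q" using hk by (simp add: q_def)
  have q: "0 < q" "q \<le> Q" "coprime h (int q)" "\<bar>real q * \<theta> - of_int h\<bar> < 1 / real Q"
    using hk by (auto simp: k)
  show thesis
  proof (rule that[OF q(1,2)])
    show "dist_nearest_int (\<theta> * real q) < 1 / real Q"
      using q(4) dist_nearest_int_le[of "\<theta> * real q" h] by (simp add: mult.commute)
    fix j :: nat assume j: "1 \<le> j" "2 * j \<le> q"
    define m where "m = round (\<theta> * real j)"
    have nd: "int j * h \<noteq> int q * m"
    proof
      assume "int j * h = int q * m"
      then have "int q dvd int j * h" by simp
      then have "int q dvd int j" using q(3) coprime_commute coprime_dvd_mult_left_iff by blast
      then show False using j q(1) by (auto dest!: dvd_imp_le)
    qed
    have "\<bar>int j * h - int q * m\<bar> \<ge> 1" using nd by linarith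
    then have "(of_int 1 :: real) \<le> of_int \<bar>int j * h - int q * m\<bar>"
      by (simp only: of_int_le_iff)
    then have "(1::real) \<le> \<bar>real j * of_int h - real q * of_int m\<bar>" by simp
    also have "real j * of_int h - real q * of_int m = real q * (\<theta> * real j - of_int m) - real j * (real q * \<theta> - of_int h)"
      by (simp add: algebra_simps)
    also have "\<bar>\<dots>\<bar> \<le> real q * \<bar>\<theta> * real j - of_int m\<bar> + real j * \<bar>real q * \<theta> - of_int h\<bar>"
      by (rule order.trans[OF abs_triangle_ineq4]) (simp add: abs_mult)
    also have "real j * \<bar>real q * \<theta> - of_int h\<bar> \<le> real j * (1 / real q)"
      using q assms by (intro mult_left_mono order.trans[OF less_imp_le[OF q(4)]] divide_left_mono) auto
    also have "\<dots> \<le> 1 / 2" using j q(1) by (simp add: field_simps flip: of_nat_mult)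
    finally have "1 / 2 \<le> real q * dist_nearest_int (\<theta> * real j)"
      by (simp add: dist_nearest_int_def m_def)
    then show "1 / (2 * real q) \<le> dist_nearest_int (\<theta> * real j)"
      using q(1) by (simp add: field_simps)
  qed
qed

section \<open>Exponential sums over arithmetic progressions\<close>

definition unit_exp :: "real \<Rightarrow> complex" where
  "unit_exp x = cis (2 * pi * x)"

lemma norm_unit_exp [simp]: "norm (unit_exp x) = 1"
  by (simp add: unit_exp_def)

lemma unit_exp_add: "unit_exp (x + y) = unit_exp x * unit_exp y"
  by (simp add: unit_exp_def cis_mult distrib_left)

lemma unit_exp_diff: "unit_exp (x - y) = unit_exp x * cnj (unit_exp y)"
  by (simp add: unit_exp_def cis_mult cis_cnj right_diff_distrib)

lemma unit_exp_power: "unit_exp x ^ n = unit_exp (real n * x)"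
  using Complex.DeMoivre[of "2 * pi * x" n] by (simp only: unit_exp_def mult.left_commute)

lemma unit_exp_of_int [simp]: "unit_exp (of_int n) = 1"
  using cis_multiple_2pi[of "of_int n"] by (simp add: unit_exp_def)

lemma sin_ge_over_pi:
  fixes y :: real
  assumes "0 \<le> y" "y \<le> pi / 2"
  shows "sin y \<ge> y / pi"
proof (cases "y \<le> pi / 3")
  case True
  have "sin 0 - 0 / 2 \<le> sin y - y / 2"
  proof (rule DERIV_nonneg_imp_nondecreasing[OF assms(1), where f = "\<lambda>y. sin y - y / 2"])
    fix x assume x: "0 \<le> x" "x \<le> y"
    have "cos (pi / 3) \<le> cos x" using x True assms by (intro cos_monotone_0_pi_le) auto
    then have "((\<lambda>y. sin y - y / 2) has_real_derivative (cos x - 1 / 2)) (at x) \<and> cos x - 1 / 2 \<ge> 0"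
      by (auto intro!: derivative_eq_intros simp: cos_60)
    then show "\<exists>z. ((\<lambda>y. sin y - y / 2) has_real_derivative z) (at x) \<and> 0 \<le> z" by blast
  qed
  moreover have "y / pi \<le> y / 2" using assms pi_ge_two by (intro divide_left_mono) auto
  ultimately show ?thesis unfolding sin_zero by linarith
next
  case False
  have "sin (pi / 6) \<le> sin y" using False assms pi_gt_zero by (intro sin_monotone_2pi_le) auto
  moreover have "y / pi \<le> 1 / 2" using assms by (simp add: field_simps)
  ultimately show ?thesis unfolding sin_30 by linarith
qed

lemma norm_unit_exp_minus_1: "norm (unit_exp x - 1) = 2 * \<bar>sin (pi * x)\<bar>"
proof -
  have "(norm (unit_exp x - 1))\<^sup>2 = (cos (2 * (pi * x)) - 1)\<^sup>2 + (sin (2 * (pi * x)))\<^sup>2"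
    by (simp add: unit_exp_def cmod_def mult.assoc)
  also have "\<dots> = (2 * \<bar>sin (pi * x)\<bar>)\<^sup>2"
  proof -
    have "(sin (2 * (pi * x)))\<^sup>2 = 1 - (cos (2 * (pi * x)))\<^sup>2" by (simp add: sin_squared_eq)
    then have "(cos (2 * (pi * x)) - 1)\<^sup>2 + (sin (2 * (pi * x)))\<^sup>2 = 2 * (1 - cos (2 * (pi * x)))"
      by (simp add: power2_eq_square algebra_simps)
    also have "\<dots> = 4 * (sin (pi * x))\<^sup>2" by (simp add: cos_double_sin)
    finally show ?thesis by (simp add: power_mult_distrib)
  qed
  finally show ?thesis by (subst (asm) power2_eq_iff_nonneg) auto
qed

lemma norm_unit_exp_minus_1_ge: "2 * dist_nearest_int x \<le> norm (unit_exp x - 1)"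
proof -
  define r where "r = x - of_int (round x)"
  have e: "unit_exp x = unit_exp r"
    using unit_exp_add[of r "of_int (round x)"] by (simp add: r_def)
  have ar: "\<bar>r\<bar> \<le> 1 / 2" using dist_nearest_int_le_half[of x] by (simp add: dist_nearest_int_def r_def)
  have "\<bar>r\<bar> = (pi * \<bar>r\<bar>) / pi" by simp
  also have "\<dots> \<le> sin (pi * \<bar>r\<bar>)" using ar by (intro sin_ge_over_pi) auto
  also have "\<dots> \<le> \<bar>sin (pi * r)\<bar>" by (cases "r \<ge> 0") auto
  finally show ?thesis unfolding e norm_unit_exp_minus_1 by (simp add: dist_nearest_int_def r_def)
qed

lemma norm_unit_exp_minus_1_le: "norm (unit_exp x - 1) \<le> 2 * pi * \<bar>x\<bar>"
  using abs_sin_x_le_abs_x[of "pi * x"] unfolding norm_unit_exp_minus_1 by (simp add: abs_mult)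

lemma norm_sum_unit_exp:
  "norm (\<Sum>j<n. unit_exp (y + x * real j)) \<le> min_inv (real n) (dist_nearest_int x)"
proof -
  have e: "(\<Sum>j<n. unit_exp (y + x * real j)) = unit_exp y * (\<Sum>j<n. unit_exp x ^ j)"
    by (simp add: unit_exp_add unit_exp_power sum_distrib_left mult.commute)
  have n: "norm (\<Sum>j<n. unit_exp (y + x * real j)) = norm (\<Sum>j<n. unit_exp x ^ j)"
    unfolding e by (simp add: norm_mult)
  have 1: "norm (\<Sum>j<n. unit_exp (y + x * real j)) \<le> real n"
    using norm_sum[of "\<lambda>j. unit_exp (y + x * real j)" "{..<n}"] by simp
  show ?thesis
  proof (cases "dist_nearest_int x = 0")
    case False
    let ?r = "dist_nearest_int x"
    have r: "?r > 0" using False dist_nearest_int_nonneg[of x] by linarith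
    have ne: "unit_exp x \<noteq> 1" using norm_unit_exp_minus_1_ge[of x] r by auto
    have "norm (unit_exp x ^ n - 1) \<le> norm (unit_exp x ^ n) + norm (1 :: complex)"
      by (rule norm_triangle_ineq4)
    then have le2: "norm (unit_exp x ^ n - 1) \<le> 2" by (simp add: norm_power)
    have "norm (\<Sum>j<n. unit_exp x ^ j) = norm (unit_exp x ^ n - 1) / norm (unit_exp x - 1)"
      using geometric_sum[OF ne] by (simp add: norm_divide)
    also have "\<dots> \<le> 2 / (2 * ?r)"
      using r le2 norm_unit_exp_minus_1_ge[of x] by (intro frac_le) auto
    finally show ?thesis using 1 r unfolding n min_inv_def by simp
  qed (use 1 in \<open>simp add: min_inv_def\<close>)
qed

text \<open>One solution \<open>b0\<close> makes \<open>b0 * m\<close> coprime to \<open>d\<close>,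
  hence \<open>m\<close> invertible modulo \<open>d\<close>, and all solutions form the single class
  of \<open>b0\<close>. Without a solution, \<open>J = 0\<close>. The factor \<open>m\<close> is
  there for sums over products \<open>b * m\<close> in a residue class.\<close>

lemma progression_image:
  fixes c d m lo hi :: nat
  assumes d: "d > 0" and cop: "coprime c d"
  obtains b0 J where "{b \<in> {lo..hi}. [b * m = c] (mod d)} = (\<lambda>j. b0 + d * j) ` {..<J}"
    and "real J \<le> real (hi - lo) / real d + 1"
proof (cases "{b \<in> {lo..hi}. [b * m = c] (mod d)} = {}")
  case True
  show ?thesis by (rule that[of 0 0]) (use True in auto)
next
  case False
  let ?P = "{b \<in> {lo..hi}. [b * m = c] (mod d)}"
  define b0 where "b0 = Min ?P"
  have b0: "b0 \<in> ?P" unfolding b0_def by (rule Min_in) (use False in auto)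
  have min: "b0 \<le> b" if "b \<in> ?P" for b unfolding b0_def by (rule Min_le) (use that in auto)
  have "coprime (b0 * m) d" using b0 cop cong_imp_coprime cong_sym by blast
  then have cm: "coprime m d" by simp
  have iff: "[b * m = c] (mod d) \<longleftrightarrow> [b = b0] (mod d)" for b
  proof
    assume "[b * m = c] (mod d)"
    then have "[b * m = b0 * m] (mod d)" using b0 cong_sym cong_trans by blast
    then show "[b = b0] (mod d)" using cm cong_mult_rcancel_nat by blast
  next
    assume "[b = b0] (mod d)"
    then have "[b * m = b0 * m] (mod d)" by (intro cong_mult) auto
    then show "[b * m = c] (mod d)" using b0 cong_trans by blast
  qed
  define J where "J = (hi - b0) div d + 1"
  show ?thesis
  proof (rule that[of b0 J])
    show "?P = (\<lambda>j. b0 + d * j) ` {..<J}"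
    proof (intro equalityI subsetI)
      fix b assume b: "b \<in> ?P"
      then have "b0 \<le> b" "[b = b0] (mod d)" using min iff by auto
      then obtain j where j: "b = b0 + d * j"
        by (metis cong_le_nat cong_sym mult.commute add.commute)
      have "d * j \<le> hi - b0" using b j by auto
      then have "j \<le> (hi - b0) div d" using d by (simp add: less_eq_div_iff_mult_less_eq mult.commute)
      then show "b \<in> (\<lambda>j. b0 + d * j) ` {..<J}" using j by (auto simp: J_def)
    next
      fix b assume "b \<in> (\<lambda>j. b0 + d * j) ` {..<J}"
      then obtain j where j: "b = b0 + d * j" "j \<le> (hi - b0) div d" unfolding J_def by fastforce
      then have "d * j \<le> hi - b0" using d by (simp add: less_eq_div_iff_mult_less_eq mult.commute)
      then have "b \<in> {lo..hi}" using b0 j by auto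
      moreover have "[b = b0] (mod d)" using j by (simp add: cong_def)
      ultimately show "b \<in> ?P" using iff by auto
    qed
    have "real ((hi - b0) div d) \<le> real (hi - b0) / real d" by (rule of_nat_div_le_of_nat)
    also have "\<dots> \<le> real (hi - lo) / real d" using b0 by (intro divide_right_mono) auto
    finally show "real J \<le> real (hi - lo) / real d + 1" by (simp add: J_def)
  qed
qed

text \<open>Stepping through the progression by \<open>d\<close> multiplies the frequency by
  \<open>d\<close>; this is the origin of the factors \<open>d\<close> in the later frequencies.
  \<open>Y\<close> may exceed the length, so that one bound serves many ranges.\<close>

lemma norm_sum_progression:
  fixes c d m lo hi :: nat
  assumes d: "d > 0" and cop: "coprime c d" and Y: "real (hi - lo) / real d + 1 \<le> Y"
  shows "norm (\<Sum>b | b \<in> {lo..hi} \<and> [b * m = c] (mod d). unit_exp (\<theta> * real b))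
           \<le> min_inv Y (dist_nearest_int (\<theta> * real d))"
proof -
  obtain b0 J where P: "{b \<in> {lo..hi}. [b * m = c] (mod d)} = (\<lambda>j. b0 + d * j) ` {..<J}"
    and J: "real J \<le> real (hi - lo) / real d + 1"
    by (rule progression_image[OF d cop])
  have inj: "inj_on (\<lambda>j. b0 + d * j) {..<J}" using d by (auto simp: inj_on_def)
  have "(\<Sum>b | b \<in> {lo..hi} \<and> [b * m = c] (mod d). unit_exp (\<theta> * real b))
     = (\<Sum>b\<in>(\<lambda>j. b0 + d * j) ` {..<J}. unit_exp (\<theta> * real b))"
    using P by simp
  also have "\<dots> = (\<Sum>j<J. unit_exp (\<theta> * real b0 + \<theta> * real d * real j))"
    by (subst sum.reindex[OF inj]) (simp add: algebra_simps)
  also have "norm \<dots> \<le> min_inv (real J) (dist_nearest_int (\<theta> * real d))"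
    by (rule norm_sum_unit_exp)
  also have "\<dots> \<le> min_inv Y (dist_nearest_int (\<theta> * real d))"
    by (rule min_inv_mono) (use J Y in linarith)
  finally show ?thesis .
qed

lemma card_progression:
  fixes c d lo hi :: nat
  assumes d: "d > 0" and cop: "coprime c d"
  shows "real (card {b \<in> {lo..hi}. [b = c] (mod d)}) \<le> real (hi - lo) / real d + 1"
proof -
  obtain b0 J where P: "{b \<in> {lo..hi}. [b * 1 = c] (mod d)} = (\<lambda>j. b0 + d * j) ` {..<J}"
    and J: "real J \<le> real (hi - lo) / real d + 1"
    by (rule progression_image[OF d cop])
  have "card {b \<in> {lo..hi}. [b = c] (mod d)} \<le> card {..<J}"
    using P by (simp only: mult_1_right) (intro card_image_le finite_lessThan)
  then show ?thesis using J by simp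
qed

text \<open>Partial summation: \<open>ln m = \<Sum>j=2..m. (ln j - ln (j - 1))\<close>, and the weights are nonnegative with total \<open>ln M\<close>.\<close>

lemma norm_sum_ln_le:
  fixes g :: "nat \<Rightarrow> complex"
  assumes bd: "\<And>j. norm (\<Sum>m = j..M. g m) \<le> K"
  shows "norm (\<Sum>m = 1..M. of_real (ln (real m)) * g m) \<le> ln (real M) * K"
proof -
  define w where "w = (\<lambda>j::nat. ln (real (Suc j)) - ln (real j))"
  have w: "w j \<ge> 0" if "j \<ge> 1" for j using that by (simp add: w_def)
  have lnw: "ln (real m) = (\<Sum>j = 1..<m. w j)" if "m \<ge> 1" for m
    using sum_Suc_diff'[of 1 m "\<lambda>j. ln (real j)"] that by (simp add: w_def)
  have "(\<Sum>m = 1..M. of_real (ln (real m)) * g m) = (\<Sum>m = 1..M. \<Sum>j = 1..<m. of_real (w j) * g m)"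
    by (intro sum.cong refl) (simp add: lnw sum_distrib_right)
  also have "\<dots> = (\<Sum>m = 1..M. \<Sum>j | j \<in> {1..<M} \<and> j < m. of_real (w j) * g m)"
    by (intro sum.cong refl) auto
  also have "\<dots> = (\<Sum>j = 1..<M. \<Sum>m | m \<in> {1..M} \<and> j < m. of_real (w j) * g m)"
    by (rule sum.swap_restrict) auto
  also have "\<dots> = (\<Sum>j = 1..<M. of_real (w j) * (\<Sum>m = Suc j..M. g m))"
    by (intro sum.cong refl) (auto simp: sum_distrib_left intro!: sum.cong)
  also have "norm \<dots> \<le> (\<Sum>j = 1..<M. w j * K)"
    by (intro order.trans[OF norm_sum] sum_mono) (auto simp: norm_mult w intro!: mult_left_mono bd)
  also have "\<dots> = ln (real M) * K"
    by (cases "M = 0") (simp_all add: lnw flip: sum_distrib_right)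
  finally show ?thesis .
qed

section \<open>Vaughan's identity and sums of type I\<close>

definition moebius_mu :: "nat \<Rightarrow> real" where
  "moebius_mu n = (if squarefree n then (-1) ^ card (prime_factors n) else 0)"

lemma abs_moebius_mu_le_1: "\<bar>moebius_mu n\<bar> \<le> 1"
  by (simp add: moebius_mu_def)

lemma moebius_mu_prime_mult:
  assumes "prime p" "\<not> p dvd e" "e > 0"
  shows "moebius_mu (p * e) = - moebius_mu e"
proof -
  have cop: "coprime p e" using assms by (simp add: prime_imp_coprime)
  have "squarefree (p * e) \<longleftrightarrow> squarefree e"
    using cop assms(1) squarefree_mult_coprime squarefree_multD(2) squarefree_prime by blast
  moreover have "prime_factors (p * e) = insert p (prime_factors e)"
    using assms by (subst prime_factors_product) (auto simp: prime_prime_factors prime_gt_0_nat)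
  moreover have "p \<notin> prime_factors e" using assms by auto
  ultimately show ?thesis by (simp add: moebius_mu_def)
qed

text \<open>Choose a prime \<open>p\<close> dividing \<open>n\<close>. A divisor \<open>e\<close>
  prime to \<open>p\<close> is paired with \<open>p * e\<close>, where the sign flips; the remaining
  divisors contain \<open>p\<^sup>2\<close> and contribute nothing.\<close>

lemma sum_moebius_mu_divisors:
  assumes "n > 0"
  shows "(\<Sum>d | d dvd n. moebius_mu d) = (if n = 1 then 1 else 0)"
proof (cases "n = 1")
  case False
  obtain p where p: "prime p" "p dvd n" using False prime_factor_nat by blast
  let ?A = "{d. d dvd n \<and> \<not> p dvd d}" and ?B = "{d. d dvd n \<and> p dvd d}"
  have fin: "finite {d. d dvd n}" using assms by simp
  have finA: "finite ?A" and finB: "finite ?B" by (rule finite_subset[OF _ fin], blast)+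
  have inj: "inj_on ((*) p) ?A" using p by (auto simp: inj_on_def)
  have im: "(*) p ` ?A \<subseteq> ?B"
  proof
    fix x assume "x \<in> (*) p ` ?A"
    then obtain e where e: "x = p * e" "e dvd n" "\<not> p dvd e" by auto
    have "coprime p e" using p e by (simp add: prime_imp_coprime)
    then have "p * e dvd n" using p e divides_mult by blast
    then show "x \<in> ?B" using e by simp
  qed
  have "(\<Sum>d | d dvd n. moebius_mu d) = (\<Sum>d\<in>?A \<union> ?B. moebius_mu d)"
    by (rule sum.cong) auto
  also have "\<dots> = (\<Sum>d\<in>?A. moebius_mu d) + (\<Sum>d\<in>?B. moebius_mu d)"
    by (rule sum.union_disjoint[OF finA finB]) auto
  also have "(\<Sum>d\<in>?B. moebius_mu d) = (\<Sum>d\<in>(*) p ` ?A. moebius_mu d)"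
  proof (rule sum.mono_neutral_right[OF finB im], intro ballI)
    fix x assume x: "x \<in> ?B - (*) p ` ?A"
    then obtain e where e: "x = p * e" by auto
    have "e dvd n" using x e dvd_mult_right by blast
    then have "p dvd e" using x e by blast
    then have "p ^ 2 dvd x" using e by (simp add: power2_eq_square mult_dvd_mono)
    moreover have "\<not> p dvd 1" using p(1) not_prime_1 by (metis nat_dvd_1_iff_1)
    ultimately have "\<not> squarefree x" unfolding squarefree_def by blast
    then show "moebius_mu x = 0" by (simp add: moebius_mu_def)
  qed
  also have "\<dots> = (\<Sum>e\<in>?A. moebius_mu (p * e))"
    by (subst sum.reindex[OF inj]) simp
  also have "\<dots> = (\<Sum>e\<in>?A. - moebius_mu e)"
    using p assms by (intro sum.cong refl moebius_mu_prime_mult) (auto intro: dvd_pos_nat)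
  finally show ?thesis using False by (simp add: sum_negf)
qed (simp add: moebius_mu_def)

section \<open>Divisor sums and double sums over products\<close>

lemma sum_divisors_swap:
  fixes F :: "nat \<Rightarrow> nat \<Rightarrow> 'a :: comm_monoid_add"
  assumes "n > 0"
  shows "(\<Sum>b | b dvd n. \<Sum>l | l dvd n div b. F b l) = (\<Sum>l | l dvd n. \<Sum>b | b dvd n div l. F b l)"
proof -
  have iff: "b dvd n \<and> l dvd n div b \<longleftrightarrow> b * l dvd n" for b l
    using assms by (metis dvd_div_iff_mult dvd_mult_left dvd_pos_nat mult.commute not_gr_zero)
  have fin: "finite {d. d dvd n}" using assms by simp
  have "(\<Sum>b | b dvd n. \<Sum>l | l dvd n div b. F b l) = (\<Sum>b | b dvd n. \<Sum>l | l \<in> {l. l dvd n} \<and> b * l dvd n. F b l)"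
    using iff by (intro sum.cong refl) (auto intro: dvd_mult_right)
  also have "\<dots> = (\<Sum>l | l dvd n. \<Sum>b | b \<in> {b. b dvd n} \<and> b * l dvd n. F b l)"
    by (rule sum.swap_restrict[OF fin fin])
  also have "\<dots> = (\<Sum>l | l dvd n. \<Sum>b | b dvd n div l. F b l)"
  proof (intro sum.cong refl)
    fix l assume "l \<in> {l. l dvd n}"
    then show "{b \<in> {b. b dvd n}. b * l dvd n} = {b. b dvd n div l}"
      using iff[of l] by (auto simp: mult.commute intro: dvd_mult_right)
  qed
  finally show ?thesis .
qed

lemma sum_hyperbola:
  fixes f :: "nat \<Rightarrow> nat \<Rightarrow> 'a :: comm_monoid_add"
  shows "(\<Sum>n = 1..N. \<Sum>b | b dvd n. f b (n div b)) = (\<Sum>b = 1..N. \<Sum>m = 1..N div b. f b m)"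
proof -
  have "(\<Sum>n = 1..N. \<Sum>b | b dvd n. f b (n div b)) = (\<Sum>(n, b)\<in>(SIGMA n:{1..N}. {b. b dvd n}). f b (n div b))"
    by (rule sum.Sigma) auto
  also have "\<dots> = (\<Sum>(b, m)\<in>(SIGMA b:{1..N}. {1..N div b}). f b m)"
  proof (rule sum.reindex_bij_witness[of _ "\<lambda>(b, m). (b * m, b)" "\<lambda>(n, b). (b, n div b)"])
    fix x assume x: "x \<in> (SIGMA n:{1..N}. {b. b dvd n})"
    obtain n b where nb: "x = (n, b)" "n \<ge> 1" "n \<le> N" "b dvd n" using x by auto
    then have "b > 0" by (auto intro: Nat.gr0I)
    then show "(case x of (n, b) \<Rightarrow> (b, n div b)) \<in> (SIGMA b:{1..N}. {1..N div b})"
      using nb dvd_imp_le[of b n] by (auto simp: Suc_le_eq div_greater_zero_iff div_le_mono)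
  next
    fix x assume x: "x \<in> (SIGMA b:{1..N}. {1..N div b})"
    obtain b m where bm: "x = (b, m)" "b \<ge> 1" "b \<le> N" "m \<ge> 1" "m \<le> N div b" using x by auto
    then have "b * m \<le> N" by (simp add: less_eq_div_iff_mult_less_eq mult.commute)
    then show "(case x of (b, m) \<Rightarrow> (b * m, b)) \<in> (SIGMA n:{1..N}. {b. b dvd n})"
      using bm by (simp add: Suc_le_eq)
  qed auto
  also have "\<dots> = (\<Sum>b = 1..N. \<Sum>m = 1..N div b. f b m)"
    by (rule sum.Sigma[symmetric]) auto
  finally show ?thesis .
qed

definition mangoldt_tail :: "nat \<Rightarrow> nat \<Rightarrow> real" where
  "mangoldt_tail U m = (\<Sum>l | l dvd m \<and> U < l. mangoldt l)"

lemma mangoldt_tail_eq: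
  assumes "m > 0"
  shows "mangoldt_tail U m = ln (real m) - (\<Sum>l | l dvd m. if l \<le> U then mangoldt l else 0)"
proof -
  have "ln (real m) = (\<Sum>l | l dvd m. mangoldt l)" using mangoldt_sum[of m, where ?'a = real] assms by simp
  also have "\<dots> = (\<Sum>l | l dvd m. (if U < l then mangoldt l else 0) + (if l \<le> U then mangoldt l else 0))"
    by (intro sum.cong) auto
  also have "\<dots> = (\<Sum>l | l dvd m. if U < l then mangoldt l else 0) + (\<Sum>l | l dvd m. if l \<le> U then mangoldt l else 0)"
    by (rule sum.distrib)
  also have "(\<Sum>l | l dvd m. if U < l then mangoldt l else 0) = mangoldt_tail U m"
    unfolding mangoldt_tail_def using assms by (intro sum.mono_neutral_cong_right) auto
  finally show ?thesis by simp
qed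

lemma mangoldt_tail_nonneg: "0 \<le> mangoldt_tail U m"
  unfolding mangoldt_tail_def by (intro sum_nonneg mangoldt_nonneg)

lemma mangoldt_tail_le: "m > 0 \<Longrightarrow> mangoldt_tail U m \<le> ln (real m)"
  unfolding mangoldt_tail_eq by (simp add: sum_nonneg mangoldt_nonneg)

text \<open>Because of this gap, a product \<open>b * m\<close> with \<open>b > U\<close>
  contributes only if \<open>m > U\<close> as well, which keeps both variables of the type II sums
  long.\<close>

lemma mangoldt_tail_eq_0: "m > 0 \<Longrightarrow> m \<le> U \<Longrightarrow> mangoldt_tail U m = 0"
  unfolding mangoldt_tail_def by (rule sum.neutral) (auto dest: dvd_imp_le)

text \<open>Convolving with the Moebius function undoes the convolution with 1 that defines
  \<open>mangoldt_tail\<close>: after exchanging the divisors \<open>b\<close> and \<open>l\<close>,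
  the sum over \<open>b\<close> dividing \<open>n div l\<close> vanishes unless
  \<open>l = n\<close>.\<close>

lemma moebius_mangoldt_tail:
  assumes "n > 0"
  shows "(\<Sum>b | b dvd n. moebius_mu b * mangoldt_tail U (n div b)) = (if U < n then mangoldt n else 0)"
proof -
  let ?L = "\<lambda>l. if U < l then mangoldt l else (0::real)"
  have "(\<Sum>b | b dvd n. moebius_mu b * mangoldt_tail U (n div b)) = (\<Sum>b | b dvd n. \<Sum>l | l dvd n div b. moebius_mu b * ?L l)"
  proof (intro sum.cong refl)
    fix b assume "b \<in> {b. b dvd n}"
    then have "n div b > 0" using assms by (auto elim: dvdE)
    then have "mangoldt_tail U (n div b) = (\<Sum>l | l dvd n div b. ?L l)"
      unfolding mangoldt_tail_def by (intro sum.mono_neutral_cong_left) auto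
    then show "moebius_mu b * mangoldt_tail U (n div b) = (\<Sum>l | l dvd n div b. moebius_mu b * ?L l)"
      by (simp add: sum_distrib_left)
  qed
  also have "\<dots> = (\<Sum>l | l dvd n. \<Sum>b | b dvd n div l. moebius_mu b * ?L l)"
    by (rule sum_divisors_swap[OF assms])
  also have "\<dots> = (\<Sum>l | l dvd n. if l = n then ?L n else 0)"
  proof (intro sum.cong refl)
    fix l assume "l \<in> {l. l dvd n}"
    then have *: "n div l > 0" "n div l = 1 \<longleftrightarrow> l = n" using assms by (auto elim!: dvdE)
    show "(\<Sum>b | b dvd n div l. moebius_mu b * ?L l) = (if l = n then ?L n else 0)"
      unfolding sum_distrib_right[symmetric] sum_moebius_mu_divisors[OF *(1)] using *(2) by simp
  qed
  also have "\<dots> = ?L n" using assms by (subst sum.delta) auto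
  finally show ?thesis .
qed

lemma vaughan_identity:
  fixes \<psi> :: "nat \<Rightarrow> complex"
  shows "(\<Sum>n = 1..N. of_real (mangoldt n) * \<psi> n)
    = (\<Sum>n | n \<in> {1..N} \<and> n \<le> U. of_real (mangoldt n) * \<psi> n)
      + (\<Sum>b | b \<in> {1..N} \<and> b \<le> U. of_real (moebius_mu b) * (\<Sum>m = 1..N div b. of_real (mangoldt_tail U m) * \<psi> (b * m)))
      + (\<Sum>b | b \<in> {1..N} \<and> U < b. of_real (moebius_mu b) * (\<Sum>m = 1..N div b. of_real (mangoldt_tail U m) * \<psi> (b * m)))"
proof -
  let ?F = "\<lambda>b. of_real (moebius_mu b) * (\<Sum>m = 1..N div b. of_real (mangoldt_tail U m) * \<psi> (b * m))"
  have "(\<Sum>n = 1..N. of_real (mangoldt n) * \<psi> n)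
    = (\<Sum>n\<in>{n \<in> {1..N}. n \<le> U} \<union> {n \<in> {1..N}. U < n}. of_real (mangoldt n) * \<psi> n)"
    by (intro sum.cong) auto
  also have "\<dots> = (\<Sum>n | n \<in> {1..N} \<and> n \<le> U. of_real (mangoldt n) * \<psi> n)
      + (\<Sum>n | n \<in> {1..N} \<and> U < n. of_real (mangoldt n) * \<psi> n)"
    by (rule sum.union_disjoint) auto
  also have "(\<Sum>n | n \<in> {1..N} \<and> U < n. of_real (mangoldt n) * \<psi> n)
    = (\<Sum>n = 1..N. of_real (if U < n then mangoldt n else 0) * \<psi> n)"
    by (intro sum.mono_neutral_cong_left) auto
  also have "\<dots> = (\<Sum>n = 1..N. \<Sum>b | b dvd n. of_real (moebius_mu b * mangoldt_tail U (n div b)) * \<psi> (b * (n div b)))"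
  proof (intro sum.cong refl)
    fix n assume "n \<in> {1..N}"
    then have n: "n > 0" by simp
    show "of_real (if U < n then mangoldt n else 0) * \<psi> n
       = (\<Sum>b | b dvd n. of_real (moebius_mu b * mangoldt_tail U (n div b)) * \<psi> (b * (n div b)))"
      unfolding moebius_mangoldt_tail[OF n, symmetric] of_real_sum sum_distrib_right by (intro sum.cong) auto
  qed
  also have "\<dots> = (\<Sum>b = 1..N. \<Sum>m = 1..N div b. of_real (moebius_mu b * mangoldt_tail U m) * \<psi> (b * m))"
    by (rule sum_hyperbola)
  also have "\<dots> = (\<Sum>b\<in>{b \<in> {1..N}. b \<le> U} \<union> {b \<in> {1..N}. U < b}. ?F b)"
    by (intro sum.cong) (auto simp: sum_distrib_left mult.assoc)
  also have "\<dots> = (\<Sum>b | b \<in> {1..N} \<and> b \<le> U. ?F b) + (\<Sum>b | b \<in> {1..N} \<and> U < b. ?F b)"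
    by (rule sum.union_disjoint) auto
  finally show ?thesis by simp
qed

text \<open>Here \<open>mangoldt_tail U\<close> is written as \<open>ln\<close> minus the von
  Mangoldt function up to \<open>U\<close> summed over divisors. The logarithm is removed by partial
  summation, which is why \<open>J\<close> bounds the sums from any starting point \<open>j\<close>.
  The second part leads to \<open>t = b * c\<close> with \<open>b, c \<le> U\<close>; a given
  \<open>t\<close> collects at most the total of \<open>mangoldt c\<close> over all
  \<open>c dvd t\<close>, which is \<open>ln t\<close>. So each part costs one factor
  \<open>ln N\<close>.\<close>

lemma type_I_bound:
  fixes \<psi> :: "nat \<Rightarrow> complex"
  assumes U: "U * U \<le> N"
    and J: "\<And>t j. 1 \<le> t \<Longrightarrow> t \<le> U * U \<Longrightarrow> norm (\<Sum>m = j..N div t. \<psi> (t * m)) \<le> J t"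
  shows "norm (\<Sum>b | b \<in> {1..N} \<and> b \<le> U. of_real (moebius_mu b) * (\<Sum>m = 1..N div b. of_real (mangoldt_tail U m) * \<psi> (b * m)))
     \<le> 2 * ln (real N) * (\<Sum>t = 1..U * U. J t)"
proof (cases "U = 0")
  case True
  then have "{b \<in> {1..N}. b \<le> U} = {}" by auto
  then show ?thesis using True by simp
next
  case False
  have N: "N > 0" using False U by (auto intro: Nat.gr0I)
  have Jnn: "J t \<ge> 0" if "t \<in> {1..U * U}" for t
    using order.trans[OF norm_ge_zero J[of t 0]] that by simp
  have inner: "norm (\<Sum>m = 1..N div b. of_real (mangoldt_tail U m) * \<psi> (b * m))
      \<le> ln (real N) * J b + (\<Sum>c = 1..U. mangoldt c * J (b * c))" if b: "b \<in> {1..U}" for b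
  proof -
    have bU: "b \<le> U * U" using b by (simp add: order.trans[OF _ le_square])
    have bc: "b * c \<in> {1..U * U}" if "c \<in> {1..U}" for c
      using b that by (auto intro!: mult_le_mono)
    define S1 where "S1 = (\<Sum>m = 1..N div b. of_real (ln (real m)) * \<psi> (b * m))"
    define S2 where "S2 = (\<Sum>c = 1..N div b. \<Sum>m = 1..N div b div c. of_real (if c \<le> U then mangoldt c else 0) * \<psi> (b * c * m))"
    have "(\<Sum>m = 1..N div b. of_real (mangoldt_tail U m) * \<psi> (b * m))
      = (\<Sum>m = 1..N div b. of_real (ln (real m)) * \<psi> (b * m)
          - (\<Sum>c | c dvd m. of_real (if c \<le> U then mangoldt c else 0) * \<psi> (b * c * (m div c))))"
      by (intro sum.cong refl)
        (auto simp: mangoldt_tail_eq left_diff_distrib sum_distrib_right mult.assoc intro!: sum.cong)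
    also have "\<dots> = S1 - S2"
      unfolding sum_subtractf S1_def S2_def
      by (subst sum_hyperbola[of "\<lambda>c m. of_real (if c \<le> U then mangoldt c else 0) * \<psi> (b * c * m)"]) simp
    finally have e: "norm (\<Sum>m = 1..N div b. of_real (mangoldt_tail U m) * \<psi> (b * m)) \<le> norm S1 + norm S2"
      using norm_triangle_ineq4[of S1 S2] by simp
    have Jb: "norm (\<Sum>m = j..N div b. \<psi> (b * m)) \<le> J b" for j
      by (rule J) (use b bU in auto)
    have "norm S1 \<le> ln (real (N div b)) * J b"
      unfolding S1_def by (rule norm_sum_ln_le) (rule Jb)
    also have "\<dots> \<le> ln (real N) * J b"
    proof (rule mult_right_mono)
      show "ln (real (N div b)) \<le> ln (real N)"
      proof (cases "N div b = 0")
        case False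
        then have "real (N div b) > 0" by linarith
        moreover have "real (N div b) \<le> real N" by (simp add: div_le_dividend)
        ultimately show ?thesis using N by (subst ln_le_cancel_iff) auto
      qed (use N in simp)
    qed (use Jnn b bU in auto)
    finally have n1: "norm S1 \<le> ln (real N) * J b" .
    have "norm S2 \<le> (\<Sum>c = 1..N div b. if c \<le> U then mangoldt c * J (b * c) else 0)"
      unfolding S2_def
    proof (rule order.trans[OF norm_sum], rule sum_mono)
      fix c assume c: "c \<in> {1..N div b}"
      show "norm (\<Sum>m = 1..N div b div c. of_real (if c \<le> U then mangoldt c else 0) * \<psi> (b * c * m))
         \<le> (if c \<le> U then mangoldt c * J (b * c) else 0)"
      proof (cases "c \<le> U")
        case True
        have "norm (\<Sum>m = 1..N div (b * c). \<psi> (b * c * m)) \<le> J (b * c)"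
          by (rule J) (use True c bc[of c] in auto)
        then show ?thesis using True
          by (simp add: div_mult2_eq norm_mult mangoldt_nonneg mult_left_mono flip: sum_distrib_left)
      qed simp
    qed
    also have "\<dots> = (\<Sum>c\<in>{1..N div b} \<inter> {1..U}. mangoldt c * J (b * c))"
      by (intro sum.mono_neutral_cong_right) auto
    also have "\<dots> \<le> (\<Sum>c = 1..U. mangoldt c * J (b * c))"
    proof (intro sum_mono2)
      fix c assume "c \<in> {1..U} - {1..N div b} \<inter> {1..U}"
      then show "0 \<le> mangoldt c * J (b * c)"
        by (intro mult_nonneg_nonneg mangoldt_nonneg Jnn bc) auto
    qed auto
    finally show ?thesis using e n1 by linarith
  qed
  have "norm (\<Sum>b | b \<in> {1..N} \<and> b \<le> U. of_real (moebius_mu b) * (\<Sum>m = 1..N div b. of_real (mangoldt_tail U m) * \<psi> (b * m)))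
    \<le> (\<Sum>b | b \<in> {1..N} \<and> b \<le> U. norm (\<Sum>m = 1..N div b. of_real (mangoldt_tail U m) * \<psi> (b * m)))"
    by (intro order.trans[OF norm_sum] sum_mono)
      (auto simp: norm_mult abs_moebius_mu_le_1 intro!: mult_left_le_one_le)
  also have "\<dots> \<le> (\<Sum>b = 1..U. norm (\<Sum>m = 1..N div b. of_real (mangoldt_tail U m) * \<psi> (b * m)))"
    by (intro sum_mono2) auto
  also have "\<dots> \<le> (\<Sum>b = 1..U. ln (real N) * J b + (\<Sum>c = 1..U. mangoldt c * J (b * c)))"
    by (intro sum_mono inner)
  also have "\<dots> = ln (real N) * (\<Sum>b = 1..U. J b) + (\<Sum>b = 1..U. \<Sum>c = 1..U. mangoldt c * J (b * c))"
    by (simp add: sum.distrib sum_distrib_left)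
  also have "ln (real N) * (\<Sum>b = 1..U. J b) \<le> ln (real N) * (\<Sum>t = 1..U * U. J t)"
    using Jnn N by (intro mult_left_mono sum_mono2) (auto intro: order.trans[OF _ le_square])
  also have "(\<Sum>b = 1..U. \<Sum>c = 1..U. mangoldt c * J (b * c)) \<le> ln (real N) * (\<Sum>t = 1..U * U. J t)"
  proof -
    have "(\<Sum>b = 1..U. \<Sum>c = 1..U. mangoldt c * J (b * c)) = (\<Sum>c = 1..U. \<Sum>b = 1..U. mangoldt c * J (c * b))"
      by (subst sum.swap) (simp add: mult.commute)
    also have "\<dots> \<le> (\<Sum>c = 1..U. \<Sum>b = 1..U * U div c. mangoldt c * J (c * b))"
    proof (intro sum_mono sum_mono2)
      fix c assume c: "c \<in> {1..U}"
      then have "U * c \<le> U * U" by simp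
      then have "U \<le> U * U div c" using c by (simp add: less_eq_div_iff_mult_less_eq)
      then show "{1..U} \<subseteq> {1..U * U div c}" by auto
      fix b assume b: "b \<in> {1..U * U div c} - {1..U}"
      then have "c * b \<in> {1..U * U}" using c by (auto simp: less_eq_div_iff_mult_less_eq mult.commute)
      then show "0 \<le> mangoldt c * J (c * b)" using Jnn mangoldt_nonneg by (intro mult_nonneg_nonneg) auto
    qed auto
    also have "\<dots> \<le> (\<Sum>c = 1..U * U. \<Sum>b = 1..U * U div c. mangoldt c * J (c * b))"
    proof (intro sum_mono2 sum_nonneg)
      fix c b assume *: "c \<in> {1..U * U} - {1..U}" "b \<in> {1..U * U div c}"
      then have "c * b \<in> {1..U * U}" by (auto simp: less_eq_div_iff_mult_less_eq mult.commute)
      then show "0 \<le> mangoldt c * J (c * b)" using Jnn mangoldt_nonneg by (intro mult_nonneg_nonneg) auto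
    qed (auto intro: order.trans[OF _ le_square])
    also have "\<dots> = (\<Sum>t = 1..U * U. \<Sum>c | c dvd t. mangoldt c * J (c * (t div c)))"
      by (rule sum_hyperbola[symmetric])
    also have "\<dots> = (\<Sum>t = 1..U * U. ln (real t) * J t)"
      by (intro sum.cong refl) (auto simp: mangoldt_sum simp flip: sum_distrib_right)
    also have "\<dots> \<le> (\<Sum>t = 1..U * U. ln (real N) * J t)"
      using Jnn U by (intro sum_mono mult_right_mono) auto
    finally show ?thesis by (simp add: sum_distrib_left)
  qed
  finally show ?thesis by simp
qed

section \<open>Sums of type II\<close>

text \<open>The residue class is built into the function, so that \<open>vaughan_identity\<close>,
  valid for any \<psi>, applies to the progression unchanged.\<close>

definition twisted_char :: "real \<Rightarrow> nat \<Rightarrow> nat \<Rightarrow> nat \<Rightarrow> complex" where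
  "twisted_char \<theta> c d n = (if [n = c] (mod d) then unit_exp (\<theta> * real n) else 0)"

lemma norm_twisted_char_le: "norm (twisted_char \<theta> c d n) \<le> 1"
  by (simp add: twisted_char_def)

lemma norm_sum_twisted_char:
  assumes d: "d > 0" and cop: "coprime c d" and Y: "real (hi - lo) / real d + 1 \<le> Y"
  shows "norm (\<Sum>m = lo..hi. twisted_char \<theta> c d (t * m)) \<le> min_inv Y (dist_nearest_int (\<theta> * real d * real t))"
proof -
  have "(\<Sum>m = lo..hi. twisted_char \<theta> c d (t * m))
     = (\<Sum>m | m \<in> {lo..hi} \<and> [m * t = c] (mod d). unit_exp ((\<theta> * real t) * real m))"
    by (intro sum.mono_neutral_cong_right) (auto simp: twisted_char_def mult_ac)
  also have "norm \<dots> \<le> min_inv Y (dist_nearest_int (\<theta> * real t * real d))"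
    by (rule norm_sum_progression[OF d cop Y])
  finally show ?thesis by (simp add: mult_ac)
qed

text \<open>The condition \<open>[b * m1 = c] (mod d)\<close> makes \<open>b\<close> invertible, so
  both congruences can hold only if \<open>m1\<close> and \<open>m2\<close> agree modulo
  \<open>d\<close>; then they are one condition on \<open>b\<close>. Since \<open>m1 - m2\<close> is
  itself a multiple of \<open>d\<close>, the frequency finally carries
  \<open>d\<^sup>2\<close>.\<close>

lemma sum_twisted_char_correlation:
  assumes d: "d > 0" and cop: "coprime c d" and Y: "real (hi - lo) / real d + 1 \<le> Y"
  shows "norm (\<Sum>b = lo..hi. twisted_char \<theta> c d (b * m1) * cnj (twisted_char \<theta> c d (b * m2)))
     \<le> (if [m1 = m2] (mod d) then min_inv Y (dist_nearest_int (\<theta> * real d * (real m1 - real m2))) else 0)"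
proof -
  have iff: "[b * m2 = c] (mod d) \<longleftrightarrow> [m1 = m2] (mod d)" if b: "[b * m1 = c] (mod d)" for b
  proof -
    have "coprime (b * m1) d" using b cop cong_imp_coprime cong_sym by blast
    then have cb: "coprime b d" by simp
    have "[b * m2 = c] (mod d) \<longleftrightarrow> [b * m1 = b * m2] (mod d)"
      using b cong_sym cong_trans by blast
    also have "\<dots> \<longleftrightarrow> [m1 = m2] (mod d)" using cb by (rule cong_mult_lcancel_nat)
    finally show ?thesis .
  qed
  have s: "(\<Sum>b = lo..hi. twisted_char \<theta> c d (b * m1) * cnj (twisted_char \<theta> c d (b * m2)))
     = (if [m1 = m2] (mod d) then (\<Sum>b | b \<in> {lo..hi} \<and> [b * m1 = c] (mod d). unit_exp ((\<theta> * (real m1 - real m2)) * real b)) else 0)"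
  proof (cases "[m1 = m2] (mod d)")
    case True
    have "(\<Sum>b = lo..hi. twisted_char \<theta> c d (b * m1) * cnj (twisted_char \<theta> c d (b * m2)))
      = (\<Sum>b | b \<in> {lo..hi} \<and> [b * m1 = c] (mod d). twisted_char \<theta> c d (b * m1) * cnj (twisted_char \<theta> c d (b * m2)))"
      by (intro sum.mono_neutral_right) (auto simp: twisted_char_def)
    also have "\<dots> = (\<Sum>b | b \<in> {lo..hi} \<and> [b * m1 = c] (mod d). unit_exp ((\<theta> * (real m1 - real m2)) * real b))"
    proof (intro sum.cong refl)
      fix b assume "b \<in> {b \<in> {lo..hi}. [b * m1 = c] (mod d)}"
      then have "[b * m1 = c] (mod d)" "[b * m2 = c] (mod d)" using iff True by auto
      then show "twisted_char \<theta> c d (b * m1) * cnj (twisted_char \<theta> c d (b * m2)) = unit_exp ((\<theta> * (real m1 - real m2)) * real b)"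
        by (simp add: twisted_char_def algebra_simps flip: unit_exp_diff)
    qed
    finally show ?thesis using True by simp
  next
    case False
    then have "twisted_char \<theta> c d (b * m1) * cnj (twisted_char \<theta> c d (b * m2)) = 0" for b
      using iff[of b] by (auto simp: twisted_char_def)
    then show ?thesis using False by (simp only: sum.neutral_const if_False)
  qed
  show ?thesis
  proof (cases "[m1 = m2] (mod d)")
    case True
    have "norm (\<Sum>b | b \<in> {lo..hi} \<and> [b * m1 = c] (mod d). unit_exp ((\<theta> * (real m1 - real m2)) * real b))
      \<le> min_inv Y (dist_nearest_int (\<theta> * (real m1 - real m2) * real d))"
      by (rule norm_sum_progression[OF d cop Y])
    then show ?thesis unfolding s using True by (simp add: mult_ac)
  qed (simp add: s)
qed

lemma sum_le_sum_reindexed: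
  fixes g :: "nat \<Rightarrow> real"
  assumes "inj_on f A" "f ` A \<subseteq> B" "finite B" "\<And>j. j \<in> B \<Longrightarrow> g j \<ge> 0"
  shows "(\<Sum>x\<in>A. g (f x)) \<le> (\<Sum>j\<in>B. g j)"
proof -
  have "(\<Sum>x\<in>A. g (f x)) = (\<Sum>j\<in>f ` A. g j)" using assms by (simp add: sum.reindex)
  also have "\<dots> \<le> (\<Sum>j\<in>B. g j)" using assms by (intro sum_mono2) auto
  finally show ?thesis .
qed

text \<open>The differences are \<open>d * j\<close>, and each \<open>j \<ge> 1\<close> occurs at
  most once on either side of \<open>m1\<close>, hence the factor 2; the diagonal contributes at
  most \<open>Y\<close>. Values below \<open>m1\<close> differ from it by at most \<open>m1\<close>,
  values above it by at most \<open>P\<close>, hence \<open>max P m1\<close>.\<close>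

lemma sum_min_inv_differences:
  assumes d: "d > 0" and Y: "Y \<ge> 0"
  shows "(\<Sum>m2 | m2 \<in> {1..P} \<and> [m1 = m2] (mod d). min_inv Y (dist_nearest_int (\<theta> * (real m1 - real m2))))
     \<le> Y + 2 * (\<Sum>j = 1..max P m1 div d. min_inv Y (dist_nearest_int (\<theta> * real d * real j)))"
proof -
  let ?h = "\<lambda>m2. min_inv Y (dist_nearest_int (\<theta> * (real m1 - real m2)))"
  let ?g = "\<lambda>j. min_inv Y (dist_nearest_int (\<theta> * real d * real j))"
  let ?X = "max P m1 div d"
  define A where "A = {m2. m2 \<in> {1..P} \<and> [m1 = m2] (mod d)}"
  have fin: "finite A" by (simp add: A_def)
  have gnn: "?g j \<ge> 0" for j by (intro min_inv_nonneg Y dist_nearest_int_nonneg)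
  have hnn: "?h j \<ge> 0" for j by (intro min_inv_nonneg Y dist_nearest_int_nonneg)
  have up: "\<exists>j. m2 = m1 + d * j \<and> j \<in> {1..?X}" if "m2 \<in> A" "m1 < m2" for m2
  proof -
    have "d dvd m2 - m1" using that by (auto simp: A_def cong_sym_eq[of m1] cong_altdef_nat)
    then obtain j where j: "m2 - m1 = d * j" by auto
    then have e: "m2 = m1 + d * j" using that by auto
    have "d * j \<le> max P m1" using e that by (auto simp: A_def)
    then have "j \<le> ?X" using d by (simp add: less_eq_div_iff_mult_less_eq mult.commute)
    moreover have "j \<noteq> 0" using e that by (auto intro: ccontr)
    ultimately show ?thesis using e by auto
  qed
  have down: "\<exists>j. m1 = m2 + d * j \<and> j \<in> {1..?X}" if "m2 \<in> A" "m2 < m1" for m2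
  proof -
    have "d dvd m1 - m2" using that by (auto simp: A_def cong_altdef_nat)
    then obtain j where j: "m1 - m2 = d * j" by auto
    then have e: "m1 = m2 + d * j" using that by auto
    have "d * j \<le> max P m1" using e by auto
    then have "j \<le> ?X" using d by (simp add: less_eq_div_iff_mult_less_eq mult.commute)
    moreover have "j \<noteq> 0" using e that by (auto intro: ccontr)
    ultimately show ?thesis using e by auto
  qed
  have 1: "(\<Sum>m2\<in>{m2 \<in> A. m1 < m2}. ?h m2) \<le> (\<Sum>j = 1..?X. ?g j)"
  proof -
    have "(\<Sum>m2\<in>{m2 \<in> A. m1 < m2}. ?h m2) = (\<Sum>m2\<in>{m2 \<in> A. m1 < m2}. ?g ((m2 - m1) div d))"
    proof (intro sum.cong refl)
      fix m2 assume "m2 \<in> {m2 \<in> A. m1 < m2}"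
      then obtain j where j: "m2 = m1 + d * j" using up by blast
      have "\<theta> * (real m1 - real m2) = - (\<theta> * real d * real j)" unfolding j by (simp add: algebra_simps)
      then show "?h m2 = ?g ((m2 - m1) div d)" unfolding j using d by (simp add: mult.assoc)
    qed
    also have "\<dots> \<le> (\<Sum>j = 1..?X. ?g j)"
    proof (rule sum_le_sum_reindexed)
      show "inj_on (\<lambda>m2. (m2 - m1) div d) {m2 \<in> A. m1 < m2}"
      proof (rule inj_onI)
        fix x y assume x: "x \<in> {m2 \<in> A. m1 < m2}" and y: "y \<in> {m2 \<in> A. m1 < m2}"
          and e: "(x - m1) div d = (y - m1) div d"
        obtain i where i: "x = m1 + d * i" using up[of x] x by blast
        obtain j where j: "y = m1 + d * j" using up[of y] y by blast
        show "x = y" using e d unfolding i j by simp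
      qed
      show "(\<lambda>m2. (m2 - m1) div d) ` {m2 \<in> A. m1 < m2} \<subseteq> {1..?X}"
      proof (clarify)
        fix x assume x: "x \<in> A" "m1 < x"
        obtain i where i: "x = m1 + d * i" "i \<in> {1..?X}" using up[OF x] by blast
        then show "(x - m1) div d \<in> {1..?X}" using d by simp
      qed
    qed (use gnn in auto)
    finally show ?thesis .
  qed
  have 2: "(\<Sum>m2\<in>{m2 \<in> A. m2 < m1}. ?h m2) \<le> (\<Sum>j = 1..?X. ?g j)"
  proof -
    have "(\<Sum>m2\<in>{m2 \<in> A. m2 < m1}. ?h m2) = (\<Sum>m2\<in>{m2 \<in> A. m2 < m1}. ?g ((m1 - m2) div d))"
    proof (intro sum.cong refl)
      fix m2 assume "m2 \<in> {m2 \<in> A. m2 < m1}"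
      then obtain j where j: "m1 = m2 + d * j" using down by blast
      have "\<theta> * (real m1 - real m2) = \<theta> * real d * real j" unfolding j by (simp add: algebra_simps)
      then show "?h m2 = ?g ((m1 - m2) div d)" unfolding j using d by (simp add: mult.assoc)
    qed
    also have "\<dots> \<le> (\<Sum>j = 1..?X. ?g j)"
    proof (rule sum_le_sum_reindexed)
      show "inj_on (\<lambda>m2. (m1 - m2) div d) {m2 \<in> A. m2 < m1}"
      proof (rule inj_onI)
        fix x y assume x: "x \<in> {m2 \<in> A. m2 < m1}" and y: "y \<in> {m2 \<in> A. m2 < m1}"
          and e: "(m1 - x) div d = (m1 - y) div d"
        obtain i where i: "m1 = x + d * i" using down[of x] x by blast
        obtain j where j: "m1 = y + d * j" using down[of y] y by blast
        have "m1 - x = d * i" "m1 - y = d * j" using i j by linarith+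
        then have "i = j" using e d by simp
        then show "x = y" using i j by simp
      qed
      show "(\<lambda>m2. (m1 - m2) div d) ` {m2 \<in> A. m2 < m1} \<subseteq> {1..?X}"
      proof (clarify)
        fix x assume x: "x \<in> A" "x < m1"
        obtain i where i: "m1 = x + d * i" "i \<in> {1..?X}" using down[OF x] by blast
        have "m1 - x = d * i" using i by linarith
        then show "(m1 - x) div d \<in> {1..?X}" using i(2) d by simp
      qed
    qed (use gnn in auto)
    finally show ?thesis .
  qed
  have 3: "(\<Sum>m2\<in>{m2 \<in> A. m2 = m1}. ?h m2) \<le> Y"
  proof -
    have "(\<Sum>m2\<in>{m2 \<in> A. m2 = m1}. ?h m2) \<le> (\<Sum>m2\<in>{m1}. ?h m2)"
      by (intro sum_mono2 hnn) auto
    also have "\<dots> \<le> Y" using min_inv_le1 by simp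
    finally show ?thesis .
  qed
  have "(\<Sum>m2\<in>A. ?h m2) = (\<Sum>m2\<in>({m2 \<in> A. m2 = m1} \<union> {m2 \<in> A. m1 < m2}) \<union> {m2 \<in> A. m2 < m1}. ?h m2)"
    by (intro sum.cong) auto
  also have "\<dots> = (\<Sum>m2\<in>{m2 \<in> A. m2 = m1} \<union> {m2 \<in> A. m1 < m2}. ?h m2) + (\<Sum>m2\<in>{m2 \<in> A. m2 < m1}. ?h m2)"
    using fin by (intro sum.union_disjoint) auto
  also have "(\<Sum>m2\<in>{m2 \<in> A. m2 = m1} \<union> {m2 \<in> A. m1 < m2}. ?h m2)
      = (\<Sum>m2\<in>{m2 \<in> A. m2 = m1}. ?h m2) + (\<Sum>m2\<in>{m2 \<in> A. m1 < m2}. ?h m2)"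
    using fin by (intro sum.union_disjoint) auto
  finally have "(\<Sum>m2\<in>A. ?h m2) \<le> Y + 2 * (\<Sum>j = 1..?X. ?g j)" using 1 2 3 by linarith
  then show ?thesis unfolding A_def .
qed

text \<open>Cauchy-Schwarz in \<open>b\<close> removes the coefficients \<open>a\<close> and leaves
  correlations over pairs \<open>m1\<close>, \<open>m2\<close>. The condition
  \<open>b * m \<le> N\<close> only shortens the range of \<open>b\<close>, which stays an interval
  of length below \<open>M\<close>, so the same \<open>Y\<close> serves every pair.\<close>

lemma type_II_bound:
  fixes a B :: "nat \<Rightarrow> real"
  assumes d: "d > 0" and cop: "coprime c d" and M: "M > 0"
    and lohi: "M \<le> lo" "hi < 2 * M"
    and a: "\<And>b. \<bar>a b\<bar> \<le> 1" and B: "\<And>m. m \<in> {1..N div M} \<Longrightarrow> \<bar>B m\<bar> \<le> L" and L: "L \<ge> 0"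
    and Y: "Y = real M / real d + 1"
  shows "(norm (\<Sum>b = lo..hi. of_real (a b) * (\<Sum>m = 1..N div b. of_real (B m) * twisted_char \<theta> c d (b * m))))\<^sup>2
     \<le> real M * L\<^sup>2 * real (N div M) * (Y + 2 * (\<Sum>j = 1..N div M div d. min_inv Y (dist_nearest_int (\<theta> * real d * real d * real j))))"
proof -
  define P where "P = N div M"
  let ?w = "twisted_char \<theta> c d"
  define inner where "inner = (\<lambda>b. \<Sum>m = 1..N div b. of_real (B m) * ?w (b * m))"
  define G where "G = Y + 2 * (\<Sum>j = 1..P div d. min_inv Y (dist_nearest_int (\<theta> * real d * real d * real j)))"
  have Ynn: "Y \<ge> 0" using Y by simp
  have inner: "inner b = (\<Sum>m = 1..P. of_real (if b * m \<le> N then B m else 0) * ?w (b * m))" if b: "b \<in> {lo..hi}" for b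
  proof -
    have bp: "b > 0" "M \<le> b" using b M lohi by auto
    have iff: "m \<le> N div b \<longleftrightarrow> b * m \<le> N" for m using bp by (simp add: less_eq_div_iff_mult_less_eq mult.commute)
    have "N div b \<le> P" unfolding P_def using bp M by (intro div_le_mono2) auto
    then show ?thesis unfolding inner_def using iff
      by (intro sum.mono_neutral_cong_left) auto
  qed
  have 1: "norm (\<Sum>b = lo..hi. of_real (a b) * inner b) \<le> (\<Sum>b = lo..hi. norm (inner b))"
    by (intro order.trans[OF norm_sum] sum_mono) (auto simp: norm_mult a intro!: mult_left_le_one_le)
  have 2: "(\<Sum>b = lo..hi. (norm (inner b))\<^sup>2) \<le> L\<^sup>2 * real P * G"
  proof -
    have "of_real (\<Sum>b = lo..hi. (norm (inner b))\<^sup>2) = (\<Sum>b = lo..hi. inner b * cnj (inner b))"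
      by (simp only: of_real_sum complex_norm_square)
    also have "\<dots> = (\<Sum>b = lo..hi. \<Sum>m1 = 1..P. \<Sum>m2 = 1..P.
        of_real ((if b * m1 \<le> N then B m1 else 0) * (if b * m2 \<le> N then B m2 else 0)) * (?w (b * m1) * cnj (?w (b * m2))))"
      by (intro sum.cong refl) (simp add: inner sum_product mult_ac)
    also have "\<dots> = (\<Sum>m1 = 1..P. \<Sum>m2 = 1..P. \<Sum>b = lo..hi.
        of_real ((if b * m1 \<le> N then B m1 else 0) * (if b * m2 \<le> N then B m2 else 0)) * (?w (b * m1) * cnj (?w (b * m2))))"
      by (subst sum.swap, rule sum.cong[OF refl], rule sum.swap)
    also have "\<dots> = (\<Sum>m1 = 1..P. \<Sum>m2 = 1..P. of_real (B m1 * B m2) *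
        (\<Sum>b = lo..min hi (min (N div m1) (N div m2)). ?w (b * m1) * cnj (?w (b * m2))))"
    proof (intro sum.cong refl)
      fix m1 m2 assume m: "m1 \<in> {1..P}" "m2 \<in> {1..P}"
      then have iff: "b \<le> N div m1 \<longleftrightarrow> b * m1 \<le> N" "b \<le> N div m2 \<longleftrightarrow> b * m2 \<le> N" for b
        by (auto simp: less_eq_div_iff_mult_less_eq)
      show "(\<Sum>b = lo..hi. of_real ((if b * m1 \<le> N then B m1 else 0) * (if b * m2 \<le> N then B m2 else 0)) * (?w (b * m1) * cnj (?w (b * m2))))
        = of_real (B m1 * B m2) * (\<Sum>b = lo..min hi (min (N div m1) (N div m2)). ?w (b * m1) * cnj (?w (b * m2)))"
        unfolding sum_distrib_left using iff by (intro sum.mono_neutral_cong_right) auto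
    qed
    finally have e: "complex_of_real (\<Sum>b = lo..hi. (norm (inner b))\<^sup>2) = (\<Sum>m1 = 1..P. \<Sum>m2 = 1..P. of_real (B m1 * B m2) *
        (\<Sum>b = lo..min hi (min (N div m1) (N div m2)). ?w (b * m1) * cnj (?w (b * m2))))"
      .
    have "0 \<le> (\<Sum>b = lo..hi. (norm (inner b))\<^sup>2)" by (intro sum_nonneg) auto
    then have n: "(\<Sum>b = lo..hi. (norm (inner b))\<^sup>2) = norm (complex_of_real (\<Sum>b = lo..hi. (norm (inner b))\<^sup>2))"
      by (simp only: norm_of_real abs_of_nonneg)
    have "(\<Sum>b = lo..hi. (norm (inner b))\<^sup>2) \<le> (\<Sum>m1 = 1..P. \<Sum>m2 = 1..P. L\<^sup>2 *
       (if [m1 = m2] (mod d) then min_inv Y (dist_nearest_int (\<theta> * real d * (real m1 - real m2))) else 0))"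
      unfolding n[unfolded e]
    proof (intro order.trans[OF norm_sum] sum_mono)
      fix m1 m2 assume m: "m1 \<in> {1..P}" "m2 \<in> {1..P}"
      have "\<bar>B m1\<bar> * \<bar>B m2\<bar> \<le> L * L" using m B L by (intro mult_mono) (auto simp: P_def)
      then have b: "norm (complex_of_real (B m1 * B m2)) \<le> L\<^sup>2"
        by (simp only: norm_of_real abs_mult power2_eq_square)
      have c: "real (min hi (min (N div m1) (N div m2)) - lo) / real d + 1 \<le> Y"
        unfolding Y using lohi by (intro add_right_mono divide_right_mono) auto
      show "norm (of_real (B m1 * B m2) * (\<Sum>b = lo..min hi (min (N div m1) (N div m2)). ?w (b * m1) * cnj (?w (b * m2))))
        \<le> L\<^sup>2 * (if [m1 = m2] (mod d) then min_inv Y (dist_nearest_int (\<theta> * real d * (real m1 - real m2))) else 0)"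
        unfolding norm_mult[of "of_real (B m1 * B m2)"]
        by (rule mult_mono[OF b sum_twisted_char_correlation[OF d cop c]]) auto
    qed
    also have "\<dots> = L\<^sup>2 * (\<Sum>m1 = 1..P. \<Sum>m2 | m2 \<in> {1..P} \<and> [m1 = m2] (mod d). min_inv Y (dist_nearest_int (\<theta> * real d * (real m1 - real m2))))"
    proof -
      have "(\<Sum>m2 = 1..P. if [m1 = m2] (mod d) then min_inv Y (dist_nearest_int (\<theta> * real d * (real m1 - real m2))) else 0)
        = (\<Sum>m2 | m2 \<in> {1..P} \<and> [m1 = m2] (mod d). min_inv Y (dist_nearest_int (\<theta> * real d * (real m1 - real m2))))" for m1
        by (intro sum.mono_neutral_cong_right) auto
      then show ?thesis by (simp only: flip: sum_distrib_left)
    qed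
    also have "\<dots> \<le> L\<^sup>2 * (\<Sum>m1 = 1..P. G)"
    proof (intro mult_left_mono sum_mono)
      fix m1 assume "m1 \<in> {1..P}"
      then have "max P m1 = P" by auto
      then show "(\<Sum>m2 | m2 \<in> {1..P} \<and> [m1 = m2] (mod d). min_inv Y (dist_nearest_int (\<theta> * real d * (real m1 - real m2)))) \<le> G"
        using sum_min_inv_differences[OF d Ynn, where P = P and ?m1.0 = m1 and \<theta> = "\<theta> * real d"] by (simp add: G_def)
    qed auto
    finally show ?thesis by simp
  qed
  have "(norm (\<Sum>b = lo..hi. of_real (a b) * inner b))\<^sup>2 \<le> (\<Sum>b = lo..hi. norm (inner b))\<^sup>2"
    using 1 by (intro power_mono) auto
  also have "\<dots> \<le> (\<Sum>b = lo..hi. (norm (inner b))\<^sup>2) * real (card {lo..hi})"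
    by (rule sum_squared_le_sum_of_squares)
  also have "\<dots> \<le> (\<Sum>b = lo..hi. (norm (inner b))\<^sup>2) * real M"
    using lohi by (intro mult_left_mono sum_nonneg) auto
  also have "\<dots> \<le> L\<^sup>2 * real P * G * real M"
    using 2 by (intro mult_right_mono) auto
  also have "\<dots> = real M * L\<^sup>2 * real P * G" by (simp add: mult_ac)
  finally show ?thesis unfolding inner_def G_def P_def .
qed

section \<open>Exponential sums over primes\<close>

lemma harm_le: "harm n \<le> 1 + ln (real n)" if "n > 0"
proof -
  have "harm n - ln (of_nat n) \<le> harm 1 - ln (of_nat 1 :: real)"
    by (rule euler_mascheroni_sequence_decreasing) (use that in auto)
  then show ?thesis by (simp add: harm_def)
qed

text \<open>What is retained of Dirichlet's theorem: \<open>q\<close> behaves like the denominator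
  of a good approximation to \<theta>, without mention of the fraction. The size of \<open>q\<close>
  enters separately.\<close>

definition spaced_multiples :: "real \<Rightarrow> nat \<Rightarrow> bool" where
  "spaced_multiples \<theta> q \<longleftrightarrow> q > 0 \<and>
    (\<forall>j. 1 \<le> j \<longrightarrow> 2 * j \<le> q \<longrightarrow> dist_nearest_int (\<theta> * real j) \<ge> 1 / (2 * real q))"

lemma sum_min_inv_multiples_le:
  assumes sp: "spaced_multiples \<theta> q" and W: "W \<ge> 0" and q: "q \<le> 2 * N" and T: "T \<le> N" and N: "N > 0"
  shows "(\<Sum>j = 1..T. min_inv (W / real j) (dist_nearest_int (\<theta> * real j)))
          \<le> 48 * (1 + ln (real N)) * (real q + real T + W / real q)"
proof -
  have q0: "q > 0" using sp by (simp add: spaced_multiples_def)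
  have l4: "ln (4::real) \<le> 2"
    using ln_add_one_self_le_self[of 3] ln_2_less_1 ln_mult[of 2 "2::real"] by simp
  have N0: "ln (real N) \<ge> 0" using N by simp
  have "harm (2 * q) \<le> 1 + ln (real (2 * q))" using q0 by (intro harm_le) auto
  also have "\<dots> \<le> 1 + ln (4 * real N)" using q0 q N by simp
  also have "\<dots> = 1 + ln 4 + ln (real N)" using N by (subst ln_mult) auto
  finally have h1: "harm (2 * q) \<le> 3 + ln (real N)" using l4 by linarith
  have "harm T \<le> (harm N :: real)"
    unfolding harm_def using T by (intro sum_mono2) auto
  then have h2: "harm T \<le> 1 + ln (real N)" using harm_le[OF N] by linarith
  have "(\<Sum>j = 1..T. min_inv (W / real j) (dist_nearest_int (\<theta> * real j)))
    \<le> 8 * (real q + real T + W / real q) * (1 + harm (2 * q) + harm T)"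
    by (rule sum_min_inv_multiples) (use sp W in \<open>auto simp: spaced_multiples_def\<close>)
  also have "\<dots> \<le> 8 * (real q + real T + W / real q) * (6 * (1 + ln (real N)))"
    using h1 h2 N0 W by (intro mult_left_mono) auto
  also have "\<dots> = 48 * (1 + ln (real N)) * (real q + real T + W / real q)"
    by (simp only: mult.assoc mult.commute mult.left_commute) simp
  finally show ?thesis .
qed

text \<open>By \<open>U * U * d \<le> N\<close> one has \<open>N / (t d) \<ge> 1\<close> for all
  \<open>t \<le> U * U\<close>. The \<open>+ 1\<close> in the length of a progression is thus
  absorbed into \<open>2 N / (d t)\<close>, the form \<open>W / t\<close> that
  \<open>sum_min_inv_multiples_le\<close> takes.\<close>

lemma type_I_sum:
  assumes N: "N > 0" and d: "d > 0" and cop: "coprime c d" and U: "U * U * d \<le> N"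
    and sp: "spaced_multiples (\<theta> * real d) q" and q: "q \<le> 2 * N"
  shows "norm (\<Sum>b | b \<in> {1..N} \<and> b \<le> U. of_real (moebius_mu b) *
           (\<Sum>m = 1..N div b. of_real (mangoldt_tail U m) * twisted_char \<theta> c d (b * m)))
     \<le> 2 * ln (real N) * (48 * (1 + ln (real N)) * (real q + real (U * U) + 2 * real N / real d / real q))"
proof -
  let ?J = "\<lambda>t. min_inv (2 * real N / real d / real t) (dist_nearest_int (\<theta> * real d * real t))"
  have UN: "U * U \<le> N" using U d by (metis le_square mult.right_neutral mult_le_mono2 One_nat_def Suc_leI order.trans)
  have "norm (\<Sum>b | b \<in> {1..N} \<and> b \<le> U. of_real (moebius_mu b) *
           (\<Sum>m = 1..N div b. of_real (mangoldt_tail U m) * twisted_char \<theta> c d (b * m)))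
     \<le> 2 * ln (real N) * (\<Sum>t = 1..U * U. ?J t)"
  proof (rule type_I_bound[OF UN])
    fix t j assume t: "1 \<le> t" "t \<le> U * U"
    show "norm (\<Sum>m = j..N div t. twisted_char \<theta> c d (t * m)) \<le> ?J t"
    proof (rule norm_sum_twisted_char[OF d cop])
      have "t * d \<le> N" using t U by (meson mult_le_mono1 order.trans)
      then have td: "real t * real d \<le> real N" by (metis of_nat_le_iff of_nat_mult)
      have "real (N div t - j) / real d + 1 \<le> real N / real t / real d + 1"
        using of_nat_div_le_of_nat[of N t, where ?'a = real] by (intro add_right_mono divide_right_mono) auto
      also have "1 \<le> real N / real t / real d" using td t d by (simp add: field_simps)
      finally show "real (N div t - j) / real d + 1 \<le> 2 * real N / real d / real t"
        by (simp add: field_simps)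
    qed
  qed
  also have "\<dots> \<le> 2 * ln (real N) * (48 * (1 + ln (real N)) * (real q + real (U * U) + 2 * real N / real d / real q))"
    using N by (intro mult_left_mono sum_min_inv_multiples_le[OF sp _ q UN N]) auto
  finally show ?thesis .
qed

text \<open>A block of \<open>b\<close> between \<open>M\<close> and \<open>2 M\<close> contributes
  only if \<open>U < 2 M\<close> and, by the gap of \<open>mangoldt_tail\<close>,
  \<open>U < P = N div M\<close>. This gives \<open>M \<le> N / U\<close> for the diagonal and
  \<open>P \<le> 2 N / U\<close> for the number of differences. The result is free of
  \<open>i\<close>, so that the blocks can simply be counted.\<close>

lemma type_II_dyadic:
  fixes i :: nat
  assumes N: "N > 0" and d: "d > 0" and cop: "coprime c d" and dU: "d \<le> U"
    and sp: "spaced_multiples (\<theta> * real d * real d) q" and q: "q \<le> 2 * N"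
  shows "(norm (\<Sum>b = max (2 ^ i) (U + 1)..min (2 * 2 ^ i - 1) N. of_real (moebius_mu b) *
           (\<Sum>m = 1..N div b. of_real (mangoldt_tail U m) * twisted_char \<theta> c d (b * m))))\<^sup>2
     \<le> 300 * (1 + ln (real N)) ^ 3 * real N * (real q + real N / real U + real N / (real d * real d * real q))"
    (is "?T\<^sup>2 \<le> ?R")
proof -
  define M where "M = (2::nat) ^ i"
  have M: "M > 0" by (simp add: M_def)
  define P where "P = N div M"
  define L where "L = 1 + ln (real N)"
  have lnN: "ln (real N) \<ge> 0" using N by simp
  have L: "L \<ge> 1" "ln (real N) \<le> L" using lnN by (auto simp: L_def)
  have Rnn: "?R \<ge> 0" using lnN by (intro mult_nonneg_nonneg add_nonneg_nonneg) auto
  show ?thesis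
  proof (cases "2 * M > U \<and> P > U")
    case False
    have "?T = 0"
    proof (cases "2 * M > U")
      case True
      then have PU: "P \<le> U" using False by simp
      have "(\<Sum>m = 1..N div b. of_real (mangoldt_tail U m) * twisted_char \<theta> c d (b * m)) = 0"
        if b: "b \<in> {max (2 ^ i) (U + 1)..min (2 * 2 ^ i - 1) N}" for b
      proof (rule sum.neutral, rule ballI)
        fix m assume m: "m \<in> {1..N div b}"
        have "N div b \<le> P" unfolding P_def using b M by (intro div_le_mono2) (auto simp: M_def)
        then have "mangoldt_tail U m = 0" using m PU by (intro mangoldt_tail_eq_0) auto
        then show "of_real (mangoldt_tail U m) * twisted_char \<theta> c d (b * m) = 0" by simp
      qed
      then show ?thesis by simp
    next
      case False
      then have "{max (2 ^ i) (U + 1)..min (2 * 2 ^ i - 1) N} = {}" by (auto simp: M_def)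
      then show ?thesis by simp
    qed
    then show ?thesis using Rnn by simp
  next
    case True
    have U0: "U > 0" using d dU by simp
    have MP: "real M * real P \<le> real N"
    proof -
      have "M * P \<le> N" by (simp add: P_def)
      then show ?thesis by (metis of_nat_le_iff of_nat_mult)
    qed
    have MU: "real M \<le> real N / real U"
    proof -
      have "real M * real U \<le> real M * real P" using True by (intro mult_left_mono) auto
      then show ?thesis using MP U0 by (simp add: field_simps)
    qed
    have PU: "real P \<le> 2 * real N / real U"
    proof -
      have "real U * real P \<le> (2 * real M) * real P" using True by (intro mult_right_mono) auto
      then show ?thesis using MP U0 by (simp add: field_simps)
    qed
    define Y where "Y = real M / real d + 1"
    \<comment> \<open>From \<open>d \<le> U < 2 M\<close> one gets \<open>Y \<le> 3 M / d\<close>,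
      and \<open>M j d \<le> M P \<le> N\<close> turns this into \<open>3 N / (d\<^sup>2 j)\<close>,
      that is \<open>W / j\<close>.\<close>
    define W where "W = 3 * real N / (real d * real d)"
    have Wnn: "W \<ge> 0" by (simp add: W_def)
    have Y3: "Y \<le> 3 * real M / real d"
    proof -
      have "real d \<le> 2 * real M" using True dU by linarith
      then show ?thesis unfolding Y_def using d by (simp add: field_simps)
    qed
    let ?r = "\<lambda>j. dist_nearest_int (\<theta> * real d * real d * real j)"
    have PN: "P div d \<le> N" unfolding P_def by (meson div_le_dividend order.trans)
    have "(\<Sum>j = 1..P div d. min_inv Y (?r j)) \<le> (\<Sum>j = 1..P div d. min_inv (W / real j) (?r j))"
    proof (intro sum_mono min_inv_mono)
      fix j assume j: "j \<in> {1..P div d}"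
      then have "j * d \<le> P" using d by (simp add: less_eq_div_iff_mult_less_eq)
      then have "real j * real d \<le> real P" by (metis of_nat_le_iff of_nat_mult)
      then have "real M * (real j * real d) \<le> real M * real P" by (intro mult_left_mono) auto
      then have "real M * (real j * real d) \<le> real N" using MP by linarith
      then have "3 * real M / real d \<le> W / real j" using j d unfolding W_def by (simp add: field_simps)
      then show "Y \<le> W / real j" using Y3 by linarith
    qed
    also have "\<dots> \<le> 48 * L * (real q + real (P div d) + W / real q)"
      unfolding L_def by (rule sum_min_inv_multiples_le[OF sp Wnn q PN N])
    also have "\<dots> \<le> 48 * L * (real q + 2 * (real N / real U) + 3 * (real N / (real d * real d * real q)))"
    proof (intro mult_left_mono add_mono)
      have "real (P div d) \<le> real P" by (simp add: div_le_dividend)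
      then show "real (P div d) \<le> 2 * (real N / real U)" using PU by linarith
    qed (use L in \<open>auto simp: W_def\<close>)
    finally have S: "(\<Sum>j = 1..P div d. min_inv Y (?r j))
      \<le> 48 * L * (real q + 2 * (real N / real U) + 3 * (real N / (real d * real d * real q)))" .
    have YL: "Y \<le> 3 * L * (real N / real U)"
    proof -
      have "3 * real M / real d \<le> 3 * real M / 1" using d by (intro divide_left_mono) auto
      also have "\<dots> \<le> 3 * (real N / real U)" using MU by simp
      also have "\<dots> \<le> L * (3 * (real N / real U))" using L by (intro mult_right_mono[of 1 L, simplified]) auto
      finally show ?thesis using Y3 by (simp add: mult_ac)
    qed
    have "?T\<^sup>2 \<le> real M * (ln (real N))\<^sup>2 * real (N div M) * (Y + 2 * (\<Sum>j = 1..N div M div d. min_inv Y (?r j)))"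
    proof (rule type_II_bound[OF d cop M])
      show "M \<le> max (2 ^ i) (U + 1)" by (simp add: M_def)
      have "2 * M - 1 < 2 * M" using M by simp
      then show "min (2 * 2 ^ i - 1) N < 2 * M" unfolding M_def by linarith
      fix m assume m: "m \<in> {1..N div M}"
      then have "m \<le> N" by (meson atLeastAtMost_iff div_le_dividend order.trans)
      then have "ln (real m) \<le> ln (real N)" using m by simp
      then show "\<bar>mangoldt_tail U m\<bar> \<le> ln (real N)"
        using m mangoldt_tail_le[of m U] mangoldt_tail_nonneg[of U m] by auto
    qed (use lnN Y_def abs_moebius_mu_le_1 in auto)
    also have "\<dots> = (real M * real P) * (ln (real N))\<^sup>2 * (Y + 2 * (\<Sum>j = 1..P div d. min_inv Y (?r j)))"
      by (simp add: P_def)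
    also have "\<dots> \<le> (real M * real P) * (ln (real N))\<^sup>2 * (3 * L * (real N / real U) +
        2 * (48 * L * (real q + 2 * (real N / real U) + 3 * (real N / (real d * real d * real q)))))"
      using YL S by (intro mult_left_mono add_mono) auto
    also have "\<dots> \<le> real N * L\<^sup>2 * (3 * L * (real N / real U) +
        2 * (48 * L * (real q + 2 * (real N / real U) + 3 * (real N / (real d * real d * real q)))))"
      using MP L lnN by (intro mult_right_mono mult_mono power_mono add_nonneg_nonneg mult_nonneg_nonneg) auto
    \<comment> \<open>The coefficients to be dominated by 300 are 96 for \<open>q\<close>, 195 for
      \<open>N / U\<close> and 288 for the last term.\<close>
    also have "\<dots> \<le> real N * L\<^sup>2 * (300 * L * (real q + real N / real U + real N / (real d * real d * real q)))"
    proof (intro mult_left_mono)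
      define x y where "x = real N / real U" and "y = real N / (real d * real d * real q)"
      have xy: "L * x \<ge> 0" "L * y \<ge> 0" "L * real q \<ge> 0" using L by (auto simp: x_def y_def)
      have "300 * L * (real q + x + y) - (3 * L * x + 2 * (48 * L * (real q + 2 * x + 3 * y)))
        = 204 * (L * real q) + 105 * (L * x) + 12 * (L * y)" by (simp add: algebra_simps)
      then show "3 * L * x + 2 * (48 * L * (real q + 2 * x + 3 * y)) \<le> 300 * L * (real q + x + y)"
        using xy by linarith
    qed auto
    also have "\<dots> = ?R" by (simp add: L_def power2_eq_square power3_eq_cube mult_ac)
    finally show ?thesis .
  qed
qed

lemma type_II_sum:
  assumes N: "N > 0" and d: "d > 0" and cop: "coprime c d" and dU: "d \<le> U"
    and sp: "spaced_multiples (\<theta> * real d * real d) q" and q: "q \<le> 2 * N"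
  shows "norm (\<Sum>b | b \<in> {1..N} \<and> U < b. of_real (moebius_mu b) *
           (\<Sum>m = 1..N div b. of_real (mangoldt_tail U m) * twisted_char \<theta> c d (b * m)))
     \<le> 3 * (1 + ln (real N)) *
       sqrt (300 * (1 + ln (real N)) ^ 3 * real N * (real q + real N / real U + real N / (real d * real d * real q)))"
proof -
  define R where "R = 300 * (1 + ln (real N)) ^ 3 * real N * (real q + real N / real U + real N / (real d * real d * real q))"
  let ?F = "\<lambda>b. of_real (moebius_mu b) *
           (\<Sum>m = 1..N div b. of_real (mangoldt_tail U m) * twisted_char \<theta> c d (b * m))"
  have "(\<Sum>b | b \<in> {1..N} \<and> U < b. ?F b) = (\<Sum>i\<in>{..floor_log N}. \<Sum>b | b \<in> {b \<in> {1..N}. U < b} \<and> floor_log b = i. ?F b)"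
    by (rule sum.group[symmetric]) (auto intro: floor_log_le_iff)
  also have "\<dots> = (\<Sum>i\<in>{..floor_log N}. \<Sum>b = max (2 ^ i) (U + 1)..min (2 * 2 ^ i - 1) N. ?F b)"
  proof (intro sum.cong refl)
    fix i
    have fl: "floor_log b = i \<longleftrightarrow> 2 ^ i \<le> b \<and> b \<le> 2 * 2 ^ i - 1" if "b > 0" for b
    proof
      assume "floor_log b = i"
      then show "2 ^ i \<le> b \<and> b \<le> 2 * 2 ^ i - 1"
        using floor_log_exp2_le[OF that] floor_log_exp2_gt[of b] by fastforce
    next
      assume "2 ^ i \<le> b \<and> b \<le> 2 * 2 ^ i - 1"
      then have "2 ^ i \<le> b" "b < 2 * 2 ^ i" using that by linarith+
      then show "floor_log b = i" using floor_log_eqI[OF that] by blast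
    qed
    show "{b \<in> {b \<in> {1..N}. U < b}. floor_log b = i} = {max (2 ^ i) (U + 1)..min (2 * 2 ^ i - 1) N}"
    proof (intro equalityI subsetI)
      fix b assume "b \<in> {b \<in> {b \<in> {1..N}. U < b}. floor_log b = i}"
      then have "b > 0" "b \<le> N" "U < b" "floor_log b = i" by auto
      then show "b \<in> {max (2 ^ i) (U + 1)..min (2 * 2 ^ i - 1) N}" using fl[of b] by simp
    next
      fix b assume "b \<in> {max (2 ^ i) (U + 1)..min (2 * 2 ^ i - 1) N}"
      then have "b > 0" "b \<le> N" "U < b" "2 ^ i \<le> b" "b \<le> 2 * 2 ^ i - 1" by auto
      then show "b \<in> {b \<in> {b \<in> {1..N}. U < b}. floor_log b = i}" using fl[of b] by simp
    qed
  qed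
  also have "norm \<dots> \<le> (\<Sum>i\<in>{..floor_log N}. sqrt R)"
  proof (rule order.trans[OF norm_sum], rule sum_mono)
    fix i
    show "norm (\<Sum>b = max (2 ^ i) (U + 1)..min (2 * 2 ^ i - 1) N. ?F b) \<le> sqrt R"
      using type_II_dyadic[OF assms, of i] unfolding R_def by (rule real_le_rsqrt)
  qed
  also have "\<dots> = real (floor_log N + 1) * sqrt R" by simp
  also have "\<dots> \<le> 3 * (1 + ln (real N)) * sqrt R"
  proof (rule mult_right_mono)
    have "2 ^ floor_log N \<le> N" using N by (rule floor_log_exp2_le)
    then have "(2::real) ^ floor_log N \<le> real N" by (metis of_nat_le_iff of_nat_numeral of_nat_power)
    then have "ln ((2::real) ^ floor_log N) \<le> ln (real N)" using N by (subst ln_le_cancel_iff) auto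
    then have "real (floor_log N) * ln 2 \<le> ln (real N)" by (simp add: ln_realpow)
    moreover have "real (floor_log N) * (1 / 2) \<le> real (floor_log N) * ln 2"
      using ln2_ge_two_thirds by (intro mult_left_mono) auto
    ultimately have "real (floor_log N) \<le> 2 * ln (real N)" by linarith
    moreover have "ln (real N) \<ge> 0" using N by simp
    ultimately show "real (floor_log N + 1) \<le> 3 * (1 + ln (real N))" by simp
  next
    show "0 \<le> sqrt R" unfolding R_def using N by (intro real_sqrt_ge_zero mult_nonneg_nonneg add_nonneg_nonneg) auto
  qed
  finally show ?thesis unfolding R_def .
qed

text \<open>Type I and type II sums involve the frequencies \<open>\<theta> d\<close> and
  \<open>\<theta> d\<^sup>2\<close>, so each has its own denominator; \<open>E\<close> bounds both
  denominators and both quotients that enter the estimates. The terms \<open>n \<le> U\<close> are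
  estimated trivially and disappear in \<open>U\<^sup>2\<close>.\<close>

lemma exponential_sum_bound:
  assumes N: "N > 0" and d: "d > 0" and cop: "coprime c d" and dU: "d \<le> U" and U: "U * U * d \<le> N"
    and sp1: "spaced_multiples (\<theta> * real d) q1" and sp2: "spaced_multiples (\<theta> * real d * real d) q2"
    and q1N: "q1 \<le> 2 * N" and q2N: "q2 \<le> 2 * N"
    and q1: "real q1 \<le> E" "real N / (real d * real q1) \<le> E"
    and q2: "real q2 \<le> E" "real N / (real d * real d * real q2) \<le> E"
  shows "norm (\<Sum>n = 1..N. of_real (mangoldt n) * twisted_char \<theta> c d n)
     \<le> 600 * (1 + ln (real N)) ^ 3 * (real U ^ 2 + E + sqrt (real N * (E + real N / real U)))"
proof -
  define L where "L = 1 + ln (real N)"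
  have lnN: "ln (real N) \<ge> 0" using N by simp
  have L: "L \<ge> 1" "ln (real N) \<le> L" using lnN by (auto simp: L_def)
  have U0: "U > 0" using d dU by simp
  have E0: "E \<ge> 0" using q1(1) by linarith
  have L13: "L \<le> L ^ 3" "L\<^sup>2 \<le> L ^ 3" using L by (auto intro: power_increasing[of 1 3 L, simplified] power_increasing)
  let ?V = "real U ^ 2"
  have U1: "real U \<le> ?V" using U0 by (simp add: self_le_power)
  define G where "G = real N * (E + real N / real U)"
  have G0: "G \<ge> 0" using E0 by (simp add: G_def)
  have 1: "norm (\<Sum>n | n \<in> {1..N} \<and> n \<le> U. of_real (mangoldt n) * twisted_char \<theta> c d n) \<le> L ^ 3 * ?V"
  proof -
    have "norm (\<Sum>n | n \<in> {1..N} \<and> n \<le> U. of_real (mangoldt n) * twisted_char \<theta> c d n)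
      \<le> (\<Sum>n | n \<in> {1..N} \<and> n \<le> U. L)"
    proof (rule order.trans[OF norm_sum], rule sum_mono)
      fix n assume n: "n \<in> {n \<in> {1..N}. n \<le> U}"
      have "norm (of_real (mangoldt n) * twisted_char \<theta> c d n) \<le> mangoldt n * 1"
        unfolding norm_mult using norm_twisted_char_le mangoldt_nonneg by (intro mult_mono) auto
      also have "\<dots> \<le> ln (real n)" using n mangoldt_le[of n] by auto
      also have "\<dots> \<le> ln (real N)" using n by auto
      finally show "norm (of_real (mangoldt n) * twisted_char \<theta> c d n) \<le> L" using L by linarith
    qed
    also have "\<dots> = real (card {n \<in> {1..N}. n \<le> U}) * L" by simp
    also have "\<dots> \<le> real U * L"
    proof -
      have "card {n \<in> {1..N}. n \<le> U} \<le> card {1..U}" by (intro card_mono) auto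
      then show ?thesis using L by (intro mult_right_mono) auto
    qed
    also have "\<dots> \<le> ?V * L ^ 3" using U1 L13 L by (intro mult_mono) auto
    finally show ?thesis by (simp add: mult.commute)
  qed
  have 2: "norm (\<Sum>b | b \<in> {1..N} \<and> b \<le> U. of_real (moebius_mu b) *
           (\<Sum>m = 1..N div b. of_real (mangoldt_tail U m) * twisted_char \<theta> c d (b * m)))
     \<le> 300 * L ^ 3 * (?V + E)"
  proof -
    have "norm (\<Sum>b | b \<in> {1..N} \<and> b \<le> U. of_real (moebius_mu b) *
           (\<Sum>m = 1..N div b. of_real (mangoldt_tail U m) * twisted_char \<theta> c d (b * m)))
     \<le> 2 * ln (real N) * (48 * L * (real q1 + real (U * U) + 2 * real N / real d / real q1))"
      unfolding L_def by (rule type_I_sum[OF N d cop U sp1 q1N])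
    also have "\<dots> \<le> 2 * L * (48 * L * (E + ?V + 2 * E))"
      using L E0 lnN q1 by (intro mult_mono add_mono mult_nonneg_nonneg add_nonneg_nonneg) (auto simp: power2_eq_square)
    also have "\<dots> = 96 * L\<^sup>2 * (3 * E + ?V)" by (simp add: power2_eq_square algebra_simps)
    also have "\<dots> \<le> 96 * L ^ 3 * (3 * E + 3 * ?V)"
      using L13 E0 L by (intro mult_mono) auto
    also have "\<dots> \<le> 300 * L ^ 3 * (?V + E)"
    proof -
      have "L ^ 3 * (?V + E) \<ge> 0" using L E0 by simp
      then show ?thesis by (simp add: algebra_simps)
    qed
    finally show ?thesis .
  qed
  have 3: "norm (\<Sum>b | b \<in> {1..N} \<and> U < b. of_real (moebius_mu b) *
           (\<Sum>m = 1..N div b. of_real (mangoldt_tail U m) * twisted_char \<theta> c d (b * m)))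
     \<le> 100 * L ^ 3 * sqrt G"
  proof -
    let ?Q = "real q2 + real N / real U + real N / (real d * real d * real q2)"
    have "norm (\<Sum>b | b \<in> {1..N} \<and> U < b. of_real (moebius_mu b) *
           (\<Sum>m = 1..N div b. of_real (mangoldt_tail U m) * twisted_char \<theta> c d (b * m)))
     \<le> 3 * L * sqrt (300 * L ^ 3 * real N * ?Q)"
      unfolding L_def by (rule type_II_sum[OF N d cop dU sp2 q2N])
    \<comment> \<open>The factor \<open>600 * L ^ 3\<close> is rounded up to the square
      \<open>(30 * L\<^sup>2)\<^sup>2\<close> to keep roots of \<open>L\<close> out of the
      result.\<close>
    also have "\<dots> \<le> 3 * L * sqrt (900 * L ^ 4 * G)"
    proof (intro mult_left_mono real_sqrt_le_mono)
      have "?Q \<le> 2 * (E + real N / real U)"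
      proof -
        have "real N / real U \<ge> 0" by simp
        then show ?thesis using q2 unfolding distrib_left by linarith
      qed
      then have "300 * L ^ 3 * real N * ?Q \<le> 300 * L ^ 3 * real N * (2 * (E + real N / real U))"
        using L by (intro mult_left_mono) auto
      also have "\<dots> = 600 * L ^ 3 * G" by (simp add: G_def)
      also have "\<dots> \<le> 900 * L ^ 4 * G"
        using L G0 by (intro mult_right_mono mult_mono power_increasing) auto
      finally show "300 * L ^ 3 * real N * ?Q \<le> 900 * L ^ 4 * G" .
    qed (use L in auto)
    also have "sqrt (900 * L ^ 4 * G) = 30 * L\<^sup>2 * sqrt G"
    proof -
      have e: "900 * L ^ 4 = (30 * L\<^sup>2)\<^sup>2" by (simp add: power_mult_distrib flip: power_mult)
      have "sqrt (900 * L ^ 4 * G) = sqrt ((30 * L\<^sup>2)\<^sup>2) * sqrt G" by (simp only: e real_sqrt_mult)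
      also have "sqrt ((30 * L\<^sup>2)\<^sup>2) = 30 * L\<^sup>2" by (rule real_sqrt_unique) auto
      finally show ?thesis .
    qed
    also have "3 * L * (30 * L\<^sup>2 * sqrt G) = 90 * L ^ 3 * sqrt G" by (simp add: power2_eq_square power3_eq_cube)
    also have "\<dots> \<le> 100 * L ^ 3 * sqrt G" using L G0 by (intro mult_right_mono) auto
    finally show ?thesis .
  qed
  have "norm (\<Sum>n = 1..N. of_real (mangoldt n) * twisted_char \<theta> c d n)
      \<le> L ^ 3 * ?V + 300 * L ^ 3 * (?V + E) + 100 * L ^ 3 * sqrt G"
    unfolding vaughan_identity[where N = N and U = U]
    by (intro order.trans[OF norm_triangle_ineq] add_mono 1 2 3)
  also have "\<dots> \<le> 600 * L ^ 3 * (?V + E + sqrt G)"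
  proof -
    have "L ^ 3 * ?V \<ge> 0" "L ^ 3 * E \<ge> 0" "L ^ 3 * sqrt G \<ge> 0" using L E0 G0 by auto
    then show ?thesis by (simp add: algebra_simps)
  qed
  finally show ?thesis unfolding L_def G_def .
qed

section \<open>Irrationality type\<close>

text \<open>An irrational number has infinitely many fractions \<open>h / q\<close> within
  \<open>1 / q\<^sup>2\<close>. Along these \<open>q\<close> the expression under the lower limit is
  at most \<open>q powr (\<theta> - 1)\<close>, which tends to \<open>0\<close> for every
  \<open>\<theta> < 1\<close>. The lower bound 1 is what later yields
  \<open>5 \<sigma> \<le> 1\<close>.\<close>

lemma irrationality_type_ge_1:
  assumes irr: "\<alpha> \<notin> \<rat>"
  shows "irrationality_type \<alpha> \<ge> 1"
proof -
  let ?f = "\<lambda>\<theta> q. ereal (real q powr \<theta> * dist_nearest_int (\<alpha> * real q))"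
  have mem: "liminf (?f \<theta>) = 0" if th: "\<theta> < 1" for \<theta>
  proof (rule antisym)
    show "liminf (?f \<theta>) \<ge> 0"
      by (intro Liminf_bounded always_eventually allI)
        (simp add: dist_nearest_int_nonneg)
    show "liminf (?f \<theta>) \<le> 0"
    proof (rule ccontr)
      assume "\<not> liminf (?f \<theta>) \<le> 0"
      then have "0 < liminf (?f \<theta>)" by simp
      then obtain e where e: "0 < e" "e < liminf (?f \<theta>)" using dense by blast
      have "eventually (\<lambda>q. e < ?f \<theta> q) sequentially"
        using e(2) by (rule less_LiminfD)
      moreover obtain r where r: "0 < ereal r" "ereal r < e" using ereal_dense2[OF e(1)] by blast
      ultimately have "eventually (\<lambda>q. ereal r < ereal (real q powr \<theta> * dist_nearest_int (\<alpha> * real q))) sequentially"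
        using order.strict_trans[OF r(2)] by (blast intro: eventually_mono)
      then have "eventually (\<lambda>q. r < real q powr \<theta> * dist_nearest_int (\<alpha> * real q)) sequentially" by simp
      moreover have "((\<lambda>q. real q powr (\<theta> - 1)) \<longlongrightarrow> 0) sequentially"
        by (rule tendsto_neg_powr[OF _ filterlim_real_sequentially]) (use th in auto)
      then have "eventually (\<lambda>q. real q powr (\<theta> - 1) < r) sequentially"
        using r(1) by (auto dest!: order_tendstoD(2))
      ultimately have "eventually (\<lambda>q. r < real q powr \<theta> * dist_nearest_int (\<alpha> * real q) \<and> real q powr (\<theta> - 1) < r) sequentially"
        by (rule eventually_conj)
      then obtain Q where Q: "\<And>q. q \<ge> Q \<Longrightarrow> r < real q powr \<theta> * dist_nearest_int (\<alpha> * real q) \<and> real q powr (\<theta> - 1) < r"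
        unfolding eventually_sequentially by blast
      have "infinite (approx_set \<alpha>)" using irr rational_iff_finite_approx_set by blast
      then obtain h k where hk: "(h, k) \<in> approx_set \<alpha>" "k > int Q"
        using infinite_approx_set by blast
      then have k: "k > 0" "\<bar>\<alpha> - of_int h / of_int k\<bar> < 1 / (of_int k)\<^sup>2"
        by (auto simp: approx_set_def)
      define q where "q = nat k"
      have kq: "k = int q" "q > 0" "q \<ge> Q" using k hk by (auto simp: q_def)
      have "\<bar>\<alpha> * real q - of_int h\<bar> = real q * \<bar>\<alpha> - of_int h / real q\<bar>"
      proof -
        have "\<alpha> * real q - of_int h = real q * (\<alpha> - of_int h / real q)"
          using kq(2) by (simp add: right_diff_distrib mult.commute)
        then show ?thesis by (simp add: abs_mult)
      qed
      also have "\<dots> \<le> real q * (1 / (real q)\<^sup>2)"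
        using k(2) unfolding kq(1) by (intro mult_left_mono) auto
      finally have "dist_nearest_int (\<alpha> * real q) \<le> real q * (1 / (real q)\<^sup>2)"
        using dist_nearest_int_le[of "\<alpha> * real q" h] by linarith
      also have "\<dots> = 1 / real q" using kq(2) by (simp add: power2_eq_square)
      finally have "real q powr \<theta> * dist_nearest_int (\<alpha> * real q) \<le> real q powr \<theta> * (1 / real q)"
        by (intro mult_left_mono) auto
      also have "\<dots> = real q powr (\<theta> - 1)" using kq(2) by (simp add: powr_diff)
      finally show False using Q[OF kq(3)] by linarith
    qed
  qed
  have le: "ereal \<theta> \<le> irrationality_type \<alpha>" if "\<theta> < 1" for \<theta>
    unfolding irrationality_type_def by (rule Sup_upper) (use mem[OF that] in auto)
  show ?thesis
  proof (rule ereal_le_epsilon2)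
    fix e :: real assume "e > 0"
    then have "ereal (1 - e) \<le> irrationality_type \<alpha>" by (intro le) auto
    then have "ereal (1 - e) + ereal e \<le> irrationality_type \<alpha> + ereal e" by (rule add_right_mono)
    then show "1 \<le> irrationality_type \<alpha> + ereal e" by (simp add: one_ereal_def)
  qed
qed

text \<open>Above the supremum the lower limit is nonzero, hence positive, which gives the estimate
  for all large \<open>q\<close>. The finitely many others only lower the constant, because
  irrationality makes each of their distances positive.\<close>

lemma irrationality_type_lower_bound:
  assumes irr: "\<alpha> \<notin> \<rat>" and type: "irrationality_type \<alpha> < ereal \<theta>"
  obtains \<kappa> where "\<kappa> > 0" "\<And>q. q > 0 \<Longrightarrow> dist_nearest_int (\<alpha> * real q) \<ge> \<kappa> * real q powr (- \<theta>)"
proof -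
  let ?f = "\<lambda>q. real q powr \<theta> * dist_nearest_int (\<alpha> * real q)"
  have "liminf (\<lambda>q. ereal (?f q)) \<noteq> 0"
  proof
    assume "liminf (\<lambda>q. ereal (?f q)) = 0"
    then have "ereal \<theta> \<le> irrationality_type \<alpha>"
      unfolding irrationality_type_def by (intro Sup_upper) auto
    then show False using type by simp
  qed
  moreover have "liminf (\<lambda>q. ereal (?f q)) \<ge> 0"
    by (intro Liminf_bounded always_eventually allI) (simp add: dist_nearest_int_nonneg)
  ultimately have "0 < liminf (\<lambda>q. ereal (?f q))" by simp
  then obtain e where e: "0 < e" "e < liminf (\<lambda>q. ereal (?f q))" using dense by blast
  have "eventually (\<lambda>q. e < ereal (?f q)) sequentially" using e(2) by (rule less_LiminfD)
  moreover obtain r where r: "0 < ereal r" "ereal r < e" using ereal_dense2[OF e(1)] by blast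
  ultimately have "eventually (\<lambda>q. ereal r < ereal (?f q)) sequentially"
    using order.strict_trans[OF r(2)] by (blast intro: eventually_mono)
  then have "eventually (\<lambda>q. r < ?f q) sequentially" by simp
  then obtain Q where Q: "\<And>q. q \<ge> Q \<Longrightarrow> r < ?f q" unfolding eventually_sequentially by blast
  have pos: "?f q > 0" if "q > 0" for q
  proof -
    have "\<alpha> * real q \<notin> \<int>"
    proof
      assume "\<alpha> * real q \<in> \<int>"
      then have "\<alpha> * real q / real q \<in> \<rat>" by (intro Rats_divide) (auto simp: Ints_subset_Rats[THEN subsetD])
      then show False using irr that by simp
    qed
    then show ?thesis using that by (intro mult_pos_pos dist_nearest_int_pos) auto
  qed
  define \<kappa> where "\<kappa> = Min (insert r (?f ` {1..Q}))"
  have k0: "\<kappa> > 0" unfolding \<kappa>_def using r(1) pos by (subst Min_gr_iff) auto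
  have k: "\<kappa> \<le> ?f q" if "q > 0" for q
  proof (cases "q \<le> Q")
    case True
    then show ?thesis unfolding \<kappa>_def using that by (intro Min_le) auto
  next
    case False
    have "\<kappa> \<le> r" unfolding \<kappa>_def by (intro Min_le) auto
    then show ?thesis using Q[of q] False by auto
  qed
  show ?thesis
  proof (rule that[OF k0])
    fix q :: nat assume q: "q > 0"
    have "\<kappa> * real q powr (- \<theta>) \<le> ?f q * real q powr (- \<theta>)"
      using k[OF q] by (intro mult_right_mono) auto
    also have "\<dots> = dist_nearest_int (\<alpha> * real q)"
      using q by (simp add: powr_minus field_simps)
    finally show "\<kappa> * real q powr (- \<theta>) \<le> dist_nearest_int (\<alpha> * real q)" .
  qed
qed

text \<open>The type is given for \<alpha>, but the sawtooth sums involve its inverse \<gamma>. If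
  \<open>n\<close> is the integer nearest to \<open>\<gamma> q\<close>, then
  \<open>\<alpha> n\<close> differs from the integer \<open>q\<close> by \<alpha> times the distance
  of \<open>\<gamma> q\<close> to \<open>n\<close>, and \<open>n \<le> 2 q\<close>, so the estimate
  for \<alpha> at \<open>n\<close> transfers.\<close>

lemma inverse_lower_bound:
  fixes \<alpha> \<kappa> \<theta> :: real
  assumes \<alpha>: "\<alpha> > 1" and \<kappa>: "\<kappa> > 0" and \<theta>: "\<theta> \<ge> 0"
    and lb: "\<And>q. q > 0 \<Longrightarrow> dist_nearest_int (\<alpha> * real q) \<ge> \<kappa> * real q powr (- \<theta>)"
  obtains \<kappa>' where "\<kappa>' > 0" "\<And>q. q > 0 \<Longrightarrow> dist_nearest_int (inverse \<alpha> * real q) \<ge> \<kappa>' * real q powr (- \<theta>)"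
proof -
  define \<gamma> where "\<gamma> = inverse \<alpha>"
  have \<gamma>: "0 < \<gamma>" "\<gamma> < 1" "\<gamma> * \<alpha> = 1" using \<alpha> by (auto simp: \<gamma>_def field_simps)
  define \<kappa>' where "\<kappa>' = min \<gamma> (\<gamma> * \<kappa> * 2 powr (- \<theta>))"
  have k0: "\<kappa>' > 0" using \<gamma> \<kappa> by (simp add: \<kappa>'_def)
  show ?thesis
  proof (rule that[OF k0])
    fix q :: nat assume q: "q > 0"
    define p where "p = round (\<gamma> * real q)"
    have D: "dist_nearest_int (\<gamma> * real q) = \<bar>\<gamma> * real q - of_int p\<bar>"
      by (simp add: dist_nearest_int_def p_def)
    have p0: "p \<ge> 0" unfolding p_def using \<gamma> by (metis mult_nonneg_nonneg less_imp_le of_nat_0_le_iff round_mono round_0)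
    have qp: "real q powr (- \<theta>) \<le> 1" using q \<theta> by (simp add: powr_le_one_le powr_minus_divide ge_one_powr_ge_zero)
    show "\<kappa>' * real q powr (- \<theta>) \<le> dist_nearest_int (inverse \<alpha> * real q)"
    proof (cases "p = 0")
      \<comment> \<open>The hypothesis says nothing about \<open>n = 0\<close>; here the distance is
        \<open>\<gamma> q\<close> itself, which is at least \<gamma>, hence the \<open>min\<close>
        in \<open>\<kappa>'\<close>.\<close>
      case True
      have "\<kappa>' * real q powr (- \<theta>) \<le> \<gamma> * 1"
        using qp k0 by (intro mult_mono) (auto simp: \<kappa>'_def)
      also have "\<dots> \<le> \<gamma> * real q" using q \<gamma> by (intro mult_left_mono) auto
      finally show ?thesis using True D \<gamma> by (simp add: \<gamma>_def)
    next
      case False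
      define n where "n = nat p"
      have n: "n > 0" "of_int p = real n" using p0 False by (auto simp: n_def)
      have "real n \<le> \<gamma> * real q + 1"
        using of_int_round_le[of "\<gamma> * real q"] n(2) by (simp add: p_def)
      also have "\<dots> \<le> 1 * real q + real q" using \<gamma> q by (intro add_mono mult_right_mono) auto
      finally have n2: "real n \<le> 2 * real q" by simp
      have "dist_nearest_int (\<alpha> * real n) \<le> \<bar>\<alpha> * real n - of_int (int q)\<bar>" by (rule dist_nearest_int_le)
      also have "\<alpha> * real n - of_int (int q) = - (\<alpha> * (\<gamma> * real q - real n))"
        using \<gamma>(3) by (simp add: right_diff_distrib mult.assoc[symmetric] mult.commute)
      also have "\<bar>\<dots>\<bar> = \<alpha> * dist_nearest_int (\<gamma> * real q)" using \<alpha> D n by (simp add: abs_mult)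
      finally have "\<kappa> * real n powr (- \<theta>) \<le> \<alpha> * dist_nearest_int (\<gamma> * real q)"
        using lb[OF n(1)] by linarith
      then have "\<gamma> * (\<kappa> * real n powr (- \<theta>)) \<le> \<gamma> * (\<alpha> * dist_nearest_int (\<gamma> * real q))"
        using \<gamma> by (intro mult_left_mono) auto
      then have 1: "\<gamma> * \<kappa> * real n powr (- \<theta>) \<le> dist_nearest_int (\<gamma> * real q)"
        using \<gamma>(3) by (simp add: mult.assoc[symmetric])
      have "(2 * real q) powr (- \<theta>) \<le> real n powr (- \<theta>)"
        using n n2 \<theta> by (intro powr_mono2') auto
      then have "\<gamma> * \<kappa> * (2 * real q) powr (- \<theta>) \<le> dist_nearest_int (\<gamma> * real q)"
        using 1 \<gamma> \<kappa> by (meson mult_left_mono mult_nonneg_nonneg less_imp_le order.trans)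
      moreover have "\<kappa>' * real q powr (- \<theta>) \<le> \<gamma> * \<kappa> * 2 powr (- \<theta>) * real q powr (- \<theta>)"
        by (intro mult_right_mono) (auto simp: \<kappa>'_def)
      moreover have "\<gamma> * \<kappa> * (2 * real q) powr (- \<theta>) = \<gamma> * \<kappa> * 2 powr (- \<theta>) * real q powr (- \<theta>)"
        by (simp add: powr_mult)
      ultimately show ?thesis unfolding \<gamma>_def by linarith
    qed
  qed
qed

text \<open>Dirichlet's theorem with \<open>Q = \<lceil>X powr (\<tau> / (1 + \<tau>))\<rceil>\<close>, where \<open>X = N k\<close>, balances \<open>q\<close> against
  \<open>X / Q powr (1 / \<tau>)\<close>, the bound for \<open>N / (r q)\<close> that the irrationality measure yields.\<close>

lemma spaced_multiples_finite_type:
  fixes \<gamma> \<kappa> \<tau> :: real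
  assumes \<tau>: "\<tau> \<ge> 1" and \<kappa>: "0 < \<kappa>"
    and lb: "\<And>q. q > 0 \<Longrightarrow> dist_nearest_int (\<gamma> * real q) \<ge> \<kappa> * real q powr (- \<tau>)"
    and k: "k > 0" and r: "r > 0" and N: "N > 0"
  obtains q where "spaced_multiples (real k * \<gamma> * real r) q"
    "real q \<le> 2 * (real N * real k) powr (\<tau> / (1 + \<tau>))"
    "real N / (real r * real q) \<le> \<kappa> powr (- 1 / \<tau>) * (real N * real k) powr (\<tau> / (1 + \<tau>))"
proof -
  define X where "X = real N * real k"
  have X: "X \<ge> 1"
  proof -
    have "1 * 1 \<le> real N * real k" using N k by (intro mult_mono) auto
    then show ?thesis by (simp add: X_def)
  qed
  define E where "E = X powr (\<tau> / (1 + \<tau>))"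
  have E1: "E \<ge> 1" unfolding E_def using X \<tau> by (intro ge_one_powr_ge_zero) auto
  define Q where "Q = nat \<lceil>E\<rceil>"
  have QE: "E \<le> real Q" "real Q \<le> 2 * E" using E1 unfolding Q_def by linarith+
  have Q0: "Q > 0" using QE E1 by (auto intro: Nat.gr0I)
  obtain q where q: "0 < q" "q \<le> Q" "dist_nearest_int (real k * \<gamma> * real r * real q) < 1 / real Q"
    "\<And>j. 1 \<le> j \<Longrightarrow> 2 * j \<le> q \<Longrightarrow> dist_nearest_int (real k * \<gamma> * real r * real j) \<ge> 1 / (2 * real q)"
    using dirichlet_spacing[OF Q0] by blast
  \<comment> \<open>The measure is applied to \<open>m\<close>, for which \<open>\<gamma> m\<close>
    is the point \<open>k \<gamma> r q\<close> close to an integer. As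
    \<open>N / (r q) = N k / m\<close>, a lower bound for \<open>m\<close> suffices and
    \<open>r\<close> drops out; \<open>r\<close> will be \<open>d\<close> and
    \<open>d\<^sup>2\<close>.\<close>
  define m where "m = k * r * q"
  have m: "m > 0" using k r q by (simp add: m_def)
  have "\<kappa> * real m powr (- \<tau>) \<le> dist_nearest_int (\<gamma> * real m)" by (rule lb[OF m])
  also have "\<gamma> * real m = real k * \<gamma> * real r * real q" by (simp add: m_def mult_ac)
  also have "dist_nearest_int \<dots> \<le> 1 / real Q" using q(3) by simp
  also have "\<dots> \<le> 1 / E" using QE E1 by (intro divide_left_mono) auto
  finally have "\<kappa> * E \<le> real m powr \<tau>"
    using E1 m by (simp add: powr_minus field_simps)
  then have "(\<kappa> * E) powr (1 / \<tau>) \<le> (real m powr \<tau>) powr (1 / \<tau>)"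
    using \<kappa> E1 \<tau> by (intro powr_mono2) auto
  also have "\<dots> = real m" using m \<tau> by (simp add: powr_powr)
  finally have mlow: "\<kappa> powr (1 / \<tau>) * E powr (1 / \<tau>) \<le> real m"
    using \<kappa> E1 by (simp add: powr_mult)
  have "real N / (real r * real q) = X / real m"
    using k by (simp add: X_def m_def)
  also have "\<dots> \<le> X / (\<kappa> powr (1 / \<tau>) * E powr (1 / \<tau>))"
    using mlow X m \<kappa> E1 by (intro divide_left_mono mult_pos_pos) auto
  also have "E powr (1 / \<tau>) = X powr (1 / (1 + \<tau>))"
    unfolding E_def powr_powr using \<tau> by (simp add: field_simps)
  also have "X / (\<kappa> powr (1 / \<tau>) * X powr (1 / (1 + \<tau>))) = \<kappa> powr (- 1 / \<tau>) * X powr (1 - 1 / (1 + \<tau>))"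
    using X \<kappa> by (simp add: powr_diff powr_minus field_simps)
  also have "1 - 1 / (1 + \<tau>) = \<tau> / (1 + \<tau>)" using \<tau> by (simp add: field_simps)
  finally have 2: "real N / (real r * real q) \<le> \<kappa> powr (- 1 / \<tau>) * E" by (simp add: E_def)
  show ?thesis
  proof (rule that)
    show "spaced_multiples (real k * \<gamma> * real r) q"
      unfolding spaced_multiples_def using q by blast
    show "real q \<le> 2 * (real N * real k) powr (\<tau> / (1 + \<tau>))"
      using q(2) QE unfolding E_def X_def by linarith
    show "real N / (real r * real q) \<le> \<kappa> powr (- 1 / \<tau>) * (real N * real k) powr (\<tau> / (1 + \<tau>))"
      using 2 unfolding E_def X_def .
  qed
qed

section \<open>Beatty sequences\<close>

text \<open>With \<open>E0 = (N k) powr (\<tau> / (1 + \<tau>))\<close> the critical quantity is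
  \<open>Z = sqrt (N E0)\<close>. For large \<open>k\<close>, where \<open>E0 > N\<close>, it
  exceeds \<open>N\<close> and the trivial bound suffices; otherwise the denominators are at most
  \<open>2 N\<close>, as \<open>exponential_sum_bound\<close> requires.\<close>

lemma frequency_bound:
  fixes \<gamma> \<kappa> \<tau> :: real
  defines "\<sigma> \<equiv> 1 / (3 * \<tau> + 2)"
  assumes \<tau>: "\<tau> \<ge> 1" and \<kappa>: "0 < \<kappa>"
    and lb: "\<And>q. q > 0 \<Longrightarrow> dist_nearest_int (\<gamma> * real q) \<ge> \<kappa> * real q powr (- \<tau>)"
  obtains A where "A \<ge> 0"
    "\<And>N d c k. N > 0 \<Longrightarrow> d > 0 \<Longrightarrow> real d \<le> real N powr \<sigma> \<Longrightarrow> coprime c d \<Longrightarrow> k > 0 \<Longrightarrow>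
       norm (\<Sum>n = 1..N. of_real (mangoldt n) * twisted_char (real k * \<gamma>) c d n)
         \<le> A * (1 + ln (real N)) ^ 3 * real N powr (1 - \<sigma>) * (1 + sqrt (real k * real N powr (- \<sigma>)))"
proof -
  define c1 where "c1 = max 2 (\<kappa> powr (- 1 / \<tau>))"
  have c1: "c1 \<ge> 2" "\<kappa> powr (- 1 / \<tau>) \<le> c1" by (auto simp: c1_def)
  have \<sigma>: "\<sigma> > 0" "5 * \<sigma> \<le> 1" using \<tau> by (auto simp: \<sigma>_def field_simps)
  define \<rho> where "\<rho> = \<tau> / (2 * (1 + \<tau>))"
  have \<rho>: "\<rho> \<ge> 0" "\<rho> \<le> 1 / 2" using \<tau> by (auto simp: \<rho>_def field_simps)
  \<comment> \<open>This identity is the equation that determines \<sigma>. It gives \<open>Z = N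
    powr (1 - \<sigma>) * (k N powr (- \<sigma>)) powr \<rho>\<close>, and
    \<open>\<rho> \<le> 1 / 2\<close> allows \<open>y powr \<rho>\<close> to be replaced by
    \<open>1 + sqrt y\<close>.\<close>
  have bal: "1 - \<sigma> - \<sigma> * \<rho> = 1 / 2 + \<rho>"
  proof -
    have "3 * \<tau> + 2 \<noteq> 0" "1 + \<tau> \<noteq> 0" using \<tau> by auto
    then have f: "\<rho> * (1 + \<sigma>) = 3 * \<tau> / (2 * (3 * \<tau> + 2))"
      unfolding \<rho>_def \<sigma>_def by (simp add: divide_simps) (simp add: algebra_simps)
    have "3 * \<tau> / (2 * (3 * \<tau> + 2)) + \<sigma> = 1 / 2"
      using \<open>3 * \<tau> + 2 \<noteq> 0\<close> unfolding \<sigma>_def by (simp add: divide_simps) (simp add: algebra_simps)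
    then have "\<rho> + \<sigma> * \<rho> + \<sigma> = 1 / 2" unfolding f[symmetric] by (simp add: distrib_left mult.commute)
    then show ?thesis by linarith
  qed
  define A where "A = 600 * (3 + 2 * c1)"
  show ?thesis
  proof (rule that[of A])
    show "A \<ge> 0" using c1 by (simp add: A_def)
    fix N d c k :: nat
    assume N: "N > 0" and d: "d > 0" "real d \<le> real N powr \<sigma>" and cop: "coprime c d" and k: "k > 0"
    define L where "L = 1 + ln (real N)"
    have L: "L \<ge> 1" using N by (simp add: L_def)
    have L3: "L \<le> L ^ 3" "L ^ 3 \<ge> 0" using L by (auto intro: self_le_power)
    define X where "X = real N powr (1 - \<sigma>)"
    have X: "X > 0" using N by (simp add: X_def)
    define E0 where "E0 = (real N * real k) powr (\<tau> / (1 + \<tau>))"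
    have E0: "E0 > 0" using N k by (simp add: E0_def)
    define Z where "Z = sqrt (real N * E0)"
    have Z: "Z \<le> X * (1 + sqrt (real k * real N powr (- \<sigma>)))"
    proof -
      define y where "y = real k * real N powr (- \<sigma>)"
      have y: "y > 0" using k N by (simp add: y_def)
      have "Z = (real N * E0) powr (1 / 2)"
        unfolding Z_def using N E0 by (simp add: powr_half_sqrt)
      also have "\<dots> = real N powr (1 / 2) * (real N * real k) powr \<rho>"
      proof -
        have "\<tau> / (1 + \<tau>) * (1 / 2) = \<rho>" by (simp add: \<rho>_def)
        then show ?thesis unfolding E0_def by (simp only: powr_mult powr_powr)
      qed
      also have "\<dots> = real N powr (1 / 2 + \<rho>) * real k powr \<rho>"
        by (simp add: powr_mult powr_add)
      also have "\<dots> = real N powr (1 - \<sigma>) * (real N powr (- \<sigma> * \<rho>) * real k powr \<rho>)"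
        unfolding bal[symmetric] using N by (simp add: powr_add[symmetric] mult.assoc[symmetric])
      also have "\<dots> = X * y powr \<rho>"
        by (simp add: X_def y_def powr_mult powr_powr)
      also have "\<dots> \<le> X * (1 + sqrt y)"
      proof (rule mult_left_mono)
        show "y powr \<rho> \<le> 1 + sqrt y"
        proof (cases "y \<le> 1")
          case True
          have "y powr \<rho> \<le> 1" using True y \<rho> by (intro powr_le1) auto
          then show ?thesis using y by (simp add: add_increasing2)
        next
          case False
          then have "y powr \<rho> \<le> y powr (1 / 2)" using \<rho> by (intro powr_mono) auto
          then show ?thesis using y by (simp add: powr_half_sqrt)
        qed
      qed (use X in auto)
      finally show ?thesis by (simp add: y_def)
    qed
    have Z0: "Z \<ge> 0" unfolding Z_def using E0 by auto
    have XZ: "X \<le> X * (1 + sqrt (real k * real N powr (- \<sigma>)))"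
      using X by simp
    have main: "norm (\<Sum>n = 1..N. of_real (mangoldt n) * twisted_char (real k * \<gamma>) c d n)
       \<le> 600 * L ^ 3 * (3 * X + 2 * c1 * Z)"
    proof (cases "E0 \<le> real N")
      case False
      have "norm (\<Sum>n = 1..N. of_real (mangoldt n) * twisted_char (real k * \<gamma>) c d n) \<le> (\<Sum>n = 1..N. L)"
      proof (rule order.trans[OF norm_sum], rule sum_mono)
        fix n assume n: "n \<in> {1..N}"
        have "norm (of_real (mangoldt n) * twisted_char (real k * \<gamma>) c d n) \<le> mangoldt n * 1"
          unfolding norm_mult using norm_twisted_char_le mangoldt_nonneg by (intro mult_mono) auto
        also have "\<dots> \<le> ln (real n)" using n mangoldt_le[of n] by auto
        also have "\<dots> \<le> ln (real N)" using n by auto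
        finally show "norm (of_real (mangoldt n) * twisted_char (real k * \<gamma>) c d n) \<le> L" by (simp add: L_def)
      qed
      also have "\<dots> = L * real N" by simp
      also have "\<dots> \<le> L ^ 3 * Z"
      proof (intro mult_mono L3)
        have "(real N)\<^sup>2 \<le> real N * E0" using False by (simp add: power2_eq_square mult_left_mono)
        then show "real N \<le> Z" unfolding Z_def by (rule real_le_rsqrt)
      qed (use L3 in auto)
      also have "\<dots> \<le> 600 * L ^ 3 * (3 * X + 2 * c1 * Z)"
      proof -
        have "L ^ 3 * Z \<le> L ^ 3 * (600 * (3 * X + 2 * c1 * Z))"
        proof (rule mult_left_mono)
          have "1 * Z \<le> c1 * Z" using c1 Z0 by (intro mult_right_mono) auto
          then show "Z \<le> 600 * (3 * X + 2 * c1 * Z)" using X Z0 by simp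
        qed (use L3 in auto)
        then show ?thesis by (simp add: mult_ac)
      qed
      finally show ?thesis .
    next
      case True
      define u where "u = real N powr (2 * \<sigma>)"
      have u1: "u \<ge> 1" unfolding u_def using N \<sigma> by (intro ge_one_powr_ge_zero) auto
      define U where "U = nat \<lfloor>u\<rfloor>"
      have U: "real U \<le> u" "u < real U + 1" using u1 unfolding U_def by linarith+
      have "real U > 0" using U u1 by linarith
      then have U1: "real U \<ge> 1" by simp
      \<comment> \<open>With \<open>d \<le> N powr \<sigma>\<close> both side conditions on
        \<open>U\<close> hold: \<open>d \<le> d\<^sup>2 \<le> U\<close>, and
        \<open>U\<^sup>2 d \<le> N powr (5 * \<sigma>) \<le> N\<close>.\<close>
      have dd: "d * d \<le> U"
      proof -
        have "real d * real d \<le> real N powr \<sigma> * real N powr \<sigma>" using d by (intro mult_mono) auto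
        also have "\<dots> = u" unfolding u_def by (simp add: powr_add[symmetric])
        finally have "real (d * d) \<le> u" by simp
        then show ?thesis unfolding U_def by (simp add: le_nat_floor)
      qed
      then have dU: "d \<le> U" by (meson le_square order.trans)
      have UU: "real U ^ 2 \<le> real N powr (4 * \<sigma>)"
      proof -
        have "real U ^ 2 \<le> u ^ 2" using U by (intro power_mono) auto
        also have "\<dots> = real N powr (4 * \<sigma>)" unfolding u_def power2_eq_square by (simp add: powr_add[symmetric])
        finally show ?thesis .
      qed
      have UUd: "U * U * d \<le> N"
      proof -
        have "real (U * U * d) \<le> real N powr (4 * \<sigma>) * real N powr \<sigma>"
          using UU d by (simp add: power2_eq_square mult_mono)
        also have "\<dots> = real N powr (5 * \<sigma>)" by (simp add: powr_add[symmetric])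
        also have "\<dots> \<le> real N powr 1" using N \<sigma> by (intro powr_mono) auto
        finally show ?thesis using N by (simp del: of_nat_mult)
      qed
      have UX: "real U ^ 2 \<le> X"
        unfolding X_def by (rule order.trans[OF UU]) (use N \<sigma> in \<open>auto intro!: powr_mono\<close>)
      obtain q1 where q1: "spaced_multiples (real k * \<gamma> * real d) q1"
        "real q1 \<le> 2 * E0" "real N / (real d * real q1) \<le> \<kappa> powr (- 1 / \<tau>) * E0"
        using spaced_multiples_finite_type[OF \<tau> \<kappa> lb k d(1) N] unfolding E0_def by blast
      have d2: "d * d > 0" using d by simp
      obtain q2 where q2: "spaced_multiples (real k * \<gamma> * real (d * d)) q2"
        "real q2 \<le> 2 * E0" "real N / (real (d * d) * real q2) \<le> \<kappa> powr (- 1 / \<tau>) * E0"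
        using spaced_multiples_finite_type[OF \<tau> \<kappa> lb k d2 N] unfolding E0_def by blast
      define E where "E = c1 * E0"
      have le: "2 * E0 \<le> E" "\<kappa> powr (- 1 / \<tau>) * E0 \<le> E"
        unfolding E_def using c1 E0 by (intro mult_right_mono; simp)+
      have "norm (\<Sum>n = 1..N. of_real (mangoldt n) * twisted_char (real k * \<gamma>) c d n)
        \<le> 600 * (1 + ln (real N)) ^ 3 * (real U ^ 2 + E + sqrt (real N * (E + real N / real U)))"
      proof (rule exponential_sum_bound[OF N d(1) cop dU UUd q1(1)])
        show "spaced_multiples (real k * \<gamma> * real d * real d) q2" using q2(1) by (simp add: mult.assoc)
        show "q1 \<le> 2 * N" "q2 \<le> 2 * N" using q1(2) q2(2) True by linarith+
        show "real q1 \<le> E" "real q2 \<le> E" "real N / (real d * real q1) \<le> E"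
          using q1 q2 le by linarith+
        show "real N / (real d * real d * real q2) \<le> E" using q2(3) le by simp
      qed
      also have "\<dots> \<le> 600 * L ^ 3 * (3 * X + 2 * c1 * Z)"
      proof -
        have E0Z: "E0 \<le> Z"
          unfolding Z_def by (rule real_le_rsqrt) (use True E0 in \<open>simp add: power2_eq_square\<close>)
        have s1: "sqrt (real N * E) \<le> c1 * Z"
        proof -
          have "sqrt c1 \<le> c1" using c1 by (intro real_le_lsqrt) (auto simp: power2_eq_square)
          then have "sqrt c1 * Z \<le> c1 * Z" using Z0 by (rule mult_right_mono)
          then show ?thesis unfolding E_def Z_def by (simp add: real_sqrt_mult mult_ac)
        qed
        have s2: "sqrt (real N * (real N / real U)) \<le> 2 * X"
        proof (rule real_le_lsqrt)
          have "u / 2 \<le> real U" using U U1 by linarith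
          then have "real N * (real N / real U) \<le> real N * (real N / (u / 2))"
            using U1 u1 by (intro mult_left_mono divide_left_mono mult_pos_pos) auto
          also have "\<dots> = 2 * (real N powr 1 * real N powr 1 * real N powr (- 2 * \<sigma>))"
            unfolding u_def using N by (simp add: powr_minus field_simps)
          also have "\<dots> = 2 * X\<^sup>2"
            unfolding X_def power2_eq_square powr_add[symmetric] by simp
          also have "\<dots> \<le> (2 * X)\<^sup>2" by (simp add: power2_eq_square)
          finally show "real N * (real N / real U) \<le> (2 * X)\<^sup>2" .
        qed (use X in auto)
        have "sqrt (real N * (E + real N / real U)) \<le> sqrt (real N * E) + sqrt (real N * (real N / real U))"
          unfolding distrib_left using E0 c1 by (intro sqrt_add_le_add_sqrt) (auto simp: E_def)
        also have "\<dots> \<le> c1 * Z + 2 * X" using s1 s2 by (rule add_mono)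
        finally have "real U ^ 2 + E + sqrt (real N * (E + real N / real U)) \<le> X + c1 * Z + (c1 * Z + 2 * X)"
          using UX E0Z c1 unfolding E_def by (intro add_mono mult_left_mono) auto
        also have "\<dots> = 3 * X + 2 * c1 * Z" by simp
        finally show ?thesis unfolding L_def[symmetric] using L3 by (intro mult_left_mono) auto
      qed
      finally show ?thesis .
    qed
    also have "600 * L ^ 3 * (3 * X + 2 * c1 * Z)
      \<le> 600 * L ^ 3 * ((3 + 2 * c1) * (X * (1 + sqrt (real k * real N powr (- \<sigma>)))))"
    proof (rule mult_left_mono)
      have "3 * X + 2 * c1 * Z \<le> 3 * (X * (1 + sqrt (real k * real N powr (- \<sigma>))))
        + 2 * c1 * (X * (1 + sqrt (real k * real N powr (- \<sigma>))))"
        using XZ Z c1 by (intro add_mono mult_left_mono) auto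
      then show "3 * X + 2 * c1 * Z \<le> (3 + 2 * c1) * (X * (1 + sqrt (real k * real N powr (- \<sigma>))))"
        by (simp only: distrib_right)
    qed (use L3 in auto)
    also have "\<dots> = A * (1 + ln (real N)) ^ 3 * real N powr (1 - \<sigma>) * (1 + sqrt (real k * real N powr (- \<sigma>)))"
      unfolding A_def L_def X_def by (simp only: mult.assoc mult.commute mult.left_commute)
    finally show "norm (\<Sum>n = 1..N. of_real (mangoldt n) * twisted_char (real k * \<gamma>) c d n)
         \<le> A * (1 + ln (real N)) ^ 3 * real N powr (1 - \<sigma>) * (1 + sqrt (real k * real N powr (- \<sigma>)))" .
  qed
qed

text \<open>The \<open>k\<close>-th Fourier term carries \<open>1 / k\<^sup>2\<close>, the
  exponential sum, and the factor \<open>e(k a) - e(k b)\<close>, bounded by 2 and by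
  \<open>2 * pi * k * \<Delta>\<close>. Small \<open>k\<close> contribute
  \<open>\<Delta> / k\<close>, whose sum is a logarithm; beyond \<open>1 / \<Delta>\<close> the
  growth \<open>sqrt (k \<Delta>)\<close> is still summable against \<open>1 / k\<^sup>2\<close>.
  The exponent \<open>s\<close> trades the logarithm for \<open>\<Delta> powr (- s)\<close> and one
  convergent series.\<close>

lemma bern2_difference_sum:
  fixes w x :: "nat \<Rightarrow> real"
  assumes \<Delta>: "\<Delta> > 0" "\<bar>a - b\<bar> = \<Delta>" and K: "K \<ge> 0" and s: "0 < s" "s \<le> 1 / 2"
    and S: "\<And>k. k > 0 \<Longrightarrow> norm (\<Sum>n\<in>I. of_real (w n) * unit_exp (real k * x n)) \<le> K * (1 + sqrt (real k * \<Delta>))"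
  shows "\<bar>\<Sum>n\<in>I. w n * (bern2 (x n + a) - bern2 (x n + b))\<bar>
     \<le> \<Delta> * (2 * K * \<Delta> powr (- s) * (\<Sum>k. real (Suc k) powr (- 1 - s)))"
proof -
  define t where "t = (\<lambda>k. \<Sum>n\<in>I. w n * (cos (2 * pi * (real (Suc k) * (x n + a))) / (2 * pi\<^sup>2 * (real (Suc k))\<^sup>2)
      - cos (2 * pi * (real (Suc k) * (x n + b))) / (2 * pi\<^sup>2 * (real (Suc k))\<^sup>2)))"
  have ts: "t sums (\<Sum>n\<in>I. w n * (bern2 (x n + a) - bern2 (x n + b)))"
    unfolding t_def by (intro sums_sum sums_mult sums_diff bern2_fourier)
  have sm: "summable (\<lambda>k. real (Suc k) powr (- 1 - s))"
    using s by (subst summable_Suc_iff) (simp add: summable_real_powr_iff)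
  have tb: "\<bar>t k\<bar> \<le> \<Delta> * (2 * K * \<Delta> powr (- s)) * real (Suc k) powr (- 1 - s)" for k
  proof -
    define m where "m = Suc k"
    have m: "m > 0" by (simp add: m_def)
    let ?S = "\<Sum>n\<in>I. of_real (w n) * unit_exp (real m * x n)"
    let ?c = "unit_exp (real m * a) - unit_exp (real m * b)"
    have re: "Re (unit_exp z) = cos (2 * pi * z)" for z by (simp add: unit_exp_def)
    have "t k = Re (?S * ?c) / (2 * pi\<^sup>2 * (real m)\<^sup>2)"
    proof -
      have "?S * ?c = (\<Sum>n\<in>I. of_real (w n) * (unit_exp (real m * (x n + a)) - unit_exp (real m * (x n + b))))"
        unfolding sum_distrib_right by (intro sum.cong refl) (simp add: unit_exp_add algebra_simps)
      then have e: "Re (?S * ?c) = (\<Sum>n\<in>I. w n * (cos (2 * pi * (real m * (x n + a))) - cos (2 * pi * (real m * (x n + b)))))"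
        by (simp only: Re_sum Re_complex_of_real Im_complex_of_real times_complex.sel minus_complex.sel re mult_zero_left diff_zero)
      show ?thesis unfolding e t_def m_def[symmetric]
        by (simp add: sum_divide_distrib diff_divide_distrib right_diff_distrib)
    qed
    then have "\<bar>t k\<bar> \<le> norm ?S * norm ?c / (2 * pi\<^sup>2 * (real m)\<^sup>2)"
      using abs_Re_le_cmod[of "?S * ?c"] by (simp add: norm_mult divide_right_mono)
    also have "\<dots> \<le> K * (1 + sqrt (real m * \<Delta>)) * min 2 (2 * pi * (real m * \<Delta>)) / (2 * pi\<^sup>2 * (real m)\<^sup>2)"
    proof (intro divide_right_mono mult_mono S m min.boundedI)
      show "norm ?c \<le> 2" using norm_triangle_ineq4[of "unit_exp (real m * a)" "unit_exp (real m * b)"] by simp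
      have "?c = (unit_exp (real m * (a - b)) - 1) * unit_exp (real m * b)"
        by (simp add: left_diff_distrib right_diff_distrib flip: unit_exp_add)
      then have "norm ?c = norm (unit_exp (real m * (a - b)) - 1)" by (simp add: norm_mult)
      then show "norm ?c \<le> 2 * pi * (real m * \<Delta>)"
        using norm_unit_exp_minus_1_le[of "real m * (a - b)"] \<Delta>(2) by (simp add: abs_mult)
    qed (use K \<Delta> in auto)
    also have "\<dots> \<le> \<Delta> * (2 * K * \<Delta> powr (- s)) * real m powr (- 1 - s)"
    proof -
      define y where "y = real m * \<Delta>"
      have y: "y > 0" using m \<Delta> by (simp add: y_def)
      have pi1: "pi \<ge> 1" using pi_ge_two by linarith
      \<comment> \<open>Both ranges are put under the single power \<open>y powr (1 - s)\<close>:
        for \<open>y \<le> 1\<close> it is at least \<open>y\<close>, for \<open>y > 1\<close> it is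
        at least \<open>sqrt y\<close> because \<open>s \<le> 1 / 2\<close>.\<close>
      have key: "(1 + sqrt y) * min 2 (2 * pi * y) \<le> 4 * pi\<^sup>2 * y powr (1 - s)"
      proof (cases "y \<le> 1")
        case True
        have "(1 + sqrt y) * min 2 (2 * pi * y) \<le> 2 * (2 * pi * y)"
          using True y by (intro mult_mono) auto
        also have "\<dots> \<le> 4 * pi\<^sup>2 * y" using pi1 y by (simp add: power2_eq_square)
        also have "y \<le> y powr (1 - s)" using True y s powr_mono'[of "1 - s" 1 y] by simp
        finally show ?thesis by simp
      next
        case False
        have "(1 + sqrt y) * min 2 (2 * pi * y) \<le> (2 * sqrt y) * 2"
          using False y by (intro mult_mono) auto
        also have "\<dots> = 4 * 1 * y powr (1 / 2)" using y by (simp add: powr_half_sqrt)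
        also have "\<dots> \<le> 4 * pi\<^sup>2 * y powr (1 - s)"
          using False s pi1 by (intro mult_mono powr_mono) (auto simp: one_le_power)
        finally show ?thesis .
      qed
      have "K * (1 + sqrt (real m * \<Delta>)) * min 2 (2 * pi * (real m * \<Delta>)) / (2 * pi\<^sup>2 * (real m)\<^sup>2)
        = K * ((1 + sqrt y) * min 2 (2 * pi * y)) / (2 * pi\<^sup>2 * (real m)\<^sup>2)" by (simp add: y_def mult.assoc)
      also have "\<dots> \<le> K * (4 * pi\<^sup>2 * y powr (1 - s)) / (2 * pi\<^sup>2 * (real m)\<^sup>2)"
        using K key by (intro divide_right_mono mult_left_mono) auto
      also have "\<dots> = 2 * K * (y powr (1 - s) * real m powr (- 2))"
        using m by (simp add: powr_minus powr_numeral field_simps)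
      also have "y powr (1 - s) * real m powr (- 2) = \<Delta> powr (1 - s) * (real m powr (1 - s) * real m powr (- 2))"
        unfolding y_def by (simp add: powr_mult)
      also have "real m powr (1 - s) * real m powr (- 2) = real m powr (- 1 - s)"
        by (simp add: powr_add[symmetric])
      also have "\<Delta> powr (1 - s) = \<Delta> * \<Delta> powr (- s)"
        using \<Delta> powr_add[of \<Delta> 1 "- s"] by simp
      finally show ?thesis by (simp add: mult_ac)
    qed
    finally show ?thesis by (simp only: m_def)
  qed
  have "\<bar>\<Sum>n\<in>I. w n * (bern2 (x n + a) - bern2 (x n + b))\<bar> = norm (suminf t)"
    using ts by (simp add: sums_iff)
  also have "\<dots> \<le> (\<Sum>k. \<Delta> * (2 * K * \<Delta> powr (- s)) * real (Suc k) powr (- 1 - s))"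
    using tb by (intro norm_suminf_le summable_mult sm) auto
  also have "\<dots> = \<Delta> * (2 * K * \<Delta> powr (- s)) * (\<Sum>k. real (Suc k) powr (- 1 - s))"
    by (rule suminf_mult[OF sm])
  finally show ?thesis by (simp add: mult_ac)
qed

text \<open>The backward difference quotient of \<open>bern2\<close> majorises and the forward one
  minorises the sawtooth, up to \<open>\<Delta> / 2\<close>. Nonnegative weights preserve both
  inequalities under summation.\<close>

lemma sawtooth_sum_bound:
  fixes w x :: "nat \<Rightarrow> real"
  assumes \<Delta>: "0 < \<Delta>" "\<Delta> < 1" and w: "\<And>n. w n \<ge> 0" and K: "K \<ge> 0" and s: "0 < s" "s \<le> 1 / 2"
    and S: "\<And>k. k > 0 \<Longrightarrow> norm (\<Sum>n\<in>I. of_real (w n) * unit_exp (real k * x n)) \<le> K * (1 + sqrt (real k * \<Delta>))"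
  shows "\<bar>\<Sum>n\<in>I. w n * sawtooth (x n)\<bar>
     \<le> \<Delta> / 2 * (\<Sum>n\<in>I. w n) + 2 * K * \<Delta> powr (- s) * (\<Sum>k. real (Suc k) powr (- 1 - s))"
proof -
  define Z where "Z = 2 * K * \<Delta> powr (- s) * (\<Sum>k. real (Suc k) powr (- 1 - s))"
  have "\<Delta> * (\<Sum>n\<in>I. w n * sawtooth (x n)) = (\<Sum>n\<in>I. w n * (\<Delta> * sawtooth (x n)))"
    by (simp add: sum_distrib_left mult_ac)
  also have "\<dots> \<le> (\<Sum>n\<in>I. w n * (bern2 (x n + 0) - bern2 (x n + - \<Delta>)) + w n * (\<Delta>\<^sup>2 / 2))"
  proof (intro sum_mono)
    fix n
    have "w n * (\<Delta> * sawtooth (x n)) \<le> w n * ((bern2 (x n) - bern2 (x n - \<Delta>)) + \<Delta>\<^sup>2 / 2)"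
      using bern2_diff_ge[of \<Delta> "x n"] \<Delta> w by (intro mult_left_mono) auto
    then show "w n * (\<Delta> * sawtooth (x n)) \<le> w n * (bern2 (x n + 0) - bern2 (x n + - \<Delta>)) + w n * (\<Delta>\<^sup>2 / 2)"
      by (simp add: distrib_left)
  qed
  also have "\<dots> = (\<Sum>n\<in>I. w n * (bern2 (x n + 0) - bern2 (x n + - \<Delta>))) + \<Delta> * (\<Delta> / 2 * (\<Sum>n\<in>I. w n))"
    by (simp add: sum.distrib sum_distrib_left power2_eq_square mult_ac)
  also have "(\<Sum>n\<in>I. w n * (bern2 (x n + 0) - bern2 (x n + - \<Delta>))) \<le> \<Delta> * Z"
    using bern2_difference_sum[OF \<Delta>(1) _ K s S, of 0 "- \<Delta>"] \<Delta> unfolding Z_def by simp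
  finally have "\<Delta> * (\<Sum>n\<in>I. w n * sawtooth (x n)) \<le> \<Delta> * (\<Delta> / 2 * (\<Sum>n\<in>I. w n) + Z)"
    by (simp add: distrib_left)
  then have up: "(\<Sum>n\<in>I. w n * sawtooth (x n)) \<le> \<Delta> / 2 * (\<Sum>n\<in>I. w n) + Z" using \<Delta> by simp
  have lo1: "(\<Sum>n\<in>I. w n * (bern2 (x n + \<Delta>) - bern2 (x n + 0))) \<ge> - (\<Delta> * Z)"
    using bern2_difference_sum[OF \<Delta>(1) _ K s S, of \<Delta> 0] \<Delta> unfolding Z_def by simp
  have "(\<Sum>n\<in>I. w n * (bern2 (x n + \<Delta>) - bern2 (x n + 0))) \<le> (\<Sum>n\<in>I. w n * (\<Delta> * sawtooth (x n)) + w n * (\<Delta>\<^sup>2 / 2))"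
  proof (intro sum_mono)
    fix n
    have "w n * (bern2 (x n + \<Delta>) - bern2 (x n)) \<le> w n * (\<Delta> * sawtooth (x n) + \<Delta>\<^sup>2 / 2)"
      using bern2_add_le[of \<Delta> "x n"] \<Delta> w by (intro mult_left_mono) auto
    then show "w n * (bern2 (x n + \<Delta>) - bern2 (x n + 0)) \<le> w n * (\<Delta> * sawtooth (x n)) + w n * (\<Delta>\<^sup>2 / 2)"
      by (simp add: distrib_left)
  qed
  also have "\<dots> = \<Delta> * (\<Sum>n\<in>I. w n * sawtooth (x n)) + \<Delta> * (\<Delta> / 2 * (\<Sum>n\<in>I. w n))"
    by (simp add: sum.distrib sum_distrib_left power2_eq_square mult_ac)
  finally have "\<Delta> * (- (\<Sum>n\<in>I. w n * sawtooth (x n))) \<le> \<Delta> * (\<Delta> / 2 * (\<Sum>n\<in>I. w n) + Z)"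
    using lo1 by (simp add: distrib_left)
  then have lo: "- (\<Sum>n\<in>I. w n * sawtooth (x n)) \<le> \<Delta> / 2 * (\<Sum>n\<in>I. w n) + Z"
    using \<Delta> by (simp only: mult_le_cancel_left_pos)
  show ?thesis using up lo unfolding Z_def by linarith
qed

text \<open>With \<gamma> the inverse of \<alpha>, \<open>n\<close> is a Beatty number exactly if an
  integer \<open>m \<ge> 1\<close> satisfies
  \<open>\<gamma> (n - \<beta>) \<le> m < \<gamma> (n + 1 - \<beta>)\<close>, an interval of length
  below 1. As \<beta> is an integer, the endpoints are nonzero integer multiples of an irrational
  number, hence not integers, and a difference of floors counts \<open>m\<close>. For
  \<open>n > \<beta>\<close> the interval is positive, so \<open>m \<ge> 1\<close> is
  automatic.\<close>

lemma beatty_indicator: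
  fixes \<alpha> :: real and \<beta> :: int
  assumes \<alpha>: "\<alpha> > 1" "\<alpha> \<notin> \<rat>" and n: "int n > \<beta>"
  shows "(if int n \<in> beatty \<alpha> (of_int \<beta>) then 1 else 0) - inverse \<alpha>
     = sawtooth (inverse \<alpha> * real n + inverse \<alpha> * (- of_int \<beta>))
       - sawtooth (inverse \<alpha> * real n + inverse \<alpha> * (1 - of_int \<beta>))"
proof -
  define \<gamma> where "\<gamma> = inverse \<alpha>"
  have \<gamma>: "0 < \<gamma>" "\<gamma> < 1" using \<alpha> by (auto simp: \<gamma>_def field_simps)
  define j where "j = int n - \<beta>"
  have j: "j \<ge> 1" using n by (simp add: j_def)
  define a b where "a = \<gamma> * of_int j" and "b = \<gamma> * of_int (j + 1)"
  have ab: "a = \<gamma> * real n + \<gamma> * (- of_int \<beta>)" "b = \<gamma> * real n + \<gamma> * (1 - of_int \<beta>)"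
    by (simp_all add: a_def b_def j_def algebra_simps)
  have ba: "b = a + \<gamma>" by (simp add: a_def b_def algebra_simps)
  have a0: "a > 0" using \<gamma> j by (simp add: a_def)
  have irr: "\<gamma> * of_int i \<noteq> of_int m" if "i \<noteq> 0" for i m :: int
  proof
    assume "\<gamma> * of_int i = of_int m"
    then have "\<gamma> = of_int m / of_int i" using that by (simp add: field_simps)
    then have "\<gamma> \<in> \<rat>" by simp
    then have "inverse \<gamma> \<in> \<rat>" by (rule Rats_inverse)
    then show False using \<alpha> by (simp add: \<gamma>_def)
  qed
  have iff: "int n \<in> beatty \<alpha> (of_int \<beta>) \<longleftrightarrow> (\<exists>m::nat. m \<ge> 1 \<and> a \<le> real m \<and> real m < b)"
  proof -
    have "int n = \<lfloor>\<alpha> * real m + of_int \<beta>\<rfloor> \<longleftrightarrow> a \<le> real m \<and> real m < b" for m :: nat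
    proof -
      have "int n = \<lfloor>\<alpha> * real m + of_int \<beta>\<rfloor> \<longleftrightarrow> of_int j \<le> \<alpha> * real m \<and> \<alpha> * real m < of_int j + 1"
        unfolding j_def eq_commute[of "int n"] floor_eq_iff by auto
      also have "\<dots> \<longleftrightarrow> a \<le> real m \<and> real m < b"
        unfolding a_def b_def \<gamma>_def using \<alpha> by (simp add: field_simps)
      finally show ?thesis .
    qed
    then show ?thesis unfolding beatty_def by auto
  qed
  have fl: "\<lfloor>b\<rfloor> - \<lfloor>a\<rfloor> = (if int n \<in> beatty \<alpha> (of_int \<beta>) then 1 else 0)"
  proof (cases "int n \<in> beatty \<alpha> (of_int \<beta>)")
    case True
    then obtain m :: nat where m: "a \<le> real m" "real m < b" using iff by blast
    have "a \<noteq> real m" using irr[of j "int m"] j by (simp add: a_def)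
    then have "a < real m" using m by simp
    then have "\<lfloor>a\<rfloor> < int m" "int m \<le> \<lfloor>b\<rfloor>" using m by linarith+
    moreover have "\<lfloor>b\<rfloor> \<le> \<lfloor>a\<rfloor> + 1" using ba \<gamma> by linarith
    ultimately show ?thesis using True by simp
  next
    case False
    have "\<lfloor>b\<rfloor> \<le> \<lfloor>a\<rfloor>"
    proof (rule ccontr)
      assume "\<not> \<lfloor>b\<rfloor> \<le> \<lfloor>a\<rfloor>"
      then have m: "a < of_int \<lfloor>b\<rfloor>" by linarith
      have "b \<noteq> of_int \<lfloor>b\<rfloor>" using irr[of "j + 1" "\<lfloor>b\<rfloor>"] j by (simp add: b_def)
      then have m2: "of_int \<lfloor>b\<rfloor> < b" by linarith
      define m where "m = nat \<lfloor>b\<rfloor>"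
      have "\<lfloor>b\<rfloor> \<ge> 1" using m a0 by linarith
      then have "m \<ge> 1" "real m = of_int \<lfloor>b\<rfloor>" unfolding m_def by linarith+
      moreover have "a \<le> of_int \<lfloor>b\<rfloor>" using m by simp
      ultimately show False using iff False m2 by metis
    qed
    moreover have "\<lfloor>a\<rfloor> \<le> \<lfloor>b\<rfloor>" using ba \<gamma> by (intro floor_mono) auto
    ultimately show ?thesis using False by simp
  qed
  have "sawtooth a - sawtooth b = of_int (\<lfloor>b\<rfloor> - \<lfloor>a\<rfloor>) - \<gamma>"
    unfolding sawtooth_def frac_def using ba by simp
  also have "of_int (\<lfloor>b\<rfloor> - \<lfloor>a\<rfloor>) = (if int n \<in> beatty \<alpha> (of_int \<beta>) then 1 else (0 :: real))"
    unfolding fl by simp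
  finally show ?thesis unfolding ab \<gamma>_def by (rule sym)
qed

lemma one_plus_ln_cubed_le:
  fixes x e :: real
  assumes "x \<ge> 1" "e > 0"
  shows "(1 + ln x) ^ 3 \<le> (1 + 3 / e) ^ 3 * x powr e"
proof -
  have "ln x \<le> x powr (e / 3) / (e / 3)" using assms by (intro ln_powr_bound) auto
  moreover have "1 \<le> x powr (e / 3)" using assms by (intro ge_one_powr_ge_zero) auto
  ultimately have "1 + ln x \<le> x powr (e / 3) + x powr (e / 3) / (e / 3)" by (rule add_mono[rotated])
  also have "\<dots> = (1 + 3 / e) * x powr (e / 3)" using assms by (simp add: field_simps)
  finally have "1 + ln x \<le> (1 + 3 / e) * x powr (e / 3)" .
  then have "(1 + ln x) ^ 3 \<le> ((1 + 3 / e) * x powr (e / 3)) ^ 3" using assms by (intro power_mono) auto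
  also have "\<dots> = (1 + 3 / e) ^ 3 * (x powr (e / 3)) ^ 3" by (rule power_mult_distrib)
  also have "(x powr (e / 3)) ^ 3 = x powr e" by (simp add: power3_eq_cube flip: powr_add)
  finally show ?thesis .
qed

text \<open>Uniformity in \<open>d\<close> comes from the split at \<open>N powr \<sigma>\<close>: a
  progression with larger \<open>d\<close> has at most \<open>2 * N powr (1 - \<sigma>)\<close>
  terms and needs no cancellation. The \<tau> here lies strictly above the type, where an
  irrationality measure is available.\<close>

lemma beatty_error_bound:
  fixes \<alpha> \<tau> :: real and \<beta> :: int
  defines "\<sigma> \<equiv> 1 / (3 * \<tau> + 2)"
  assumes \<alpha>: "\<alpha> > 1" "\<alpha> \<notin> \<rat>" and type: "irrationality_type \<alpha> < ereal \<tau>" and s: "0 < s" "s \<le> 1 / 2"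
  obtains C where "C \<ge> 0"
    "\<And>N c d. N \<ge> 2 \<Longrightarrow> d > 0 \<Longrightarrow> coprime c d \<Longrightarrow>
      \<bar>\<Sum>n | n \<in> {1..N} \<and> [n = c] (mod d). mangoldt n * ((if int n \<in> beatty \<alpha> (of_int \<beta>) then 1 else 0) - inverse \<alpha>)\<bar>
        \<le> C * (1 + ln (real N)) ^ 3 * real N powr (1 - \<sigma> + s)"
proof -
  define \<gamma> where "\<gamma> = inverse \<alpha>"
  have \<gamma>: "0 < \<gamma>" "\<gamma> < 1" using \<alpha> by (auto simp: \<gamma>_def field_simps)
  have "1 < ereal \<tau>" using irrationality_type_ge_1[OF \<alpha>(2)] type by (rule order.strict_trans1)
  then have \<tau>: "\<tau> \<ge> 1" by (simp add: one_ereal_def)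
  have \<sigma>: "0 < \<sigma>" "\<sigma> \<le> 1" using \<tau> by (auto simp: \<sigma>_def field_simps)
  obtain \<kappa> where \<kappa>: "\<kappa> > 0" "\<And>q. q > 0 \<Longrightarrow> dist_nearest_int (\<alpha> * real q) \<ge> \<kappa> * real q powr (- \<tau>)"
    using irrationality_type_lower_bound[OF \<alpha>(2) type] by blast
  have "\<tau> \<ge> 0" using \<tau> by simp
  then obtain \<kappa>' where \<kappa>': "\<kappa>' > 0" "\<And>q. q > 0 \<Longrightarrow> dist_nearest_int (\<gamma> * real q) \<ge> \<kappa>' * real q powr (- \<tau>)"
    using inverse_lower_bound[OF \<alpha>(1) \<kappa>(1) _ \<kappa>(2)] unfolding \<gamma>_def by blast
  obtain A where A: "A \<ge> 0" "\<And>N d c k. N > 0 \<Longrightarrow> d > 0 \<Longrightarrow> real d \<le> real N powr \<sigma> \<Longrightarrow> coprime c d \<Longrightarrow> k > 0 \<Longrightarrow>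
       norm (\<Sum>n = 1..N. of_real (mangoldt n) * twisted_char (real k * \<gamma>) c d n)
         \<le> A * (1 + ln (real N)) ^ 3 * real N powr (1 - \<sigma>) * (1 + sqrt (real k * real N powr (- \<sigma>)))"
    using frequency_bound[OF \<tau> \<kappa>'] unfolding \<sigma>_def by blast
  define \<zeta> where "\<zeta> = (\<Sum>k. real (Suc k) powr (- 1 - s))"
  have sm: "summable (\<lambda>k. real (Suc k) powr (- 1 - s))"
    using s by (subst summable_Suc_iff) (simp add: summable_real_powr_iff)
  have \<zeta>: "\<zeta> \<ge> 0" unfolding \<zeta>_def by (intro suminf_nonneg sm) auto
  \<comment> \<open>This pays for the finitely many \<open>n \<le> \<beta>\<close>, for which
    \<open>beatty_indicator\<close> says nothing; the sum is empty for
    \<open>\<beta> \<le> 0\<close>. It is the only part of the constant that depends on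
    \<beta>.\<close>
  define C0 where "C0 = (\<Sum>n = 1..nat \<beta>. 2 * mangoldt n :: real)"
  have C0: "C0 \<ge> 0" unfolding C0_def by (intro sum_nonneg) (simp add: mangoldt_nonneg)
  \<comment> \<open>\<open>C0\<close> for small \<open>n\<close>, twice
    \<open>1 + 2 * A * \<zeta>\<close> for the two sawtooth sums, and 2 for the case of large
    \<open>d\<close>.\<close>
  define C where "C = C0 + 2 * (1 + 2 * A * \<zeta>) + 2"
  show ?thesis
  proof (rule that[of C])
    show "C \<ge> 0" using C0 A(1) \<zeta> by (simp add: C_def)
    fix N c d :: nat
    assume N: "N \<ge> 2" and d: "d > 0" and cop: "coprime c d"
    define I where "I = {n. n \<in> {1..N} \<and> [n = c] (mod d)}"
    have fin: "finite I" by (simp add: I_def)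
    define L where "L = 1 + ln (real N)"
    have L: "L \<ge> 1" using N by (simp add: L_def)
    have L3: "L \<le> L ^ 3" "1 \<le> L ^ 3" "L ^ 3 \<ge> 0" using L by (auto intro: self_le_power one_le_power)
    define X where "X = real N powr (1 - \<sigma>)"
    define Xs where "Xs = real N powr (1 - \<sigma> + s)"
    have X1: "X \<ge> 1" unfolding X_def using N \<sigma> by (intro ge_one_powr_ge_zero) auto
    have XXs: "X \<le> Xs" unfolding X_def Xs_def using N s by (intro powr_mono) auto
    have one: "1 \<le> L ^ 3 * Xs" using L3 X1 XXs mult_mono[of 1 "L ^ 3" 1 Xs] by simp
    have mL: "mangoldt n \<le> L" if "n \<in> I" for n
    proof -
      have "mangoldt n \<le> ln (real n)" using that mangoldt_le[of n] by (auto simp: I_def)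
      also have "\<dots> \<le> ln (real N)" using that by (auto simp: I_def)
      finally show ?thesis by (simp add: L_def)
    qed
    let ?err = "\<lambda>n. (if int n \<in> beatty \<alpha> (of_int \<beta>) then 1 else 0) - \<gamma>"
    have err1: "\<bar>?err n\<bar> \<le> 1" for n using \<gamma> by auto
    have "\<bar>\<Sum>n\<in>I. mangoldt n * ?err n\<bar> \<le> C * L ^ 3 * Xs"
    proof (cases "real d \<le> real N powr \<sigma>")
      case False
      have "\<bar>\<Sum>n\<in>I. mangoldt n * ?err n\<bar> \<le> (\<Sum>n\<in>I. L)"
      proof (rule order.trans[OF sum_abs], rule sum_mono)
        fix n assume "n \<in> I"
        then show "\<bar>mangoldt n * ?err n\<bar> \<le> L"
          unfolding abs_mult using mL[of n] err1[of n] mangoldt_nonneg[of n] mult_mono[of "mangoldt n" L "\<bar>?err n\<bar>" 1] L by simp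
      qed
      also have "\<dots> = real (card I) * L" by simp
      also have "\<dots> \<le> (2 * X) * L"
      proof (rule mult_right_mono)
        have "real (card I) \<le> real (N - 1) / real d + 1"
          unfolding I_def by (rule card_progression[OF d cop])
        also have "real (N - 1) / real d \<le> real N / real N powr \<sigma>"
          using False N by (intro frac_le) auto
        also have "\<dots> = X" unfolding X_def using N by (simp add: powr_diff)
        finally show "real (card I) \<le> 2 * X" using X1 by simp
      qed (use L in auto)
      also have "\<dots> \<le> (2 * Xs) * L ^ 3"
        using XXs L3 X1 L by (intro mult_mono) auto
      also have "\<dots> = 2 * (L ^ 3 * Xs)" by simp
      also have "\<dots> \<le> C * (L ^ 3 * Xs)"
        using C0 A(1) \<zeta> one by (intro mult_right_mono) (auto simp: C_def)
      finally show ?thesis by (simp add: mult.assoc)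
    next
      case True
      \<comment> \<open>With this \<Delta> the approximation error \<open>\<Delta> / 2\<close> per
        term adds up to at most \<open>N powr (1 - \<sigma>)\<close> times a logarithm, the order of
        the exponential sums.\<close>
      define \<Delta> where "\<Delta> = real N powr (- \<sigma>)"
      have \<Delta>: "0 < \<Delta>" "\<Delta> < 1" unfolding \<Delta>_def using N \<sigma> by (auto intro!: powr_less_one)
      define K where "K = A * L ^ 3 * X"
      have K: "K \<ge> 0" using A(1) L3 X1 by (simp add: K_def)
      have W: "(\<Sum>n\<in>I. mangoldt n) \<le> real N * L"
      proof -
        have "(\<Sum>n\<in>I. mangoldt n) \<le> (\<Sum>n\<in>I. L)" by (intro sum_mono mL)
        also have "\<dots> = real (card I) * L" by simp
        also have "\<dots> \<le> real N * L"
        proof (rule mult_right_mono)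
          have "card I \<le> card {1..N}" by (intro card_mono) (auto simp: I_def)
          then show "real (card I) \<le> real N" by simp
        qed (use L in auto)
        finally show ?thesis .
      qed
      \<comment> \<open>The shift \<open>y\<close> multiplies the \<open>k\<close>-th exponential
        sum by a number of modulus 1, so one bound covers both sawtooth sums.\<close>
      have saw: "\<bar>\<Sum>n\<in>I. mangoldt n * sawtooth (\<gamma> * real n + y)\<bar> \<le> (1 + 2 * A * \<zeta>) * (L ^ 3 * Xs)" for y
      proof -
        have S: "norm (\<Sum>n\<in>I. of_real (mangoldt n) * unit_exp (real k * (\<gamma> * real n + y))) \<le> K * (1 + sqrt (real k * \<Delta>))"
          if k: "k > 0" for k
        proof -
          have "(\<Sum>n\<in>I. of_real (mangoldt n) * unit_exp (real k * (\<gamma> * real n + y)))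
            = unit_exp (real k * y) * (\<Sum>n\<in>I. of_real (mangoldt n) * unit_exp (real k * \<gamma> * real n))"
            unfolding sum_distrib_left by (intro sum.cong refl) (simp add: distrib_left unit_exp_add mult_ac)
          also have "norm \<dots> = norm (\<Sum>n\<in>I. of_real (mangoldt n) * unit_exp (real k * \<gamma> * real n))"
            by (simp add: norm_mult)
          also have "(\<Sum>n\<in>I. of_real (mangoldt n) * unit_exp (real k * \<gamma> * real n))
            = (\<Sum>n = 1..N. of_real (mangoldt n) * twisted_char (real k * \<gamma>) c d n)"
            by (intro sum.mono_neutral_cong_left) (auto simp: I_def twisted_char_def)
          finally show ?thesis
            using A(2)[OF _ d True cop k] N unfolding K_def L_def X_def \<Delta>_def by simp
        qed
        have "\<bar>\<Sum>n\<in>I. mangoldt n * sawtooth (\<gamma> * real n + y)\<bar>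
          \<le> \<Delta> / 2 * (\<Sum>n\<in>I. mangoldt n) + 2 * K * \<Delta> powr (- s) * \<zeta>"
          unfolding \<zeta>_def by (rule sawtooth_sum_bound[OF \<Delta> mangoldt_nonneg K s S])
        also have "\<dots> \<le> L ^ 3 * Xs + 2 * A * \<zeta> * (L ^ 3 * Xs)"
        proof (rule add_mono)
          have "\<Delta> / 2 * (\<Sum>n\<in>I. mangoldt n) \<le> \<Delta> * (real N * L)"
            using \<Delta> W by (intro mult_mono) (auto intro!: sum_nonneg mangoldt_nonneg)
          also have "\<dots> = X * L" unfolding \<Delta>_def X_def using N by (simp add: powr_diff powr_minus field_simps)
          also have "\<dots> \<le> Xs * L ^ 3" using XXs X1 L3 L by (intro mult_mono) auto
          finally show "\<Delta> / 2 * (\<Sum>n\<in>I. mangoldt n) \<le> L ^ 3 * Xs" by (simp add: mult.commute)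
          have "X * \<Delta> powr (- s) = real N powr (1 - \<sigma> + \<sigma> * s)"
            unfolding X_def \<Delta>_def by (simp add: powr_powr powr_add[symmetric])
          also have "\<dots> \<le> Xs"
            unfolding Xs_def using N s \<sigma> by (intro powr_mono) (auto simp: mult_left_le_one_le)
          finally have "(2 * A * L ^ 3 * \<zeta>) * (X * \<Delta> powr (- s)) \<le> (2 * A * L ^ 3 * \<zeta>) * Xs"
            using A(1) L3 \<zeta> by (intro mult_left_mono) auto
          then show "2 * K * \<Delta> powr (- s) * \<zeta> \<le> 2 * A * \<zeta> * (L ^ 3 * Xs)"
            by (simp add: K_def mult_ac)
        qed
        finally show ?thesis by (simp add: distrib_right)
      qed
      let ?s0 = "\<lambda>n. sawtooth (\<gamma> * real n + \<gamma> * (- of_int \<beta>))"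
      let ?s1 = "\<lambda>n. sawtooth (\<gamma> * real n + \<gamma> * (1 - of_int \<beta>))"
      have D: "\<bar>(\<Sum>n\<in>I. mangoldt n * ?err n) - (\<Sum>n\<in>I. mangoldt n * (?s0 n - ?s1 n))\<bar> \<le> C0"
      proof -
        have "\<bar>(\<Sum>n\<in>I. mangoldt n * ?err n) - (\<Sum>n\<in>I. mangoldt n * (?s0 n - ?s1 n))\<bar>
          \<le> (\<Sum>n\<in>I. \<bar>mangoldt n * (?err n - (?s0 n - ?s1 n))\<bar>)"
          unfolding sum_subtractf[symmetric] right_diff_distrib[of "mangoldt _" "?err _", symmetric]
          by (rule sum_abs)
        also have "\<dots> = (\<Sum>n\<in>I \<inter> {1..nat \<beta>}. \<bar>mangoldt n * (?err n - (?s0 n - ?s1 n))\<bar>)"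
        proof (rule sum.mono_neutral_right[OF fin])
          show "\<forall>n\<in>I - I \<inter> {1..nat \<beta>}. \<bar>mangoldt n * (?err n - (?s0 n - ?s1 n))\<bar> = 0"
          proof
            fix n assume "n \<in> I - I \<inter> {1..nat \<beta>}"
            then have "int n > \<beta>" by (auto simp: I_def)
            then show "\<bar>mangoldt n * (?err n - (?s0 n - ?s1 n))\<bar> = 0"
              using beatty_indicator[OF \<alpha>, of \<beta> n] by (simp add: \<gamma>_def)
          qed
        qed auto
        also have "\<dots> \<le> (\<Sum>n\<in>I \<inter> {1..nat \<beta>}. 2 * mangoldt n)"
        proof (rule sum_mono)
          fix n
          have "\<bar>?s0 n - ?s1 n\<bar> \<le> 1"
            unfolding sawtooth_def using frac_ge_0 frac_lt_1 by (smt (verit))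
          then have "\<bar>?err n - (?s0 n - ?s1 n)\<bar> \<le> 2" using err1[of n] by linarith
          then show "\<bar>mangoldt n * (?err n - (?s0 n - ?s1 n))\<bar> \<le> 2 * mangoldt n"
            unfolding abs_mult using mangoldt_nonneg[of n] by (simp add: mult.commute mult_left_mono)
        qed
        also have "\<dots> \<le> C0" unfolding C0_def by (intro sum_mono2) (auto simp: mangoldt_nonneg)
        finally show ?thesis .
      qed
      have e: "(\<Sum>n\<in>I. mangoldt n * (?s0 n - ?s1 n)) = (\<Sum>n\<in>I. mangoldt n * ?s0 n) - (\<Sum>n\<in>I. mangoldt n * ?s1 n)"
        by (simp add: right_diff_distrib sum_subtractf)
      have "\<bar>\<Sum>n\<in>I. mangoldt n * ?err n\<bar> \<le> C0 + 2 * ((1 + 2 * A * \<zeta>) * (L ^ 3 * Xs))"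
        using D saw[of "\<gamma> * (- of_int \<beta>)"] saw[of "\<gamma> * (1 - of_int \<beta>)"] unfolding e by linarith
      also have "\<dots> \<le> C0 * (L ^ 3 * Xs) + 2 * ((1 + 2 * A * \<zeta>) * (L ^ 3 * Xs)) + 2 * (L ^ 3 * Xs)"
        using mult_left_mono[OF one C0] one by simp
      also have "\<dots> = C * L ^ 3 * Xs" by (simp add: C_def algebra_simps)
      finally show ?thesis .
    qed
    then show "\<bar>\<Sum>n | n \<in> {1..N} \<and> [n = c] (mod d). mangoldt n * ((if int n \<in> beatty \<alpha> (of_int \<beta>) then 1 else 0) - inverse \<alpha>)\<bar>
        \<le> C * (1 + ln (real N)) ^ 3 * real N powr (1 - \<sigma> + s)"
      unfolding I_def L_def Xs_def \<gamma>_def .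
  qed
qed

theorem theorem1:
  fixes \<alpha> \<tau> :: real and \<beta> :: int
  assumes "\<alpha> > 1" and "\<alpha> \<notin> \<rat>" and "irrationality_type \<alpha> = ereal \<tau>"
  shows "\<forall>\<epsilon>::real. \<epsilon> > 0 \<longrightarrow>
    (\<exists>C::real. \<exists>N\<^sub>0::nat. \<forall>c d :: int. d \<ge> 1 \<longrightarrow> coprime c d \<longrightarrow> (\<forall>N::nat. N \<ge> N\<^sub>0 \<longrightarrow>
      \<bar>(\<Sum>n | n \<in> {1..N} \<and> int n \<in> beatty \<alpha> (of_int \<beta>) \<and> [int n = c] (mod d). (mangoldt n :: real))
         - inverse \<alpha> * (\<Sum>m | m \<in> {1..N} \<and> [int m = c] (mod d). (mangoldt m :: real))\<bar>
      \<le> C * real N powr (1 - 1 / (3 * \<tau> + 2) + \<epsilon>)))"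
proof (intro allI impI)
  fix \<epsilon> :: real assume \<epsilon>: "\<epsilon> > 0"
  \<comment> \<open>The measure is available only for exponents strictly above the type. The margin
    \<epsilon> is spent as \<open>\<epsilon> / 2\<close> on \<open>\<tau>'\<close>,
    \<open>\<epsilon> / 4\<close> on \<open>s\<close> and \<open>\<epsilon> / 4\<close> on the
    logarithms.\<close>
  define \<tau>' where "\<tau>' = \<tau> + \<epsilon> / 2"
  define \<sigma> where "\<sigma> = 1 / (3 * \<tau>' + 2)"
  define s where "s = min (1 / 2) (\<epsilon> / 4)"
  have s: "0 < s" "s \<le> 1 / 2" "s \<le> \<epsilon> / 4" using \<epsilon> by (auto simp: s_def)
  have \<tau>: "\<tau> \<ge> 1" using irrationality_type_ge_1[OF assms(2)] assms(3) by (simp add: one_ereal_def)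
  have expo: "1 - \<sigma> + s + \<epsilon> / 4 \<le> 1 - 1 / (3 * \<tau> + 2) + \<epsilon>"
  proof -
    have p: "3 * \<tau> + 2 \<ge> 5" "3 * \<tau>' + 2 \<ge> 5" using \<tau> \<epsilon> by (auto simp: \<tau>'_def)
    have "1 / (3 * \<tau> + 2) - \<sigma> = (3 * (\<epsilon> / 2)) / ((3 * \<tau> + 2) * (3 * \<tau>' + 2))"
      using p unfolding \<sigma>_def by (simp add: diff_frac_eq) (simp add: \<tau>'_def algebra_simps)
    also have "\<dots> \<le> (3 * (\<epsilon> / 2)) / (5 * 5)"
      using p \<epsilon> by (intro divide_left_mono mult_mono mult_pos_pos) auto
    also have "\<dots> \<le> \<epsilon> / 2" using \<epsilon> by simp
    finally show ?thesis using s by linarith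
  qed
  have type: "irrationality_type \<alpha> < ereal \<tau>'" using assms(3) \<epsilon> by (simp add: \<tau>'_def)
  obtain C where C: "C \<ge> 0" "\<And>N c d. N \<ge> 2 \<Longrightarrow> d > 0 \<Longrightarrow> coprime c d \<Longrightarrow>
      \<bar>\<Sum>n | n \<in> {1..N} \<and> [n = c] (mod d). mangoldt n * ((if int n \<in> beatty \<alpha> (of_int \<beta>) then 1 else 0) - inverse \<alpha>)\<bar>
        \<le> C * (1 + ln (real N)) ^ 3 * real N powr (1 - \<sigma> + s)"
    using beatty_error_bound[OF assms(1,2) type s(1,2), of \<beta>] unfolding \<sigma>_def by blast
  define C' where "C' = C * (1 + 3 / (\<epsilon> / 4)) ^ 3"
  show "\<exists>C::real. \<exists>N\<^sub>0::nat. \<forall>c d :: int. d \<ge> 1 \<longrightarrow> coprime c d \<longrightarrow> (\<forall>N::nat. N \<ge> N\<^sub>0 \<longrightarrow>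
      \<bar>(\<Sum>n | n \<in> {1..N} \<and> int n \<in> beatty \<alpha> (of_int \<beta>) \<and> [int n = c] (mod d). (mangoldt n :: real))
         - inverse \<alpha> * (\<Sum>m | m \<in> {1..N} \<and> [int m = c] (mod d). (mangoldt m :: real))\<bar>
      \<le> C * real N powr (1 - 1 / (3 * \<tau> + 2) + \<epsilon>))"
  proof (intro exI[of _ C'] exI[of _ 2] allI impI)
    fix c d :: int and N :: nat
    assume d: "d \<ge> 1" and cop: "coprime c d" and N: "N \<ge> 2"
    define d' where "d' = nat d"
    \<comment> \<open>The integer \<open>c\<close> may be negative; its least nonnegative residue
      represents the same class and is still coprime to \<open>d\<close>.\<close>
    define c' where "c' = nat (c mod d)"
    have d': "int d' = d" "d' > 0" and c': "int c' = c mod d" using d by (auto simp: d'_def c'_def)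
    have "coprime (int c') (int d')" unfolding d' c' using cop d by simp
    then have cop': "coprime c' d'" by simp
    have cong: "[int n = c] (mod d) \<longleftrightarrow> [n = c'] (mod d')" for n
    proof -
      have "[n = c'] (mod d') \<longleftrightarrow> [int n = int c'] (mod int d')" by (simp add: cong_int_iff)
      then show ?thesis unfolding d' c' by (simp add: cong_def)
    qed
    let ?I = "{n. n \<in> {1..N} \<and> [n = c'] (mod d')}"
    have "(\<Sum>n | n \<in> {1..N} \<and> int n \<in> beatty \<alpha> (of_int \<beta>) \<and> [int n = c] (mod d). (mangoldt n :: real))
         - inverse \<alpha> * (\<Sum>m | m \<in> {1..N} \<and> [int m = c] (mod d). (mangoldt m :: real))
       = (\<Sum>n\<in>?I. mangoldt n * (if int n \<in> beatty \<alpha> (of_int \<beta>) then 1 else 0)) - (\<Sum>n\<in>?I. mangoldt n * inverse \<alpha>)"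
      unfolding cong sum_distrib_left
      by (intro arg_cong2[of _ _ _ _ "(-)"] sum.mono_neutral_cong_left sum.cong) (auto simp: mult.commute)
    also have "\<dots> = (\<Sum>n\<in>?I. mangoldt n * ((if int n \<in> beatty \<alpha> (of_int \<beta>) then 1 else 0) - inverse \<alpha>))"
      by (simp only: sum_subtractf right_diff_distrib)
    also have "\<bar>\<dots>\<bar> \<le> C * (1 + ln (real N)) ^ 3 * real N powr (1 - \<sigma> + s)"
      by (rule C(2)[OF N d'(2) cop'])
    also have "\<dots> \<le> C * ((1 + 3 / (\<epsilon> / 4)) ^ 3 * real N powr (\<epsilon> / 4)) * real N powr (1 - \<sigma> + s)"
      using C(1) \<epsilon> N by (intro mult_right_mono mult_left_mono one_plus_ln_cubed_le) auto
    also have "\<dots> = C' * real N powr (1 - \<sigma> + s + \<epsilon> / 4)"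
      by (simp add: C'_def powr_add mult_ac)
    also have "\<dots> \<le> C' * real N powr (1 - 1 / (3 * \<tau> + 2) + \<epsilon>)"
      using C(1) \<epsilon> N expo by (intro mult_left_mono powr_mono) (auto simp: C'_def)
    finally show "\<bar>(\<Sum>n | n \<in> {1..N} \<and> int n \<in> beatty \<alpha> (of_int \<beta>) \<and> [int n = c] (mod d). (mangoldt n :: real))
         - inverse \<alpha> * (\<Sum>m | m \<in> {1..N} \<and> [int m = c] (mod d). (mangoldt m :: real))\<bar>
      \<le> C' * real N powr (1 - 1 / (3 * \<tau> + 2) + \<epsilon>)" .
  qed
qed

end
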